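(* Let $\alpha$ be any virtual string. Then $$m([\alpha])\geq t(\mu([\alpha]))/2\geq \rho([\alpha])-1+O/2.$$ If the primitive based matrix $T_\bullet(\alpha)$ associated to $[\alpha]$ does not contain a self-complementary element, then $$m([\alpha])\geq t(\mu([\alpha]))/2\geq \rho([\alpha])+O/2.$$
   Context: Virtual strings. A virtual string $\alpha$ is an oriented circle $S^1$ (the core circle) with a finite set $\mathrm{arr}(\alpha)$ of arrows; an arrow is an ordered pair $(a,b)$ of points of $S^1$ with tail $a$ and head $b$, and all endpoints of arrows are pairwise distinct. Strings are considered up to orientation-preserving homeomorphism of the core circle. For distinct $x,y\in S^1$, $xy$ denotes the arc from $x$ to $y$ in the positive direction and $(xy)^\circ$ its interior. Two virtual strings are (virtually) homotopic if they are related by a finite sequence of the following moves and their inverses. Type 1: if the arc $ab$ contains no endpoints of arrows, add the arrow $(a,b)$ or the arrow $(b,a)$. Type 2: given two disjoint arcs containing no endpoints of arrows, the first with endpoints $a,a'$ (in either order) and the second with endpoints $b,b'$ (in either order), add the two arrows $(a,b)$ and $(b',a')$. Type 3a: given disjoint arcs $aa^+,bb^+,cc^+$ with no arrow endpoints in their interiors, such that $(a^+,b),(b^+,c),(c^+,a)$ are arrows, replace these by $(a,b^+),(b,c^+),(c,a^+)$. Type 3b: given such arcs where $(a,b),(a^+,c),(b^+,c^+)$ are arrows, replace these by $(a^+,b^+),(a,c^+),(b,c)$. The homotopy class of $\alpha$ is $[\alpha]$, and $m([\alpha])$ is the minimum of $|\mathrm{arr}(\beta)|$ over $\beta\in[\alpha]$.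 Signed singular virtual strings. A signed singular virtual string $\alpha_d^\epsilon$ is a virtual string $\alpha$ with a distinguished arrow $d\in\mathrm{arr}(\alpha)$ and a sign $\epsilon\in\{+,-\}$. Two of them are homotopic if related by a finite sequence of the following moves and inverses: Type 1, 2, 3 moves not involving the distinguished arrow; signed singular Type 2: if $e=(a,b)$ and $e'=(b',a')$ are arrows, where $a,a'$ and $b,b'$ are the endpoints of two disjoint arcs with no arrow endpoints in their interiors, and one of $e,e'$ is distinguished, make the other one distinguished instead and reverse the sign (no arrow is removed); signed singular Type 3: a Type 3a or 3b move in which one of the three arrows is distinguished, the arrow replacing it becomes distinguished, and the sign is kept. The class is written $[\alpha_d^\epsilon]$. A signed singular string is semi-trivial if its distinguished arrow $(a,b)$ is such that $(ab)^\circ$ or $(ba)^\circ$ contains no endpoint of an arrow; a homotopy class is semi-trivial if it contains a semi-trivial signed singular string. The operation $\mu$. Let $\mathcal{S}_0^\Theta$ be the set of homotopy classes of signed singular virtual strings that are not semi-trivial. Put $\mu([\alpha])=\sum_{e\in \mathrm{arr}(\alpha)}\big([\alpha_e^+]-[\alpha_e^-]\big)\in\mathbb{Z}[\mathcal{S}_0^\Theta]$, where semi-trivial classes are set equal to $0$; this depends only on $[\alpha]$. For a reduced linear combination $L=\sum_i a_ie_i$ in a free $\mathbb{Z}$-module with distinct basis elements $e_i$, $t(L)=\sum_i|a_i|$. Based matrices. A based matrix over an abelian group $H$ is a triple $(G,s,b)$ with $G$ a finite set, $s\in G$, and $b:G\times G\to H$ skew-symmetric ($b(g,h)=-b(h,g)$,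 $b(g,g)=0$). An element $g\in G-\{s\}$ is annihilating if $b(g,h)=0$ for all $h\in G$, and core if $b(g,h)=b(s,h)$ for all $h\in G$; two elements $g_1,g_2\in G-\{s\}$ are complementary if $b(g_1,h)+b(g_2,h)=b(s,h)$ for all $h\in G$. The moves $M_1,M_2,M_3$ (elementary extensions) enlarge $(G,s,b)$ to $(\bar G,s,\bar b)$ with $\bar b$ skew-symmetric extending $b$, by adding respectively one annihilating element, one core element, or a pair of complementary elements. Based matrices are homologous if related by a finite sequence of the $M_i$ and their inverses. A based matrix is primitive if it cannot be obtained from another based matrix by a sequence of $M_i$ moves. Isomorphisms are bijections preserving $s$ and $b$. An element $g\in G$ is self-complementary if $2b(g,h)=b(s,h)$ for all $h\in G$; $s$ is annihilating-like if $b(s,h)=0$ for all $h\in G$. The based matrix $T(\alpha)=(G,s,b)$ of a virtual string, over $\mathbb{Z}$: $G=\{s\}\sqcup\mathrm{arr}(\alpha)$. For arrows $e=(a,b)$, $f=(c,d)$, $f$ links $e$ positively if $c\in ab$ and $d\in ba$, and negatively if $c\in ba$ and $d\in ab$; otherwise they are unlinked. Set $b(e,s)=n(e)$, the number of arrows linking $e$ positively minus the number linking $e$ negatively, and $b(e,f)=ab\cdot cd+\sigma$, where $ab\cdot cd$ is the number of arrows with tail in $(ab)^\circ$ and head in $(cd)^\circ$ minus the number with tail in $(cd)^\circ$ and head in $(ab)^\circ$, and $\sigma=0,1,-1$ according as $e,f$ are unlinked, $f$ links $e$ positively, or $f$ links $e$ negatively. The remaining values are determined by skew-symmetry. By results of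 Turaev, homotopic strings have homologous based matrices and every homology class contains a primitive based matrix that is unique up to isomorphism; $T_\bullet(\alpha)$ (also written $T_\bullet([\alpha])$) denotes the primitive based matrix homologous to $T(\alpha)$, and $\rho([\alpha])=|T_\bullet(\alpha)|-1$, where $|(G,s,b)|$ is the cardinality of $G$. Signed singular based matrices. A signed singular based matrix is a tuple $(G,s,d,b,\epsilon)$ with $(G,s,b)$ a based matrix, $d\in G-\{s\}$ (the distinguished element) and $\epsilon\in\{+,-\}$. The extensions $M_1'',M_2'',M_3''$ add, respectively, an annihilating element, a core element, a pair of complementary elements (in all cases new elements different from $s,d$; their inverses remove such elements, all different from $s$ and $d$), keeping $s,d,\epsilon$. The move $N''$ replaces $(G,s,d,b,\epsilon)$ by $(G,s,g,b,-\epsilon)$ when $g$ and $d$ are complementary. Two such matrices are homologous if related by a finite sequence of $M_i''$, $N''$ and their inverses; isomorphisms are bijections preserving $s,d,b$ with equal signs. A signed singular based matrix is primitive if no inverse extension $(M_i'')^{-1}$ can be applied to it, either directly or after an $N''$ move. $T(\alpha_d^\epsilon)=(G,s,d,b,\epsilon)$ where $T(\alpha)=(G,s,b)$. The quantity $O$. A distinguished element $d$ of a signed singular based matrix is called core if $b(d,h)=b(s,h)$ for all $h\in G$, annihilating if $b(d,h)=0$ for all $h\in G$, and in either case is called ordinary if $s$ is not annihilating-like (equivalently, if $d$ is not self-complementary). If the homology class of $T(\alpha_e^\epsilon)$ contains a primitive matrix whose distinguished element is ordinary core or ordinary annihilating, then it contains (up to isomorphism) exactly two primitive matrices, with opposite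 signs; the one with sign $\epsilon$ is called the standard one. Let $C$ (respectively $A$) be the number of arrows $e\in\mathrm{arr}(\alpha)$ such that $[\alpha_e^+]$ is not semi-trivial and the distinguished element of the standard primitive matrix (the one with sign $+$) in the homology class of $T(\alpha_e^+)$ is an ordinary core (respectively ordinary annihilating) element. Put $O=|C-A|$. *)

theory Defs
  imports "HOL-Analysis.Analysis" "HOL-Library.Poly_Mapping"
begin

section \<open>The core circle\<close>

text \<open>
  Every oriented circle is identified with the unit circle of the complex plane, oriented
  counterclockwise.
\<close>

abbreviation S1 :: "complex set" where
  "S1 \<equiv> sphere 0 1"

text \<open>
  The interior of the arc \<open>xy\<close> from \<open>x\<close> to \<open>y\<close> in the positive direction. The quotient \<open>z / x\<close>
  rotates \<open>x\<close> to \<open>1\<close>, so \<open>Arg2pi (z / x)\<close> is the angle travelled from \<open>x\<close> to \<open>z\<close>.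
\<close>

definition arc_interior :: "complex \<Rightarrow> complex \<Rightarrow> complex set" where
  "arc_interior x y = {z \<in> S1. 0 < Arg2pi (z / x) \<and> Arg2pi (z / x) < Arg2pi (y / x)}"

definition circle_arc :: "complex \<Rightarrow> complex \<Rightarrow> complex set" where
  "circle_arc x y = {x, y} \<union> arc_interior x y"

definition orientation_preserving_homeo :: "(complex \<Rightarrow> complex) \<Rightarrow> bool" where
  "orientation_preserving_homeo h \<longleftrightarrow>
     (\<exists>k. homeomorphism S1 S1 h k) \<and>
     (\<forall>x\<in>S1. \<forall>y\<in>S1. \<forall>z\<in>S1. x \<noteq> y \<longrightarrow>
        (z \<in> arc_interior x y \<longleftrightarrow> h z \<in> arc_interior (h x) (h y)))"


section \<open>Virtual strings and homotopy\<close>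

text \<open>A virtual string is represented by its set of arrows; an arrow is a pair (tail, head).\<close>

type_synonym arrow = "complex \<times> complex"

definition endpoints :: "arrow set \<Rightarrow> complex set" where
  "endpoints \<alpha> = fst ` \<alpha> \<union> snd ` \<alpha>"

definition virtual_string :: "arrow set \<Rightarrow> bool" where
  "virtual_string \<alpha> \<longleftrightarrow>
     finite \<alpha> \<and> endpoints \<alpha> \<subseteq> S1 \<and>
     (\<forall>(a, b)\<in>\<alpha>. a \<noteq> b) \<and>
     (\<forall>(a, b)\<in>\<alpha>. \<forall>(c, d)\<in>\<alpha>. (a, b) \<noteq> (c, d) \<longrightarrow> {a, b} \<inter> {c, d} = {})"

definition type1 :: "arrow set \<Rightarrow> arrow set \<Rightarrow> bool" where
  "type1 \<alpha> \<beta> \<longleftrightarrow>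
     (\<exists>a\<in>S1. \<exists>b\<in>S1. a \<noteq> b \<and> circle_arc a b \<inter> endpoints \<alpha> = {} \<and>
        (\<beta> = insert (a, b) \<alpha> \<or> \<beta> = insert (b, a) \<alpha>))"

text \<open>
  Two disjoint arcs \<open>xx'\<close> and \<open>yy'\<close>, the first with endpoints \<open>a, a'\<close> and the second with
  endpoints \<open>b, b'\<close>, in either order.
\<close>

definition disjoint_arcs2 ::
  "complex \<Rightarrow> complex \<Rightarrow> complex \<Rightarrow> complex \<Rightarrow> complex \<Rightarrow> complex \<Rightarrow> complex \<Rightarrow> complex \<Rightarrow> bool" where
  "disjoint_arcs2 a a' b b' x x' y y' \<longleftrightarrow>
     {a, a', b, b'} \<subseteq> S1 \<and> a \<noteq> a' \<and> b \<noteq> b' \<and>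
     {x, x'} = {a, a'} \<and> {y, y'} = {b, b'} \<and>
     circle_arc x x' \<inter> circle_arc y y' = {}"

definition type2 :: "arrow set \<Rightarrow> arrow set \<Rightarrow> bool" where
  "type2 \<alpha> \<beta> \<longleftrightarrow>
     (\<exists>a a' b b' x x' y y'. disjoint_arcs2 a a' b b' x x' y y' \<and>
        (circle_arc x x' \<union> circle_arc y y') \<inter> endpoints \<alpha> = {} \<and>
        \<beta> = \<alpha> \<union> {(a, b), (b', a')})"

text \<open>The arcs \<open>aa\<^sup>+\<close>, \<open>bb\<^sup>+\<close>, \<open>cc\<^sup>+\<close> of a Type 3 move, with \<open>ap\<close> standing for \<open>a\<^sup>+\<close> etc.\<close>

definition type3_arcs ::
  "arrow set \<Rightarrow> complex \<Rightarrow> complex \<Rightarrow> complex \<Rightarrow> complex \<Rightarrow> complex \<Rightarrow> complex \<Rightarrow> bool" where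
  "type3_arcs \<alpha> a ap b bp c cp \<longleftrightarrow>
     {a, ap, b, bp, c, cp} \<subseteq> S1 \<and> a \<noteq> ap \<and> b \<noteq> bp \<and> c \<noteq> cp \<and>
     circle_arc a ap \<inter> circle_arc b bp = {} \<and>
     circle_arc b bp \<inter> circle_arc c cp = {} \<and>
     circle_arc a ap \<inter> circle_arc c cp = {} \<and>
     (arc_interior a ap \<union> arc_interior b bp \<union> arc_interior c cp) \<inter> endpoints \<alpha> = {}"

text \<open>
  \<open>type3_via R \<alpha> \<beta>\<close>: a Type 3a or 3b move turns \<open>\<alpha>\<close> into \<open>\<beta>\<close>, where \<open>R\<close> consists of the three
  pairs (arrow of \<open>\<alpha>\<close>, arrow replacing it in \<open>\<beta>\<close>).
\<close>

definition type3_via :: "(arrow \<times> arrow) set \<Rightarrow> arrow set \<Rightarrow> arrow set \<Rightarrow> bool" where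
  "type3_via R \<alpha> \<beta> \<longleftrightarrow>
     (\<exists>a ap b bp c cp. type3_arcs \<alpha> a ap b bp c cp \<and>
        (R = {((ap, b), (a, bp)), ((bp, c), (b, cp)), ((cp, a), (c, ap))} \<or>
         R = {((a, b), (ap, bp)), ((ap, c), (a, cp)), ((bp, cp), (b, c))})) \<and>
     Domain R \<subseteq> \<alpha> \<and> \<beta> = (\<alpha> - Domain R) \<union> Range R"

inductive string_move :: "arrow set \<Rightarrow> arrow set \<Rightarrow> bool" where
  homeo: "\<lbrakk>virtual_string \<alpha>; orientation_preserving_homeo h\<rbrakk>
      \<Longrightarrow> string_move \<alpha> (map_prod h h ` \<alpha>)"
| type1: "\<lbrakk>virtual_string \<alpha>; virtual_string \<beta>; type1 \<alpha> \<beta>\<rbrakk> \<Longrightarrow> string_move \<alpha> \<beta>"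
| type2: "\<lbrakk>virtual_string \<alpha>; virtual_string \<beta>; type2 \<alpha> \<beta>\<rbrakk> \<Longrightarrow> string_move \<alpha> \<beta>"
| type3: "\<lbrakk>virtual_string \<alpha>; virtual_string \<beta>; type3_via R \<alpha> \<beta>\<rbrakk> \<Longrightarrow> string_move \<alpha> \<beta>"

definition homotopy_class :: "arrow set \<Rightarrow> arrow set set" where
  "homotopy_class \<alpha> = {\<beta>. virtual_string \<beta> \<and> equivclp string_move \<alpha> \<beta>}"

definition min_arrows :: "arrow set set \<Rightarrow> nat" where
  "min_arrows X = (LEAST n. \<exists>\<beta>\<in>X. card \<beta> = n)"


section \<open>Signed singular virtual strings\<close>

datatype sign = Plus | Minus

fun flip :: "sign \<Rightarrow> sign" where
  "flip Plus = Minus"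
| "flip Minus = Plus"

type_synonym singular_string = "arrow set \<times> arrow \<times> sign"

text \<open>
  The rules for Types 1 and 2 keep the distinguished arrow, which therefore is neither added
  nor, for the inverse moves, removed.
\<close>

inductive singular_move :: "singular_string \<Rightarrow> singular_string \<Rightarrow> bool" where
  homeo: "\<lbrakk>virtual_string \<alpha>; d \<in> \<alpha>; orientation_preserving_homeo h\<rbrakk>
      \<Longrightarrow> singular_move (\<alpha>, d, \<epsilon>) (map_prod h h ` \<alpha>, map_prod h h d, \<epsilon>)"
| type1: "\<lbrakk>virtual_string \<alpha>; virtual_string \<beta>; d \<in> \<alpha>; type1 \<alpha> \<beta>\<rbrakk>
      \<Longrightarrow> singular_move (\<alpha>, d, \<epsilon>) (\<beta>, d, \<epsilon>)"
| type2: "\<lbrakk>virtual_string \<alpha>; virtual_string \<beta>; d \<in> \<alpha>; type2 \<alpha> \<beta>\<rbrakk>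
      \<Longrightarrow> singular_move (\<alpha>, d, \<epsilon>) (\<beta>, d, \<epsilon>)"
| type3: "\<lbrakk>virtual_string \<alpha>; virtual_string \<beta>; d \<in> \<alpha>; type3_via R \<alpha> \<beta>; d \<notin> Domain R\<rbrakk>
      \<Longrightarrow> singular_move (\<alpha>, d, \<epsilon>) (\<beta>, d, \<epsilon>)"
| singular_type2: "\<lbrakk>virtual_string \<alpha>; (a, b) \<in> \<alpha>; (b', a') \<in> \<alpha>;
      disjoint_arcs2 a a' b b' x x' y y';
      (arc_interior x x' \<union> arc_interior y y') \<inter> endpoints \<alpha> = {};
      (d, d') = ((a, b), (b', a')) \<or> (d, d') = ((b', a'), (a, b))\<rbrakk>
      \<Longrightarrow> singular_move (\<alpha>, d, \<epsilon>) (\<alpha>, d', flip \<epsilon>)"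
| singular_type3: "\<lbrakk>virtual_string \<alpha>; virtual_string \<beta>; type3_via R \<alpha> \<beta>; (d, d') \<in> R\<rbrakk>
      \<Longrightarrow> singular_move (\<alpha>, d, \<epsilon>) (\<beta>, d', \<epsilon>)"

definition singular_class :: "singular_string \<Rightarrow> singular_string set" where
  "singular_class x =
     {(\<beta>, d, \<epsilon>). virtual_string \<beta> \<and> d \<in> \<beta> \<and> equivclp singular_move x (\<beta>, d, \<epsilon>)}"

fun semi_trivial :: "singular_string \<Rightarrow> bool" where
  "semi_trivial (\<alpha>, (a, b), \<epsilon>) \<longleftrightarrow>
     arc_interior a b \<inter> endpoints \<alpha> = {} \<or> arc_interior b a \<inter> endpoints \<alpha> = {}"

definition semi_trivial_class :: "singular_string set \<Rightarrow> bool" where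
  "semi_trivial_class X \<longleftrightarrow> (\<exists>x\<in>X. semi_trivial x)"


section \<open>The operation \<open>\<mu>\<close>\<close>

text \<open>
  Elements of the free module are finitely supported integer functions on the set of homotopy
  classes; semi-trivial classes never occur in the support of \<open>\<mu>\<close>.
\<close>

definition class_generator :: "singular_string \<Rightarrow> singular_string set \<Rightarrow>\<^sub>0 int" where
  "class_generator x =
     (if semi_trivial_class (singular_class x) then 0
      else Poly_Mapping.single (singular_class x) 1)"

text \<open>
  \<open>\<mu>\<close> is written as a function of a representative of the homotopy class, by the defining sum
  over its arrows.
\<close>

definition mu :: "arrow set \<Rightarrow> singular_string set \<Rightarrow>\<^sub>0 int" where
  "mu \<alpha> = (\<Sum>e\<in>\<alpha>. class_generator (\<alpha>, e, Plus) - class_generator (\<alpha>, e, Minus))"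

definition coeff_sum :: "('a \<Rightarrow>\<^sub>0 int) \<Rightarrow> int" where
  "coeff_sum L = (\<Sum>c\<in>Poly_Mapping.keys L. \<bar>Poly_Mapping.lookup L c\<bar>)"


section \<open>Based matrices\<close>

text \<open>Only the values of \<open>bform\<close> on \<open>elems \<times> elems\<close> are meaningful.\<close>

record ('a, 'h) bmat =
  elems :: "'a set"
  base :: 'a
  bform :: "'a \<Rightarrow> 'a \<Rightarrow> 'h"

definition based_matrix :: "('a, 'h::ab_group_add) bmat \<Rightarrow> bool" where
  "based_matrix M \<longleftrightarrow>
     finite (elems M) \<and> base M \<in> elems M \<and>
     (\<forall>g\<in>elems M. \<forall>h\<in>elems M. bform M g h = - bform M h g) \<and>
     (\<forall>g\<in>elems M. bform M g g = 0)"

definition annihilating :: "('a, 'h::ab_group_add) bmat \<Rightarrow> 'a \<Rightarrow> bool" where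
  "annihilating M g \<longleftrightarrow> g \<in> elems M - {base M} \<and> (\<forall>h\<in>elems M. bform M g h = 0)"

definition core :: "('a, 'h::ab_group_add) bmat \<Rightarrow> 'a \<Rightarrow> bool" where
  "core M g \<longleftrightarrow> g \<in> elems M - {base M} \<and> (\<forall>h\<in>elems M. bform M g h = bform M (base M) h)"

definition complementary :: "('a, 'h::ab_group_add) bmat \<Rightarrow> 'a \<Rightarrow> 'a \<Rightarrow> bool" where
  "complementary M g1 g2 \<longleftrightarrow>
     g1 \<in> elems M - {base M} \<and> g2 \<in> elems M - {base M} \<and>
     (\<forall>h\<in>elems M. bform M g1 h + bform M g2 h = bform M (base M) h)"

text \<open>The base itself is allowed; it is self-complementary iff it is annihilating-like.\<close>

definition self_complementary :: "('a, 'h::ab_group_add) bmat \<Rightarrow> 'a \<Rightarrow> bool" where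
  "self_complementary M g \<longleftrightarrow>
     g \<in> elems M \<and> (\<forall>h\<in>elems M. bform M g h + bform M g h = bform M (base M) h)"

definition annihilating_like :: "('a, 'h::ab_group_add) bmat \<Rightarrow> bool" where
  "annihilating_like M \<longleftrightarrow> (\<forall>h\<in>elems M. bform M (base M) h = 0)"

definition extends :: "('a, 'h::ab_group_add) bmat \<Rightarrow> ('a, 'h) bmat \<Rightarrow> 'a set \<Rightarrow> bool" where
  "extends M M' N \<longleftrightarrow>
     based_matrix M \<and> based_matrix M' \<and>
     N \<inter> elems M = {} \<and> elems M' = elems M \<union> N \<and> base M' = base M \<and>
     (\<forall>g\<in>elems M. \<forall>h\<in>elems M. bform M' g h = bform M g h)"

definition M1 :: "('a, 'h::ab_group_add) bmat \<Rightarrow> ('a, 'h) bmat \<Rightarrow> bool" where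
  "M1 M M' \<longleftrightarrow> (\<exists>g. extends M M' {g} \<and> annihilating M' g)"

definition M2 :: "('a, 'h::ab_group_add) bmat \<Rightarrow> ('a, 'h) bmat \<Rightarrow> bool" where
  "M2 M M' \<longleftrightarrow> (\<exists>g. extends M M' {g} \<and> core M' g)"

definition M3 :: "('a, 'h::ab_group_add) bmat \<Rightarrow> ('a, 'h) bmat \<Rightarrow> bool" where
  "M3 M M' \<longleftrightarrow> (\<exists>g1 g2. g1 \<noteq> g2 \<and> extends M M' {g1, g2} \<and> complementary M' g1 g2)"

definition extension :: "('a, 'h::ab_group_add) bmat \<Rightarrow> ('a, 'h) bmat \<Rightarrow> bool" where
  "extension M M' \<longleftrightarrow> M1 M M' \<or> M2 M M' \<or> M3 M M'"

text \<open>
  Isomorphisms need not be listed as generators: if the carrier type is infinite, an element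
  \<open>g\<close> other than the base is renamed to \<open>g'\<close> by adding a complementary pair \<open>g', g''\<close> where
  \<open>g'\<close> has the same values as \<open>g\<close>, and then removing the complementary pair \<open>g, g''\<close>.
\<close>

definition homologous :: "('a, 'h::ab_group_add) bmat \<Rightarrow> ('a, 'h) bmat \<Rightarrow> bool" where
  "homologous = equivclp extension"

definition primitive :: "('a, 'h::ab_group_add) bmat \<Rightarrow> bool" where
  "primitive M \<longleftrightarrow> based_matrix M \<and> \<not> (\<exists>M'. extension\<^sup>+\<^sup>+ M' M)"


section \<open>The based matrix of a virtual string\<close>

text \<open>
  Endpoints of distinct arrows are distinct, so it does not matter that open arcs are used; with
  open arcs an arrow does not link itself.
\<close>

fun links_pos :: "arrow \<Rightarrow> arrow \<Rightarrow> bool" where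
  "links_pos (c, d) (a, b) \<longleftrightarrow> c \<in> arc_interior a b \<and> d \<in> arc_interior b a"

fun links_neg :: "arrow \<Rightarrow> arrow \<Rightarrow> bool" where
  "links_neg (c, d) (a, b) \<longleftrightarrow> c \<in> arc_interior b a \<and> d \<in> arc_interior a b"

definition link_number :: "arrow set \<Rightarrow> arrow \<Rightarrow> int" where
  "link_number \<alpha> e =
     int (card {f \<in> \<alpha>. links_pos f e}) - int (card {f \<in> \<alpha>. links_neg f e})"

definition arc_product :: "arrow set \<Rightarrow> arrow \<Rightarrow> arrow \<Rightarrow> int" where
  "arc_product \<alpha> = (\<lambda>(a, b) (c, d).
     int (card {(p, q) \<in> \<alpha>. p \<in> arc_interior a b \<and> q \<in> arc_interior c d}) -
     int (card {(p, q) \<in> \<alpha>. p \<in> arc_interior c d \<and> q \<in> arc_interior a b}))"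

definition link_sign :: "arrow \<Rightarrow> arrow \<Rightarrow> int" where
  "link_sign e f = (if links_pos f e then 1 else if links_neg f e then - 1 else 0)"

text \<open>The base \<open>s\<close> is \<open>None\<close>.\<close>

fun string_form :: "arrow set \<Rightarrow> arrow option \<Rightarrow> arrow option \<Rightarrow> int" where
  "string_form \<alpha> None None = 0"
| "string_form \<alpha> (Some e) None = link_number \<alpha> e"
| "string_form \<alpha> None (Some e) = - link_number \<alpha> e"
| "string_form \<alpha> (Some e) (Some f) = arc_product \<alpha> e f + link_sign e f"

definition string_matrix :: "arrow set \<Rightarrow> (arrow option, int) bmat" where
  "string_matrix \<alpha> =
     \<lparr>elems = insert None (Some ` \<alpha>), base = None, bform = string_form \<alpha>\<rparr>"

text \<open>\<open>T\<^sub>\<bullet>(\<alpha>)\<close>, which is determined up to isomorphism.\<close>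

definition primitive_matrix :: "arrow set \<Rightarrow> (arrow option, int) bmat" where
  "primitive_matrix \<alpha> = (SOME M. primitive M \<and> homologous (string_matrix \<alpha>) M)"

definition rho :: "arrow set \<Rightarrow> nat" where
  "rho \<alpha> = card (elems (primitive_matrix \<alpha>)) - 1"


section \<open>Signed singular based matrices\<close>

record ('a, 'h) sbmat =
  underlying :: "('a, 'h) bmat"
  dist_elem :: 'a
  sgn_of :: sign

definition singular_matrix :: "('a, 'h::ab_group_add) sbmat \<Rightarrow> bool" where
  "singular_matrix P \<longleftrightarrow>
     based_matrix (underlying P) \<and> dist_elem P \<in> elems (underlying P) - {base (underlying P)}"

text \<open>
  The elements added by \<open>extension\<close> are not in the smaller matrix, which contains the
  distinguished element; so the latter is neither added nor removed.
\<close>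

definition singular_extension ::
  "('a, 'h::ab_group_add) sbmat \<Rightarrow> ('a, 'h) sbmat \<Rightarrow> bool" where
  "singular_extension P Q \<longleftrightarrow>
     singular_matrix P \<and> singular_matrix Q \<and> extension (underlying P) (underlying Q) \<and>
     dist_elem Q = dist_elem P \<and> sgn_of Q = sgn_of P"

definition N_move :: "('a, 'h::ab_group_add) sbmat \<Rightarrow> ('a, 'h) sbmat \<Rightarrow> bool" where
  "N_move P Q \<longleftrightarrow>
     singular_matrix P \<and>
     (\<exists>g. complementary (underlying P) g (dist_elem P) \<and>
        Q = \<lparr>underlying = underlying P, dist_elem = g, sgn_of = flip (sgn_of P)\<rparr>)"

definition singular_homologous ::
  "('a, 'h::ab_group_add) sbmat \<Rightarrow> ('a, 'h) sbmat \<Rightarrow> bool" where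
  "singular_homologous = equivclp (\<lambda>P Q. singular_extension P Q \<or> N_move P Q)"

definition singular_primitive :: "('a, 'h::ab_group_add) sbmat \<Rightarrow> bool" where
  "singular_primitive P \<longleftrightarrow>
     singular_matrix P \<and>
     \<not> (\<exists>Q. singular_extension Q P) \<and>
     \<not> (\<exists>P' Q. N_move P P' \<and> singular_extension Q P')"

fun singular_string_matrix :: "singular_string \<Rightarrow> (arrow option, int) sbmat" where
  "singular_string_matrix (\<alpha>, d, \<epsilon>) =
     \<lparr>underlying = string_matrix \<alpha>, dist_elem = Some d, sgn_of = \<epsilon>\<rparr>"


section \<open>The quantity \<open>O\<close>\<close>

definition ordinary_core :: "('a, 'h::ab_group_add) sbmat \<Rightarrow> bool" where
  "ordinary_core P \<longleftrightarrow> core (underlying P) (dist_elem P) \<and> \<not> annihilating_like (underlying P)"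

definition ordinary_annihilating :: "('a, 'h::ab_group_add) sbmat \<Rightarrow> bool" where
  "ordinary_annihilating P \<longleftrightarrow>
     annihilating (underlying P) (dist_elem P) \<and> \<not> annihilating_like (underlying P)"

text \<open>\<open>P\<close> is the standard primitive matrix, unique up to isomorphism, in the class of \<open>T\<close>.\<close>

definition standard_primitive ::
  "('a, 'h::ab_group_add) sbmat \<Rightarrow> ('a, 'h) sbmat \<Rightarrow> bool" where
  "standard_primitive T P \<longleftrightarrow>
     (\<exists>Q. singular_homologous T Q \<and> singular_primitive Q \<and>
        (ordinary_core Q \<or> ordinary_annihilating Q)) \<and>
     singular_homologous T P \<and> singular_primitive P \<and> sgn_of P = sgn_of T"

definition num_core :: "arrow set \<Rightarrow> nat" where
  "num_core \<alpha> = card {e \<in> \<alpha>. \<not> semi_trivial_class (singular_class (\<alpha>, e, Plus)) \<and>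
     (\<exists>P. standard_primitive (singular_string_matrix (\<alpha>, e, Plus)) P \<and> ordinary_core P)}"

definition num_annihilating :: "arrow set \<Rightarrow> nat" where
  "num_annihilating \<alpha> = card {e \<in> \<alpha>. \<not> semi_trivial_class (singular_class (\<alpha>, e, Plus)) \<and>
     (\<exists>P. standard_primitive (singular_string_matrix (\<alpha>, e, Plus)) P \<and>
        ordinary_annihilating P)}"

definition O_number :: "arrow set \<Rightarrow> int" where
  "O_number \<alpha> = \<bar>int (num_core \<alpha>) - int (num_annihilating \<alpha>)\<bar>"

end

theory Submission
  imports Defs
begin

text \<open>
  For the upper bound, the sum \<open>\<mu>\<close> only depends on the homotopy class (\<open>mu_homotopic\<close>): an arrow added
  by a Type 1 move is semi-trivial, and the two arrows added by a Type 2 move have the same classes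
  with opposite signs. A string with \<open>n\<close> arrows contributes at most \<open>2 n\<close> generators to \<open>\<mu>\<close>, and
  taking a representative with the fewest arrows gives \<open>t(\<mu>) \<le> 2 m\<close>.

  For the lower bound: if a function \<open>\<phi>\<close> on classes takes values in \<open>[-1, 1]\<close>, then \<open>t(\<mu>)\<close> is at least
  the value at \<open>\<mu>\<close> of the corresponding linear functional (\<open>evaluate_le_coeff_sum\<close>). Let \<open>H\<close> be the
  primitive matrix \<open>T\<^sub>\<bullet>(\<alpha>)\<close>, and let \<open>\<rho>'\<close> be the number of elements of \<open>H\<close>, apart from the base,
  that are not self-complementary. Since \<open>H\<close> has at most one self-complementary element besides
  the base, \<open>\<rho>'\<close> is \<open>\<rho>\<close> or \<open>\<rho> - 1\<close>. It therefore suffices to find \<open>\<phi>\<close> with value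
  \<open>2 \<rho>' + 2 O\<close> at \<open>\<mu>\<close>. The function \<open>\<phi>\<close> is read off from the homology class of the matrix of a
  signed singular string, which is a homotopy invariant (\<open>homotopic_homologous\<close>), and it is a sum
  of two functions with disjoint supports.

  The first one (\<open>mark_index\<close>) detects the elements of \<open>H\<close>. To get rid of the \<open>N\<close>-moves, a
  protected element is added to a singular matrix, whose row is the row of the distinguished
  element if the sign is plus, and the row of \<open>s\<close> minus it if the sign is minus. An \<open>N\<close>-move does
  not change this row. What remains are extensions and their inverses, and removal of elements is
  confluent up to isomorphism, so the marked matrix has a unique irreducible form
  (\<open>protected_normal_form_unique\<close>). For \<open>h\<close> in \<open>H\<close> the marked matrices of \<open>(H, h, +)\<close> and
  \<open>(H, h', -)\<close> are irreducible, and not isomorphic unless \<open>h'\<close> is self-complementary. The first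
  function is \<open>1\<close> on matrices that are homologous, after marking, to some \<open>(H, h, +)\<close> with \<open>h\<close> not
  self-complementary, \<open>-1\<close> in the case of \<open>(H, h, -)\<close>, and \<open>0\<close> otherwise. Summed with signs over
  all choices of a distinguished element in a based matrix, it gives a homology invariant of
  the based matrix (\<open>total_index_extension\<close>), as new annihilating and core elements contribute
  zero and complementary pairs cancel by an \<open>N\<close>-move. So the sum for \<open>\<alpha>\<close> equals the sum for \<open>H\<close>,
  which is \<open>2 \<rho>'\<close>.

  The second function is, up to a global sign, the indicator function of the classes with a
  primitive matrix whose distinguished element is ordinary core and whose sign is plus, minus the
  same for ordinary annihilating elements. An ordinary core element with one sign can be exchanged for
  an ordinary annihilating element with the other sign (\<open>ordinary_swap\<close>), and so every arrow counted
  in \<open>C\<close> or \<open>A\<close> contributes twice, which adds up to \<open>2 \<bar>C - A\<bar>\<close>. The marked row of such a class,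
  and of a semi-trivial one, is zero or the row of \<open>s\<close>, which never happens for an element of a
  primitive matrix. Hence the supports are disjoint, and setting semi-trivial classes to zero does not
  affect the first sum.

  Invariance of the matrix is proved by writing it as a single skew form, evaluated at indicator
  functions of arcs whose boundary points count half (\<open>string_form_wedge\<close>). A move changes these
  functions at a few points only.
\<close>

section \<open>Removing elements from based matrices\<close>

text \<open>
  The three extensions are treated in reverse and uniformly: a set is removable if adding it
  back is one of \<open>M\<^sub>1\<close>, \<open>M\<^sub>2\<close>, \<open>M\<^sub>3\<close>.
\<close>

definition removable :: "('a, 'h::ab_group_add) bmat \<Rightarrow> 'a set \<Rightarrow> bool" where
  "removable M D \<longleftrightarrow>
     (\<exists>g. D = {g} \<and> (annihilating M g \<or> core M g)) \<or>
     (\<exists>g1 g2. g1 \<noteq> g2 \<and> D = {g1, g2} \<and> complementary M g1 g2)"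

definition remove :: "('a, 'h) bmat \<Rightarrow> 'a set \<Rightarrow> ('a, 'h) bmat" where
  "remove M D = M\<lparr>elems := elems M - D\<rparr>"

lemma remove_simps [simp]:
  "elems (remove M D) = elems M - D" "base (remove M D) = base M" "bform (remove M D) = bform M"
  by (simp_all add: remove_def)

lemma remove_remove [simp]: "remove (remove M D) E = remove M (D \<union> E)"
  by (simp add: remove_def Diff_Diff_Int Diff_eq Int_assoc)

lemma removable_subset: "removable M D \<Longrightarrow> D \<subseteq> elems M - {base M}"
  by (auto simp: removable_def annihilating_def core_def complementary_def)

lemma removable_nonempty: "removable M D \<Longrightarrow> D \<noteq> {}"
  by (auto simp: removable_def)

lemma extension_iff: "extension M M' \<longleftrightarrow> (\<exists>D. extends M M' D \<and> removable M' D)"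
proof
  assume "extension M M'"
  then show "\<exists>D. extends M M' D \<and> removable M' D"
    unfolding extension_def M1_def M2_def M3_def removable_def by (elim disjE exE conjE) metis+
next
  assume "\<exists>D. extends M M' D \<and> removable M' D"
  then show "extension M M'"
    unfolding extension_def M1_def M2_def M3_def removable_def by (elim disjE exE conjE) auto
qed

lemma extends_remove:
  assumes "based_matrix M" "D \<subseteq> elems M - {base M}"
  shows "extends (remove M D) M D"
proof -
  have "based_matrix (remove M D)"
    using assms unfolding based_matrix_def remove_simps by blast
  with assms show ?thesis by (auto simp: extends_def)
qed

lemma primitive_not_removable:
  assumes "primitive M" shows "\<not> removable M D"
proof
  assume D: "removable M D"
  with assms have "extension (remove M D) M"
    by (auto simp: extension_iff primitive_def dest: removable_subset intro: extends_remove)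
  with assms show False by (auto simp: primitive_def)
qed

lemma complementary_sym: "complementary M g h \<Longrightarrow> complementary M h g"
  by (auto simp: complementary_def add.commute)

lemma removable_at:
  assumes "removable M D" "c \<in> D"
  shows "D = {c} \<and> (annihilating M c \<or> core M c) \<or> (\<exists>k. k \<noteq> c \<and> D = {c, k} \<and> complementary M c k)"
  using assms unfolding removable_def by (metis complementary_sym insertE insert_commute singletonD)

text \<open>
  Being annihilating, core or complementary is a universally quantified condition on columns, so
  it survives the loss of columns. This makes disjoint removals commute.
\<close>

lemma removable_remove:
  assumes "removable M D" "D \<inter> E = {}"
  shows "removable (remove M E) D"
  using assms unfolding removable_def
  by (elim disjE exE conjE)
     (fastforce simp: annihilating_def core_def complementary_def)+

text \<open>
  The partner of an annihilating element is core and vice versa; hence such a complementary pair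
  can also be removed one element at a time.
\<close>

lemma complementary_partner_of_removed:
  assumes "complementary M c k" "k \<noteq> c" "annihilating M c \<or> core M c"
  shows "removable (remove M {c}) {k}"
proof -
  have "annihilating M k \<or> core M k"
    using assms by (auto simp: annihilating_def core_def complementary_def)
  then have "removable M {k}" by (auto simp: removable_def)
  then show ?thesis using assms(2) by (intro removable_remove) auto
qed

section \<open>Normal forms of matrices with a protected element\<close>

abbreviation melems :: "('a, 'h) sbmat \<Rightarrow> 'a set" where
  "melems P \<equiv> elems (underlying P)"

abbreviation mbase :: "('a, 'h) sbmat \<Rightarrow> 'a" where
  "mbase P \<equiv> base (underlying P)"

abbreviation mform :: "('a, 'h) sbmat \<Rightarrow> 'a \<Rightarrow> 'a \<Rightarrow> 'h" where
  "mform P \<equiv> bform (underlying P)"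

abbreviation smat :: "('a, 'h) bmat \<Rightarrow> 'a \<Rightarrow> sign \<Rightarrow> ('a, 'h) sbmat" where
  "smat M d \<epsilon> \<equiv> \<lparr>underlying = M, dist_elem = d, sgn_of = \<epsilon>\<rparr>"

definition singular_iso ::
  "('a \<Rightarrow> 'b) \<Rightarrow> ('a, 'h) sbmat \<Rightarrow> ('b, 'h) sbmat \<Rightarrow> bool" where
  "singular_iso f P Q \<longleftrightarrow>
     bij_betw f (melems P) (melems Q) \<and>
     f (mbase P) = mbase Q \<and> f (dist_elem P) = dist_elem Q \<and>
     sgn_of P = sgn_of Q \<and>
     (\<forall>g\<in>melems P. \<forall>h\<in>melems P.
        mform Q (f g) (f h) = mform P g h)"

lemma singular_iso_refl: "singular_iso id P P"
  by (simp add: singular_iso_def)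

lemma singular_iso_trans:
  assumes "singular_iso f P Q" "singular_iso g Q R" shows "singular_iso (g \<circ> f) P R"
proof -
  have "bij_betw (g \<circ> f) (melems P) (melems R)"
    using assms unfolding singular_iso_def by (blast intro: bij_betw_trans)
  then show ?thesis
    using assms unfolding singular_iso_def by (auto dest: bij_betwE)
qed

lemma singular_iso_sym:
  assumes "singular_iso f P Q" "singular_matrix P"
  shows "singular_iso (inv_into (melems P) f) Q P"
proof -
  let ?i = "inv_into (melems P) f"
  have inj: "inj_on f (melems P)"
    using assms(1) by (auto simp: singular_iso_def bij_betw_def)
  have "mform P (?i g) (?i h) = mform Q g h"
    if gh: "g \<in> melems Q" "h \<in> melems Q" for g h
  proof -
    obtain x y where "x \<in> melems P" "y \<in> melems P" "g = f x" "h = f y"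
      using gh assms(1) unfolding singular_iso_def bij_betw_def by blast
    then show ?thesis using assms(1) inj by (simp add: singular_iso_def)
  qed
  moreover have "mbase P \<in> melems P" "dist_elem P \<in> melems P"
    using assms(2) unfolding singular_matrix_def based_matrix_def by blast+
  ultimately show ?thesis
    using assms(1) inj unfolding singular_iso_def
    by (metis bij_betw_inv_into inv_into_f_f)
qed

lemma based_matrix_remove:
  "based_matrix M \<Longrightarrow> base M \<notin> D \<Longrightarrow> based_matrix (remove M D)"
  unfolding based_matrix_def remove_simps by blast

lemma singular_iso_matrix:
  assumes "singular_iso f P Q" "singular_matrix P" shows "singular_matrix Q"
proof -
  have im: "melems Q = f ` melems P"
    and inj: "inj_on f (melems P)"
    using assms(1) by (auto simp: singular_iso_def bij_betw_def)
  have "dist_elem Q \<noteq> mbase Q"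
    using assms inj unfolding singular_iso_def singular_matrix_def based_matrix_def inj_on_def
    by (metis DiffD1 DiffD2 singletonI)
  moreover have "based_matrix (underlying Q)"
    unfolding based_matrix_def
  proof (intro conjI ballI)
    have P: "based_matrix (underlying P)" using assms(2) by (simp add: singular_matrix_def)
    show "finite (melems Q)"
      using P unfolding im based_matrix_def by blast
    show "mbase Q \<in> melems Q"
      using P assms(1) unfolding im based_matrix_def singular_iso_def by (metis imageI)
    have b: "mform Q (f x) (f y) = mform P x y"
      if "x \<in> melems P" "y \<in> melems P" for x y
      using that assms(1) by (simp add: singular_iso_def)
    fix g h assume g: "g \<in> melems Q"
    then obtain x where x: "x \<in> melems P" "g = f x" by (auto simp: im)
    show "mform Q g g = 0"
      using P x b[OF x(1) x(1)] unfolding based_matrix_def by metis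
    assume "h \<in> melems Q"
    then obtain y where y: "y \<in> melems P" "h = f y" by (auto simp: im)
    have "mform P x y = - mform P y x"
      using P x(1) y(1) unfolding based_matrix_def by blast
    then show "mform Q g h = - mform Q h g"
      using x y by (simp only: b)
  qed
  ultimately show ?thesis
    using assms unfolding singular_matrix_def singular_iso_def im by (metis DiffD1 DiffI imageI singletonD)
qed

text \<open>
  For removals the distinguished element only plays the part of a second protected element
  besides the base.
\<close>

definition sremovable :: "('a, 'h::ab_group_add) sbmat \<Rightarrow> 'a set \<Rightarrow> bool" where
  "sremovable P D \<longleftrightarrow> removable (underlying P) D \<and> dist_elem P \<notin> D"

definition sremove :: "('a, 'h) sbmat \<Rightarrow> 'a set \<Rightarrow> ('a, 'h) sbmat" where
  "sremove P D = P\<lparr>underlying := remove (underlying P) D\<rparr>"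

lemma sremove_simps [simp]:
  "underlying (sremove P D) = remove (underlying P) D"
  "dist_elem (sremove P D) = dist_elem P" "sgn_of (sremove P D) = sgn_of P"
  by (simp_all add: sremove_def)

lemma sremove_sremove [simp]: "sremove (sremove P D) E = sremove P (D \<union> E)"
  by (simp add: sremove_def)

lemma singular_matrix_sremove:
  assumes "singular_matrix P" "sremovable P D" shows "singular_matrix (sremove P D)"
  using assms removable_subset[of "underlying P" D]
  by (auto simp: singular_matrix_def sremovable_def intro!: based_matrix_remove)

lemma singular_extension_sremove:
  assumes "singular_matrix P" "sremovable P D" shows "singular_extension (sremove P D) P"
  using assms singular_matrix_sremove[OF assms] removable_subset[of "underlying P" D]
  by (auto simp: singular_extension_def extension_iff sremovable_def singular_matrix_def
      intro!: exI[of _ D] extends_remove)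

lemma singular_extensionE:
  assumes "singular_extension P Q"
  obtains D where "sremovable Q D" "singular_iso id P (sremove Q D)"
proof -
  obtain D where D: "extends (underlying P) (underlying Q) D" "removable (underlying Q) D"
    using assms by (auto simp: singular_extension_def extension_iff)
  have "dist_elem Q \<notin> D"
    using assms D(1) by (auto simp: singular_extension_def extends_def singular_matrix_def)
  then have "sremovable Q D" using D by (simp add: sremovable_def)
  moreover have "melems Q - D = melems P"
    using D(1) by (auto simp: extends_def)
  then have "singular_iso id P (sremove Q D)"
    using assms D(1) by (auto simp: singular_iso_def singular_extension_def extends_def)
  ultimately show ?thesis using that by blast
qed

lemma removable_iso:
  assumes iso: "singular_iso f P Q" and P: "singular_matrix P" and D: "sremovable P D"
  shows "sremovable Q (f ` D)" "singular_iso f (sremove P D) (sremove Q (f ` D))"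
proof -
  let ?M = "underlying P" and ?N = "underlying Q"
  have im: "elems ?N = f ` elems ?M" and inj: "inj_on f (elems ?M)"
    and s: "base ?N = f (base ?M)" and d: "dist_elem Q = f (dist_elem P)"
    and b: "\<And>g h. g \<in> elems ?M \<Longrightarrow> h \<in> elems ?M \<Longrightarrow> bform ?N (f g) (f h) = bform ?M g h"
    using iso by (auto simp: singular_iso_def bij_betw_def)
  have sM: "base ?M \<in> elems ?M" "dist_elem P \<in> elems ?M"
    using P unfolding singular_matrix_def based_matrix_def by blast+
  have sub: "D \<subseteq> elems ?M - {base ?M}" "dist_elem P \<notin> D"
    using D removable_subset by (auto simp: sremovable_def)
  have ne: "f g \<noteq> base ?N" if "g \<in> elems ?M - {base ?M}" for g
    using that inj sM by (auto simp: s dest: inj_onD)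
  have ann: "annihilating ?N (f g)" if "annihilating ?M g" for g
    using that ne sM by (auto simp: annihilating_def im b)
  have cor: "core ?N (f g)" if "core ?M g" for g
    using that ne sM by (auto simp: core_def im b s)
  have com: "complementary ?N (f g) (f h)" if "complementary ?M g h" for g h
    using that ne sM by (auto simp: complementary_def im b s)
  consider g where "D = {g}" "annihilating ?M g \<or> core ?M g"
    | g1 g2 where "g1 \<noteq> g2" "D = {g1, g2}" "complementary ?M g1 g2"
    using D unfolding sremovable_def removable_def by blast
  then have "removable ?N (f ` D)"
  proof cases
    case 1
    then show ?thesis using ann cor by (auto simp: removable_def)
  next
    case 2
    moreover have "f g1 \<noteq> f g2"
      using 2 inj by (auto simp: complementary_def dest: inj_onD)
    ultimately show ?thesis using com[of g1 g2] by (auto simp: removable_def)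
  qed
  moreover have "dist_elem Q \<notin> f ` D"
    using sub sM inj unfolding d inj_on_def by blast
  ultimately show "sremovable Q (f ` D)" by (simp add: sremovable_def)
  have "bij_betw f (elems ?M - D) (elems ?N - f ` D)"
    using inj sub(1) by (auto simp: bij_betw_def im inj_on_def)
  then show "singular_iso f (sremove P D) (sremove Q (f ` D))"
    using iso by (auto simp: singular_iso_def)
qed

text \<open>
  The diamond property. Disjoint removals commute. Overlapping ones either consist of a pair and
  one of its members, which is handled by removing the partner as well, or of two pairs
  \<open>{c, k}\<close> and \<open>{c, l}\<close>; then \<open>k\<close> and \<open>l\<close> have equal rows and it does not matter which of them
  is left.
\<close>

lemma local_confluence:
  assumes P: "singular_matrix P" and D: "sremovable P D" and E: "sremovable P E"
  shows "(\<exists>f. singular_iso f (sremove P D) (sremove P E)) \<or>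
    (\<exists>D' E'. (D' = {} \<or> sremovable (sremove P D) D') \<and>
             (E' = {} \<or> sremovable (sremove P E) E') \<and> D \<union> D' = E \<union> E')"
proof (cases "D \<inter> E = {}")
  case True
  then have "sremovable (sremove P D) E \<and> sremovable (sremove P E) D"
    using D E by (auto simp: sremovable_def intro!: removable_remove)
  then show ?thesis by (intro disjI2 exI[of _ E] exI[of _ D]) auto
next
  case False
  let ?M = "underlying P"
  obtain c where c: "c \<in> D" "c \<in> E" using False by blast
  have Dc: "D = {c} \<and> (annihilating ?M c \<or> core ?M c) \<or>
      (\<exists>k. k \<noteq> c \<and> D = {c, k} \<and> complementary ?M c k)"
    and Ec: "E = {c} \<and> (annihilating ?M c \<or> core ?M c) \<or>
      (\<exists>k. k \<noteq> c \<and> E = {c, k} \<and> complementary ?M c k)"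
    using D E c removable_at[of ?M] unfolding sremovable_def by blast+
  show ?thesis
  proof (cases "D = E")
    case True
    then show ?thesis using singular_iso_refl by blast
  next
    case ne: False
    consider (l) k where "D = {c}" "annihilating ?M c \<or> core ?M c" "k \<noteq> c" "E = {c, k}"
        "complementary ?M c k"
      | (r) k where "E = {c}" "annihilating ?M c \<or> core ?M c" "k \<noteq> c" "D = {c, k}"
        "complementary ?M c k"
      | (b) k l where "k \<noteq> c" "D = {c, k}" "complementary ?M c k"
          "l \<noteq> c" "E = {c, l}" "complementary ?M c l"
      using Dc Ec ne by auto
    then show ?thesis
    proof cases
      case l
      then have "sremovable (sremove P D) {k}"
        using E complementary_partner_of_removed[OF l(5,3,2)] by (auto simp: sremovable_def)
      then show ?thesis using l by (intro disjI2 exI[of _ "{k}"] exI[of _ "{}"]) auto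
    next
      case r
      then have "sremovable (sremove P E) {k}"
        using D complementary_partner_of_removed[OF r(5,3,2)] by (auto simp: sremovable_def)
      then show ?thesis using r by (intro disjI2 exI[of _ "{}"] exI[of _ "{k}"]) auto
    next
      case b
      have kl: "k \<noteq> l" using b ne by auto
      have mem: "c \<in> elems ?M" "k \<in> elems ?M" "l \<in> elems ?M" "k \<noteq> base ?M" "l \<noteq> base ?M"
        using b by (auto simp: complementary_def)
      have row: "bform ?M k h = bform ?M l h" if "h \<in> elems ?M" for h
        using b that unfolding complementary_def by (metis add_left_cancel)
      have skew: "bform ?M g h = - bform ?M h g" if "g \<in> elems ?M" "h \<in> elems ?M" for g h
        using P that unfolding singular_matrix_def based_matrix_def by blast
      have col: "bform ?M h k = bform ?M h l" if "h \<in> elems ?M" for h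
        using row[OF that] skew that mem by metis
      have diag: "bform ?M k k = 0" "bform ?M l l = 0"
        using P mem unfolding singular_matrix_def based_matrix_def by blast+
      have dist: "dist_elem P \<noteq> k" "dist_elem P \<noteq> l"
        using D E b by (auto simp: sremovable_def)
      let ?f = "\<lambda>x. if x = l then k else x"
      have "bij_betw ?f (elems ?M - D) (elems ?M - E)"
        unfolding bij_betw_def using b kl mem by (auto simp: inj_on_def image_iff)
      moreover have "bform ?M (?f g) (?f h) = bform ?M g h"
        if "g \<in> elems ?M - D" "h \<in> elems ?M - D" for g h
        using that row col diag by auto
      ultimately have "singular_iso ?f (sremove P D) (sremove P E)"
        using mem dist unfolding singular_iso_def by auto
      then show ?thesis by blast
    qed
  qed
qed

inductive reduces_to :: "('a, 'h::ab_group_add) sbmat \<Rightarrow> ('a, 'h) sbmat \<Rightarrow> bool" where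
  irreducible: "(\<And>D. \<not> sremovable P D) \<Longrightarrow> reduces_to P P"
| step: "sremovable P D \<Longrightarrow> reduces_to (sremove P D) N \<Longrightarrow> reduces_to P N"

lemma card_sremove:
  assumes "singular_matrix P" "sremovable P D"
  shows "card (melems (sremove P D)) < card (melems P)"
proof -
  have "finite (melems P)" "D \<subseteq> melems P" "D \<noteq> {}"
    using assms removable_subset[of "underlying P" D] removable_nonempty[of "underlying P" D]
    unfolding sremovable_def singular_matrix_def based_matrix_def by blast+
  then show ?thesis by (auto intro!: psubset_card_mono)
qed

lemma reduces_to_exists: "singular_matrix P \<Longrightarrow> \<exists>N. reduces_to P N"
proof (induction "card (melems P)" arbitrary: P rule: less_induct)
  case less
  then show ?case
    by (metis reduces_to.intros card_sremove singular_matrix_sremove)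
qed

text \<open>
  Newman's lemma modulo isomorphism, by induction on the number of elements. The statement is
  about two isomorphic matrices instead of one, because the two results of diverging removals are
  in general only isomorphic and the induction hypothesis must still apply to them.
\<close>

lemma reduces_to_unique:
  fixes P P' :: "('a, 'h::ab_group_add) sbmat"
  assumes "singular_iso f P P'" "singular_matrix P" "reduces_to P N" "reduces_to P' N'"
  shows "\<exists>g. singular_iso g N N'"
  using assms
proof (induction "card (melems P)" arbitrary: P P' N N' f rule: less_induct)
  case less
  note iso = less.prems(1) and P = less.prems(2)
  let ?i = "inv_into (melems P) f"
  have P': "singular_matrix P'" using iso P by (rule singular_iso_matrix)
  have iso': "singular_iso ?i P' P" using iso P by (rule singular_iso_sym)
  show ?case
    using less.prems(3)
  proof cases
    case irreducible
    have "\<not> sremovable P' E" for E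
      using removable_iso(1)[OF iso' P'] irreducible(2) by blast
    then have "N' = P'" using less.prems(4) by (auto elim: reduces_to.cases)
    then show ?thesis using irreducible(1) iso by auto
  next
    case (step D)
    obtain E where E: "sremovable P' E" and N': "reduces_to (sremove P' E) N'"
      using less.prems(4)
    proof cases
      case irreducible
      then show ?thesis using removable_iso(1)[OF iso P step(1)] by blast
    qed (use that in blast)
    let ?E = "?i ` E"
    have E': "sremovable P ?E" and isoE: "singular_iso ?i (sremove P' E) (sremove P ?E)"
      using removable_iso[OF iso' P' E] by auto
    have isoE': "\<exists>j. singular_iso j (sremove P ?E) (sremove P' E)"
      using singular_iso_sym[OF isoE singular_matrix_sremove[OF P' E]] by blast
    note sD = singular_matrix_sremove[OF P step(1)] and cD = card_sremove[OF P step(1)]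
    note sE = singular_matrix_sremove[OF P E'] and cE = card_sremove[OF P E']
    from local_confluence[OF P step(1) E'] show ?thesis
    proof
      assume "\<exists>f. singular_iso f (sremove P D) (sremove P ?E)"
      then have "\<exists>j. singular_iso j (sremove P D) (sremove P' E)"
        using isoE' singular_iso_trans by blast
      then show ?thesis using less.hyps[OF cD _ sD step(2) N'] by blast
    next
      assume "\<exists>D' E'. (D' = {} \<or> sremovable (sremove P D) D') \<and>
             (E' = {} \<or> sremovable (sremove P ?E) E') \<and> D \<union> D' = ?E \<union> E'"
      then obtain D' E' where D': "D' = {} \<or> sremovable (sremove P D) D'"
        and E1: "E' = {} \<or> sremovable (sremove P ?E) E'" and eq: "D \<union> D' = ?E \<union> E'"
        by blast
      let ?R = "sremove P (D \<union> D')"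
      have "singular_matrix ?R"
        using D' singular_matrix_sremove[OF sD, of D'] sD by auto
      then obtain N0 where N0: "reduces_to ?R N0" using reduces_to_exists by blast
      have 1: "reduces_to (sremove P D) N0"
        using D' N0 reduces_to.step[of "sremove P D" D' N0] by auto
      have 2: "reduces_to (sremove P ?E) N0"
        using E1 N0 reduces_to.step[of "sremove P ?E" E' N0] by (auto simp: eq)
      obtain g where g: "singular_iso g N N0"
        using less.hyps[OF cD singular_iso_refl sD step(2) 1] by blast
      obtain j where "singular_iso j (sremove P ?E) (sremove P' E)" using isoE' by blast
      from less.hyps[OF cE this sE 2 N'] obtain g' where "singular_iso g' N0 N'" by blast
      then show ?thesis using g singular_iso_trans by blast
    qed
  qed
qed

text \<open>
  Isomorphisms are generators here, so that the relation is the right one on every carrier type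
  and changes of the form outside of the carrier are absorbed.
\<close>

definition protected_homologous :: "('a, 'h::ab_group_add) sbmat \<Rightarrow> ('a, 'h) sbmat \<Rightarrow> bool" where
  "protected_homologous = equivclp (\<lambda>P Q. singular_matrix P \<and> singular_matrix Q \<and>
     (singular_extension P Q \<or> (\<exists>f. singular_iso f P Q)))"

lemma reduces_to_singular_matrix:
  "reduces_to P N \<Longrightarrow> singular_matrix P \<Longrightarrow> singular_matrix N"
  by (induction rule: reduces_to.induct) (auto dest: singular_matrix_sremove)

lemma protected_homologous_sym:
  "protected_homologous P Q \<Longrightarrow> protected_homologous Q P"
  unfolding protected_homologous_def by (rule equivclp_sym)

lemma protected_homologous_trans:
  "protected_homologous P Q \<Longrightarrow> protected_homologous Q R \<Longrightarrow> protected_homologous P R"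
  unfolding protected_homologous_def by (rule equivclp_trans)

lemma protected_homologous_refl: "protected_homologous P P"
  unfolding protected_homologous_def by simp

text \<open>
  Having isomorphic irreducible forms is preserved by each generator of the relation, and it can
  be composed along a chain because every matrix has an irreducible form.
\<close>

theorem protected_normal_form_unique:
  assumes "protected_homologous P Q" "singular_matrix P" "reduces_to P N" "reduces_to Q N'"
  shows "\<exists>f. singular_iso f N N'"
proof -
  let ?R = "\<lambda>P Q :: ('a, 'b) sbmat. singular_matrix P \<and> singular_matrix Q \<and>
     (singular_extension P Q \<or> (\<exists>f. singular_iso f P Q))"
  define same where "same P Q \<longleftrightarrow> (\<forall>N N'. reduces_to P N \<longrightarrow> reduces_to Q N' \<longrightarrow>
     (\<exists>f. singular_iso f N N'))" for P Q :: "('a, 'b) sbmat"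
  have same_sym: "same Q P" if "same P Q" "singular_matrix P" for P Q
    using that reduces_to_singular_matrix singular_iso_sym unfolding same_def by metis
  have same_step: "same P Q" if "?R P Q" for P Q
    using that
  proof (elim conjE disjE exE)
    fix f assume "singular_matrix P" "singular_iso f P Q"
    then show ?thesis unfolding same_def using reduces_to_unique by blast
  next
    assume PQ: "singular_matrix P" "singular_matrix Q" and "singular_extension P Q"
    then obtain D where D: "sremovable Q D" "singular_iso id P (sremove Q D)"
      by (auto elim: singular_extensionE)
    show ?thesis unfolding same_def
    proof (intro allI impI)
      fix N N' assume N: "reduces_to P N" and N': "reduces_to Q N'"
      obtain N0 where N0: "reduces_to (sremove Q D) N0"
        using reduces_to_exists singular_matrix_sremove PQ D by blast
      then have "reduces_to Q N0" using D by (auto intro: reduces_to.step)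
      then obtain f where "singular_iso f N0 N'"
        using reduces_to_unique[OF singular_iso_refl PQ(2)] N' by blast
      moreover obtain g where "singular_iso g N N0"
        using reduces_to_unique[OF D(2) PQ(1) N N0] by blast
      ultimately show "\<exists>f. singular_iso f N N'" using singular_iso_trans by blast
    qed
  qed
  have "equivclp ?R P Q" using assms(1) by (simp add: protected_homologous_def)
  then have "same P Q \<and> singular_matrix Q"
  proof (induction rule: equivclp_induct)
    case base
    then show ?case
      using assms(2) singular_iso_refl reduces_to_unique unfolding same_def by blast
  next
    case (step Q R)
    then have QR: "same Q R" "singular_matrix Q" "singular_matrix R"
      using same_step same_sym by blast+
    have "same P R" unfolding same_def
    proof (intro allI impI)
      fix N N' assume "reduces_to P N" "reduces_to R N'"
      moreover obtain N0 where "reduces_to Q N0" using reduces_to_exists QR by blast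
      ultimately show "\<exists>f. singular_iso f N N'"
        using step QR singular_iso_trans unfolding same_def by blast
    qed
    then show ?case using QR by blast
  qed
  then show ?thesis using assms by (auto simp: same_def)
qed

lemma based_matrixD:
  assumes "based_matrix M"
  shows "finite (elems M)" "base M \<in> elems M"
    "\<And>g h. g \<in> elems M \<Longrightarrow> h \<in> elems M \<Longrightarrow> bform M g h = - bform M h g"
    "\<And>g. g \<in> elems M \<Longrightarrow> bform M g g = 0"
  using assms unfolding based_matrix_def by blast+

lemma based_matrixI:
  assumes "finite (elems M)" "base M \<in> elems M"
    "\<And>g h. g \<in> elems M \<Longrightarrow> h \<in> elems M \<Longrightarrow> bform M g h = - bform M h g"
    "\<And>g. g \<in> elems M \<Longrightarrow> bform M g g = 0"
  shows "based_matrix M"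
  using assms unfolding based_matrix_def by blast

section \<open>Adjoining the row of the distinguished element\<close>

abbreviation with_base :: "'a set \<Rightarrow> 'a option set" where
  "with_base A \<equiv> insert None (Some ` A)"

text \<open>
  An \<open>N\<close>-move from \<open>d\<close> to a complementary \<open>g\<close> flips the sign and replaces the row of \<open>d\<close> by the
  row of \<open>s\<close> minus it. The row defined here depends on the sign in such a way that it stays the
  same.
\<close>

definition marked_row :: "('a, 'h::ab_group_add) sbmat \<Rightarrow> 'a \<Rightarrow> 'h" where
  "marked_row P h = (case sgn_of P of
      Plus \<Rightarrow> mform P (dist_elem P) h
    | Minus \<Rightarrow> mform P (mbase P) h - mform P (dist_elem P) h)"

fun marked_form :: "('a, 'h::ab_group_add) sbmat \<Rightarrow> 'a option \<Rightarrow> 'a option \<Rightarrow> 'h" where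
  "marked_form P None None = 0"
| "marked_form P None (Some h) = marked_row P h"
| "marked_form P (Some g) None = - marked_row P g"
| "marked_form P (Some g) (Some h) = mform P g h"

text \<open>
  The element \<open>None\<close> is new, carries the marked row and is protected. The former distinguished
  element loses its protection. The sign has done its work in the choice of the row and is set to
  a constant.
\<close>

definition mark :: "('a, 'h::ab_group_add) sbmat \<Rightarrow> ('a option, 'h) sbmat" where
  "mark P = \<lparr>underlying = \<lparr>elems = with_base (melems P),
       base = Some (mbase P), bform = marked_form P\<rparr>,
     dist_elem = None, sgn_of = Plus\<rparr>"

lemma mark_simps [simp]:
  "melems (mark P) = with_base (melems P)"
  "mbase (mark P) = Some (mbase P)"
  "mform (mark P) = marked_form P"
  "dist_elem (mark P) = None" "sgn_of (mark P) = Plus"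
  by (simp_all add: mark_def)

lemma singular_matrixD:
  assumes "singular_matrix P"
  shows "based_matrix (underlying P)" "dist_elem P \<in> melems P"
    "dist_elem P \<noteq> mbase P"
  using assms by (auto simp: singular_matrix_def)

lemma singular_matrix_mark:
  assumes "singular_matrix P" shows "singular_matrix (mark P)"
proof -
  note M = based_matrixD[OF singular_matrixD(1)[OF assms]]
  have "based_matrix (underlying (mark P))"
  proof (rule based_matrixI)
    fix g h assume "g \<in> melems (mark P)" "h \<in> melems (mark P)"
    then show "mform (mark P) g h = - mform (mark P) h g"
      by (cases g; cases h) (auto intro: M(3))
  qed (use M(1,2,4) in auto)
  then show ?thesis by (simp add: singular_matrix_def)
qed

lemma mark_sremove: "mark (sremove P D) = sremove (mark P) (Some ` D)"
proof -
  have "marked_form (sremove P D) x y = marked_form P x y" for x y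
    by (cases x; cases y) (auto simp: marked_row_def split: sign.split)
  then have "marked_form (sremove P D) = marked_form P" by blast
  then show ?thesis by (auto simp: mark_def sremove_def remove_def)
qed

lemma marked_row_column:
  assumes "singular_matrix P" "g \<in> melems P"
  shows "marked_row P g = (case sgn_of P of
      Plus \<Rightarrow> - mform P g (dist_elem P)
    | Minus \<Rightarrow> mform P g (dist_elem P) - mform P g (mbase P))"
proof -
  note M = based_matrixD[OF singular_matrixD(1)[OF assms(1)]]
  have "mform P (dist_elem P) g = - mform P g (dist_elem P)"
    "mform P (mbase P) g = - mform P g (mbase P)"
    using M(2,3) singular_matrixD(2)[OF assms(1)] assms(2) by blast+
  then show ?thesis by (simp add: marked_row_def split: sign.split)
qed

text \<open>
  The new column is a combination of the columns of \<open>d\<close> and \<open>s\<close>, which are never removed, so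
  conditions on columns extend to it by linearity.
\<close>

lemma sremovable_mark:
  assumes P: "singular_matrix P" and D: "sremovable P D"
  shows "sremovable (mark P) (Some ` D)"
proof -
  let ?M = "underlying P" and ?N = "underlying (mark P)"
  note d = singular_matrixD[OF P] and s = based_matrixD(2)[OF singular_matrixD(1)[OF P]]
  have "annihilating ?N (Some g)" if "annihilating ?M g" for g
    using that d(2) s by (auto simp: annihilating_def marked_row_column[OF P] split: sign.split)
  moreover have "core ?N (Some g)" if "core ?M g" for g
    using that d(2) s by (auto simp: core_def marked_row_column[OF P] split: sign.split)
  moreover have "complementary ?N (Some g) (Some h)" if "complementary ?M g h" for g h
  proof -
    have "bform ?M g x + bform ?M h x = bform ?M (base ?M) x" if "x \<in> elems ?M" for x
      using that \<open>complementary ?M g h\<close> by (auto simp: complementary_def)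
    from this[OF d(2)] this[OF s] have "marked_row P g + marked_row P h = marked_row P (base ?M)"
      using that s by (simp add: complementary_def marked_row_column[OF P] algebra_simps split: sign.split)
    then have "- marked_row P g - marked_row P h = - marked_row P (base ?M)"
      by (metis minus_add_distrib uminus_add_conv_diff add.commute)
    then show ?thesis using that by (auto simp: complementary_def)
  qed
  ultimately have "removable ?N (Some ` D)"
    using D unfolding sremovable_def removable_def by fastforce
  then show ?thesis by (auto simp: sremovable_def)
qed

lemma mark_iso:
  assumes iso: "singular_iso f P Q" and P: "singular_matrix P"
  shows "singular_iso (map_option f) (mark P) (mark Q)"
proof -
  note d = singular_matrixD[OF P] and s = based_matrixD(2)[OF singular_matrixD(1)[OF P]]
  have im: "melems Q = f ` melems P" and inj: "inj_on f (melems P)"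
    using iso by (auto simp: singular_iso_def bij_betw_def)
  have row: "marked_row Q (f h) = marked_row P h" if "h \<in> melems P" for h
    using iso d(2) s that unfolding singular_iso_def marked_row_def
    by (metis (no_types, lifting))
  have "bij_betw (map_option f) (with_base (melems P)) (with_base (melems Q))"
    unfolding bij_betw_def
  proof
    show "inj_on (map_option f) (with_base (melems P))"
      using inj by (auto simp: inj_on_def)
  qed (auto simp: im image_image)
  moreover have "marked_form Q (map_option f x) (map_option f y) = marked_form P x y"
    if "x \<in> with_base (melems P)" "y \<in> with_base (melems P)"
    for x y
    using that row iso by (auto simp: singular_iso_def)
  ultimately show ?thesis using iso by (simp add: singular_iso_def)
qed

lemma protected_homologous_iso:
  "singular_iso f P Q \<Longrightarrow> singular_matrix P \<Longrightarrow> protected_homologous P Q"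
  unfolding protected_homologous_def
  by (rule r_into_equivclp) (blast intro: singular_iso_matrix)

lemma protected_homologous_extension:
  "singular_extension P Q \<Longrightarrow> protected_homologous P Q"
  unfolding protected_homologous_def
  by (rule r_into_equivclp) (auto simp: singular_extension_def)

lemma mark_extension:
  assumes "singular_extension P Q"
  shows "protected_homologous (mark P) (mark Q)"
proof -
  obtain D where D: "sremovable Q D" "singular_iso id P (sremove Q D)"
    using assms by (rule singular_extensionE)
  have PQ: "singular_matrix P" "singular_matrix Q"
    using assms by (auto simp: singular_extension_def)
  have "protected_homologous (mark P) (mark (sremove Q D))"
    using mark_iso[OF D(2) PQ(1)] singular_matrix_mark[OF PQ(1)] by (rule protected_homologous_iso)
  moreover have "singular_extension (mark (sremove Q D)) (mark Q)"
    unfolding mark_sremove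
    using singular_matrix_mark[OF PQ(2)] sremovable_mark[OF PQ(2) D(1)]
    by (rule singular_extension_sremove)
  ultimately show ?thesis
    using protected_homologous_extension protected_homologous_trans by blast
qed

lemma mark_N_move:
  assumes "N_move P Q" shows "protected_homologous (mark P) (mark Q)"
proof -
  obtain g where P: "singular_matrix P" and g: "complementary (underlying P) g (dist_elem P)"
    and Q: "Q = smat (underlying P) g (flip (sgn_of P))"
    using assms by (auto simp: N_move_def)
  have "marked_row P h = marked_row Q h" if "h \<in> melems P" for h
  proof -
    have "mform P g h + mform P (dist_elem P) h =
        mform P (mbase P) h"
      using g that by (simp add: complementary_def)
    then show ?thesis by (cases "sgn_of P") (auto simp: marked_row_def Q algebra_simps)
  qed
  then have "singular_iso id (mark P) (mark Q)"
    by (auto simp: singular_iso_def Q)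
  then show ?thesis using singular_matrix_mark[OF P] by (rule protected_homologous_iso)
qed

text \<open>
  The purpose of marking: singular homology, with its \<open>N\<close>-moves, is mapped to a relation without
  \<open>N\<close>-moves, for which irreducible forms are unique.
\<close>

lemma mark_homologous:
  assumes "singular_homologous P Q" shows "protected_homologous (mark P) (mark Q)"
  using assms unfolding singular_homologous_def
proof (induction rule: equivclp_induct)
  case base
  show ?case by (rule protected_homologous_refl)
next
  case (step Q R)
  have "protected_homologous (mark Q) (mark R)"
    using step(2) mark_extension mark_N_move protected_homologous_sym by blast
  with step show ?case using protected_homologous_trans by blast
qed

section \<open>Annihilating and core distinguished elements\<close>

text \<open>
  Unlike for ordinary elements, the base may be annihilating-like: this is the property that the
  matrices of semi-trivial strings have.
\<close>

definition trivial_dist :: "('a, 'h::ab_group_add) sbmat \<Rightarrow> bool" where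
  "trivial_dist P \<longleftrightarrow> annihilating (underlying P) (dist_elem P) \<or> core (underlying P) (dist_elem P)"

lemma trivial_dist_mark:
  assumes P: "singular_matrix P" and "trivial_dist P" shows "trivial_dist (mark P)"
proof -
  let ?M = "underlying P"
  note d = singular_matrixD[OF P] and s = based_matrixD[OF singular_matrixD(1)[OF P]]
  have "bform ?M (base ?M) (dist_elem P) = 0"
    using assms(2) s(3)[OF s(2) d(2)] s(2) s(4)[OF s(2)]
    by (auto simp: trivial_dist_def annihilating_def core_def)
  moreover have "bform ?M (dist_elem P) (base ?M) = 0"
    using assms(2) s(2) s(4)[OF s(2)] by (auto simp: trivial_dist_def annihilating_def core_def)
  ultimately show ?thesis
    using assms(2) s(2) s(4)[OF s(2)]
    by (cases "sgn_of P")
       (auto simp: trivial_dist_def annihilating_def core_def marked_row_def)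
qed

lemma trivial_dist_reduces_to: "reduces_to P N \<Longrightarrow> trivial_dist P \<Longrightarrow> trivial_dist N"
proof (induction rule: reduces_to.induct)
  case (step P D N)
  then show ?case by (auto simp: trivial_dist_def annihilating_def core_def sremovable_def)
qed

lemma trivial_dist_iso:
  assumes iso: "singular_iso f P Q" and P: "singular_matrix P" and t: "trivial_dist P"
  shows "trivial_dist Q"
proof -
  have Q: "singular_matrix Q" using iso P by (rule singular_iso_matrix)
  have im: "melems Q = f ` melems P"
    using iso by (auto simp: singular_iso_def bij_betw_def)
  have b: "mform Q (f g) (f h) = mform P g h"
    if "g \<in> melems P" "h \<in> melems P" for g h
    using iso that by (simp add: singular_iso_def)
  have fs: "mbase Q = f (mbase P)" "dist_elem Q = f (dist_elem P)"
    using iso by (auto simp: singular_iso_def)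
  have mem: "dist_elem P \<in> melems P" "mbase P \<in> melems P"
    and ne: "f (dist_elem P) \<noteq> f (mbase P)"
    using singular_matrixD[OF Q] singular_matrixD[OF P] based_matrixD(2)[OF singular_matrixD(1)[OF P]]
    by (auto simp: fs)
  show ?thesis
    using t mem ne by (auto simp: trivial_dist_def annihilating_def core_def im fs b)
qed

text \<open>
  An element removable after marking is removable before, as there are fewer columns then.
\<close>

lemma mark_primitive_irreducible:
  assumes "primitive H" shows "\<not> sremovable (mark (smat H h \<epsilon>)) D"
proof
  let ?P = "smat H h \<epsilon>"
  assume D: "sremovable (mark ?P) D"
  then consider g where "D = {g}" "annihilating (underlying (mark ?P)) g \<or> core (underlying (mark ?P)) g"
    | g1 g2 where "g1 \<noteq> g2" "D = {g1, g2}" "complementary (underlying (mark ?P)) g1 g2"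
    unfolding sremovable_def removable_def by blast
  then show False
  proof cases
    case 1
    then obtain k where "g = Some k" using D by (cases g) (auto simp: sremovable_def)
    then have "annihilating H k \<or> core H k"
      using 1 by (auto simp: annihilating_def core_def)
    then have "removable H {k}" by (auto simp: removable_def)
    then show False using primitive_not_removable[OF assms] by blast
  next
    case 2
    then obtain k l where "g1 = Some k" "g2 = Some l"
      using D by (cases g1; cases g2) (auto simp: sremovable_def)
    then have "k \<noteq> l" "complementary H k l"
      using 2 by (auto simp: complementary_def)
    then have "removable H {k, l}" by (auto simp: removable_def)
    then show False using primitive_not_removable[OF assms] by blast
  qed
qed

lemma mark_primitive_not_trivial:
  assumes H: "primitive H" and h: "h \<in> elems H - {base H}"
  shows "\<not> trivial_dist (mark (smat H h \<epsilon>))"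
proof
  assume "trivial_dist (mark (smat H h \<epsilon>))"
  then have "annihilating H h \<or> core H h"
    using h by (cases \<epsilon>) (auto simp: trivial_dist_def annihilating_def core_def marked_row_def)
  then have "removable H {h}" by (auto simp: removable_def)
  then show False using primitive_not_removable[OF H] by blast
qed

text \<open>
  If the marked row of \<open>P\<close> is zero or the row of \<open>s\<close>, it remains so in the irreducible form.
  Uniqueness of that form would transfer this property to \<open>h\<close>, making \<open>h\<close> removable in the
  primitive matrix \<open>H\<close>.
\<close>

lemma trivial_not_homologous_mark:
  assumes H: "primitive H" and h: "h \<in> elems H - {base H}"
    and P: "singular_matrix P" "trivial_dist P"
  shows "\<not> protected_homologous (mark P) (mark (smat H h \<epsilon>))"
proof
  let ?Q = "mark (smat H h \<epsilon>)"
  assume hom: "protected_homologous (mark P) ?Q"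
  have mP: "singular_matrix (mark P)" using P(1) by (rule singular_matrix_mark)
  then obtain N where N: "reduces_to (mark P) N" using reduces_to_exists by blast
  have "reduces_to ?Q ?Q"
    using mark_primitive_irreducible[OF H] by (rule reduces_to.irreducible)
  then obtain f where "singular_iso f N ?Q"
    using protected_normal_form_unique[OF hom mP N] by blast
  moreover have "trivial_dist N" "singular_matrix N"
    using N trivial_dist_reduces_to trivial_dist_mark[OF P] reduces_to_singular_matrix mP by blast+
  ultimately have "trivial_dist ?Q" using trivial_dist_iso by blast
  then show False using mark_primitive_not_trivial[OF H h] by blast
qed

text \<open>
  Both marked matrices are irreducible, hence isomorphic. The isomorphism fixes \<open>None\<close> and sends
  \<open>h\<close>, which has the same row as \<open>None\<close> on the left, to some \<open>l\<close> with the same row as \<open>None\<close> on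
  the right. There this is the row of \<open>s\<close> minus that of \<open>k\<close>, so \<open>l\<close> and \<open>k\<close> are complementary;
  in a primitive matrix this forces \<open>l = k\<close>.
\<close>

lemma mark_opposite_signs:
  assumes H: "primitive H" and h: "h \<in> elems H - {base H}" and k: "k \<in> elems H - {base H}"
    and hom: "protected_homologous (mark (smat H h Plus)) (mark (smat H k Minus))"
  shows "self_complementary H k"
proof -
  let ?P = "smat H h Plus"
    and ?Q = "smat H k Minus"
  have P: "singular_matrix ?P" using H h by (simp add: singular_matrix_def primitive_def)
  have irr: "reduces_to (mark ?P) (mark ?P)" "reduces_to (mark ?Q) (mark ?Q)"
    using mark_primitive_irreducible[OF H] by (auto intro: reduces_to.irreducible)
  obtain f where f: "singular_iso f (mark ?P) (mark ?Q)"
    using protected_normal_form_unique[OF hom singular_matrix_mark[OF P] irr] by blast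
  have bij: "bij_betw f (with_base (elems H)) (with_base (elems H))"
    using f by (simp add: singular_iso_def)
  note inj = bij_betw_imp_inj_on[OF bij] and im = bij_betw_imp_surj_on[OF bij]
  have s: "base H \<in> elems H" and hh: "bform H h h = 0"
    using H h unfolding primitive_def based_matrix_def by blast+
  have fs: "f (Some (base H)) = Some (base H)" "f None = None"
    using f by (auto simp: singular_iso_def)
  have "f (Some h) \<noteq> None" "f (Some h) \<noteq> Some (base H)"
    using inj_onD[OF inj, of "Some h" None] inj_onD[OF inj, of "Some h" "Some (base H)"] fs h s
    by fastforce+
  moreover have "f (Some h) \<in> with_base (elems H)" using im h by blast
  ultimately obtain l where l: "f (Some h) = Some l" "l \<in> elems H" "l \<noteq> base H" by auto
  \<comment> \<open>In the first matrix the adjoined row equals the row of \<open>h\<close>.\<close>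
  have eq: "marked_form ?Q None y = marked_form ?Q (Some l) y"
    if "y \<in> with_base (elems H)" for y
  proof -
    from that have "y \<in> f ` (with_base (elems H))" by (simp only: im)
    then obtain x where x: "x \<in> with_base (elems H)" "y = f x" by (elim imageE) simp
    have "marked_form ?P None x = marked_form ?P (Some h) x"
      using hh by (cases x) (auto simp: marked_row_def)
    moreover have form: "marked_form ?Q (f u) (f v) = marked_form ?P u v"
      if "u \<in> with_base (elems H)" "v \<in> with_base (elems H)" for u v
      using f that by (auto simp: singular_iso_def)
    from form[of None x] form[of "Some h" x] have "marked_form ?Q None y = marked_form ?P None x"
      "marked_form ?Q (Some l) y = marked_form ?P (Some h) x"
      using x h fs l(1) by simp_all
    ultimately show ?thesis by simp
  qed
  have com: "complementary H l k"
    unfolding complementary_def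
  proof (intro conjI ballI)
    fix x assume "x \<in> elems H"
    then show "bform H l x + bform H k x = bform H (base H) x"
      using eq[of "Some x"] by (simp add: marked_row_def algebra_simps)
  qed (use l k in auto)
  have "l = k"
  proof (rule ccontr)
    assume "l \<noteq> k"
    then have "removable H {l, k}" using com by (auto simp: removable_def)
    then show False using primitive_not_removable[OF H] by blast
  qed
  then show ?thesis using com by (auto simp: complementary_def self_complementary_def)
qed

section \<open>The index of a matrix relative to a primitive one\<close>

definition regular_elements :: "('a, 'h::ab_group_add) bmat \<Rightarrow> 'a set" where
  "regular_elements H = {h \<in> elems H - {base H}. \<not> self_complementary H h}"

text \<open>
  Written as a difference of truth values, so that the bound by \<open>1\<close>, on which the estimate of
  \<open>t(\<mu>)\<close> rests, holds by construction.
\<close>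

definition mark_index :: "('a, 'h::ab_group_add) bmat \<Rightarrow> ('a, 'h) sbmat \<Rightarrow> int" where
  "mark_index H P =
     of_bool (\<exists>h\<in>regular_elements H.
       protected_homologous (mark P) (mark (smat H h Plus))) -
     of_bool (\<exists>h\<in>regular_elements H.
       protected_homologous (mark P) (mark (smat H h Minus)))"

lemma abs_mark_index_le: "\<bar>mark_index H P\<bar> \<le> 1"
  by (simp add: mark_index_def)

lemma mark_index_cong:
  assumes "singular_homologous P Q" shows "mark_index H P = mark_index H Q"
proof -
  have "protected_homologous (mark P) R \<longleftrightarrow> protected_homologous (mark Q) R" for R
    using mark_homologous[OF assms] protected_homologous_sym protected_homologous_trans by blast
  then show ?thesis by (simp add: mark_index_def)
qed

lemma mark_index_trivial:
  assumes "primitive H" "singular_matrix P" "trivial_dist P"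
  shows "mark_index H P = 0"
  using trivial_not_homologous_mark[OF assms(1) _ assms(2,3)]
  by (auto simp: mark_index_def regular_elements_def)

lemma singular_homologous_extension: "singular_extension P Q \<Longrightarrow> singular_homologous P Q"
  unfolding singular_homologous_def by (rule r_into_equivclp) blast

lemma singular_homologous_N: "N_move P Q \<Longrightarrow> singular_homologous P Q"
  unfolding singular_homologous_def by (rule r_into_equivclp) blast

lemma singular_homologous_sym: "singular_homologous P Q \<Longrightarrow> singular_homologous Q P"
  unfolding singular_homologous_def by (rule equivclp_sym)

lemma singular_homologous_trans:
  "singular_homologous P Q \<Longrightarrow> singular_homologous Q R \<Longrightarrow> singular_homologous P R"
  unfolding singular_homologous_def by (rule equivclp_trans)

lemma singular_homologous_refl: "singular_homologous P P"
  unfolding singular_homologous_def by simp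

definition index_difference :: "('a, 'h::ab_group_add) bmat \<Rightarrow> ('a, 'h) bmat \<Rightarrow> 'a \<Rightarrow> int" where
  "index_difference H M g =
     mark_index H (smat M g Plus) - mark_index H (smat M g Minus)"

definition total_index :: "('a, 'h::ab_group_add) bmat \<Rightarrow> ('a, 'h) bmat \<Rightarrow> int" where
  "total_index H M = (\<Sum>g\<in>elems M - {base M}. index_difference H M g)"

lemma complementary_index_difference:
  assumes M: "based_matrix M" and c: "complementary M g k"
  shows "index_difference H M g + index_difference H M k = 0"
proof -
  have "singular_homologous (smat M k \<epsilon>) (smat M g (flip \<epsilon>))" for \<epsilon>
    using M c by (intro singular_homologous_N) (auto simp: N_move_def singular_matrix_def complementary_def)
  from mark_index_cong[OF this[of Plus]] mark_index_cong[OF this[of Minus]]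
  show ?thesis by (simp add: index_difference_def)
qed

text \<open>
  A new annihilating or core element contributes zero, and the contributions of two
  complementary elements cancel by an \<open>N\<close>-move. The others keep their contributions, since the
  extension is also an extension of singular matrices.
\<close>

lemma total_index_extension:
  assumes H: "primitive H" and ext: "extension M M'"
  shows "total_index H M = total_index H M'"
proof -
  obtain D where D: "extends M M' D" "removable M' D" using ext by (auto simp: extension_iff)
  have b: "based_matrix M" "based_matrix M'" "base M' = base M"
    and el: "elems M' = elems M \<union> D" "D \<inter> elems M = {}"
    using D(1) by (auto simp: extends_def)
  have sub: "D \<subseteq> elems M' - {base M'}" using D(2) by (rule removable_subset)
  have fin: "finite (elems M')" using b(2) by (rule based_matrixD(1))
  have "index_difference H M g = index_difference H M' g" if "g \<in> elems M - {base M}" for g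
  proof -
    have "singular_homologous (smat M g \<epsilon>) (smat M' g \<epsilon>)" for \<epsilon>
      using that b ext el
      by (intro singular_homologous_extension) (auto simp: singular_extension_def singular_matrix_def)
    then show ?thesis using mark_index_cong unfolding index_difference_def by metis
  qed
  moreover have "(\<Sum>g\<in>D. index_difference H M' g) = 0"
  proof -
    consider g where "D = {g}" "annihilating M' g \<or> core M' g"
      | g1 g2 where "g1 \<noteq> g2" "D = {g1, g2}" "complementary M' g1 g2"
      using D(2) unfolding removable_def by blast
    then show ?thesis
    proof cases
      case 1
      then have "mark_index H (smat M' g \<epsilon>) = 0" for \<epsilon>
        using sub b(2) by (intro mark_index_trivial[OF H]) (auto simp: trivial_dist_def singular_matrix_def)
      then show ?thesis using 1 by (simp add: index_difference_def)
    next
      case 2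
      then show ?thesis using complementary_index_difference[OF b(2) 2(3)] by simp
    qed
  qed
  moreover have "elems M' - {base M'} = (elems M - {base M}) \<union> D" "(elems M - {base M}) \<inter> D = {}"
    using el sub b(3) by auto
  moreover have "finite (elems M - {base M})" "finite D"
    using fin el(1) by (auto intro: finite_subset)
  ultimately show ?thesis
    unfolding total_index_def by (simp add: sum.union_disjoint)
qed

lemma total_index_homologous:
  assumes "primitive H" "homologous M M'" shows "total_index H M = total_index H M'"
  using assms(2) unfolding homologous_def
  by (induction rule: equivclp_induct) (use total_index_extension[OF assms(1)] in force)+

text \<open>
  A self-complementary element is complementary to itself, so its contribution cancels with
  itself. This is where the two bounds of the main theorem diverge.
\<close>

lemma index_difference_primitive:
  assumes H: "primitive H" and g: "g \<in> elems H - {base H}"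
  shows "index_difference H H g = (if g \<in> regular_elements H then 2 else 0)"
proof (cases "g \<in> regular_elements H")
  case True
  then have "\<not> protected_homologous (mark (smat H g Plus)) (mark (smat H h Minus))"
      "\<not> protected_homologous (mark (smat H g Minus)) (mark (smat H h Plus))" if "h \<in> regular_elements H" for h
    using that mark_opposite_signs[OF H] protected_homologous_sym unfolding regular_elements_def
    by blast+
  then show ?thesis using True protected_homologous_refl
    by (auto simp: index_difference_def mark_index_def)
next
  case False
  then have "complementary H g g"
    using g by (auto simp: regular_elements_def complementary_def self_complementary_def)
  from complementary_index_difference[OF _ this, of H] False H show ?thesis
    by (simp add: primitive_def)
qed

lemma total_index_primitive:
  assumes "primitive H" shows "total_index H H = 2 * int (card (regular_elements H))"
proof -
  have "finite (elems H - {base H})"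
    using assms unfolding primitive_def by (auto dest: based_matrixD(1))
  moreover have "regular_elements H \<subseteq> elems H - {base H}" by (auto simp: regular_elements_def)
  ultimately show ?thesis
    unfolding total_index_def using index_difference_primitive[OF assms]
    by (simp add: sum.If_cases Int_absorb1)
qed

text \<open>
  Two different self-complementary elements would have equal rows, because the integers are
  torsion-free, and then be complementary to each other. So a primitive matrix has at most one,
  apart from the base.
\<close>

lemma card_regular_elements:
  fixes H :: "('a, int) bmat"
  assumes H: "primitive H"
  shows "card (elems H) - 1 \<le> card (regular_elements H) + 1"
    "(\<not> (\<exists>g\<in>elems H. self_complementary H g)) \<Longrightarrow> card (regular_elements H) = card (elems H) - 1"
proof -
  have fin: "finite (elems H)" and s: "base H \<in> elems H"
    using H unfolding primitive_def by (auto dest: based_matrixD)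
  let ?S = "{g \<in> elems H - {base H}. self_complementary H g}"
  have "g = k" if "g \<in> ?S" "k \<in> ?S" for g k
  proof (rule ccontr)
    assume "g \<noteq> k"
    moreover have "bform H g h + bform H k h = bform H (base H) h" if h: "h \<in> elems H" for h
    proof -
      have "bform H g h + bform H g h = bform H (base H) h" "bform H k h + bform H k h = bform H (base H) h"
        using that \<open>g \<in> ?S\<close> \<open>k \<in> ?S\<close> by (auto simp: self_complementary_def)
      then show ?thesis by linarith
    qed
    ultimately have "removable H {g, k}"
      using that by (auto simp: removable_def complementary_def)
    then show False using primitive_not_removable[OF H] by blast
  qed
  moreover have "finite ?S" using fin by simp
  ultimately have "card ?S \<le> 1" by (metis (no_types, lifting) One_nat_def card_le_Suc0_iff_eq)
  moreover have "elems H - {base H} = regular_elements H \<union> ?S"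
    by (auto simp: regular_elements_def)
  then have "card (elems H - {base H}) \<le> card (regular_elements H) + card ?S"
    by (metis card_Un_le)
  ultimately show "card (elems H) - 1 \<le> card (regular_elements H) + 1"
    using s fin by simp
  assume "\<not> (\<exists>g\<in>elems H. self_complementary H g)"
  then have "regular_elements H = elems H - {base H}" by (auto simp: regular_elements_def)
  then show "card (regular_elements H) = card (elems H) - 1" using s fin by simp
qed

lemma extension_card:
  assumes "extension M M'" shows "card (elems M) < card (elems M')"
proof -
  obtain D where "extends M M' D" "removable M' D" using assms by (auto simp: extension_iff)
  then show ?thesis
    using removable_nonempty[of M' D] by (auto simp: extends_def dest: based_matrixD(1) intro!: psubset_card_mono)
qed

lemma primitive_exists:
  "based_matrix M \<Longrightarrow> \<exists>H. primitive H \<and> homologous M H"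
proof (induction "card (elems M)" arbitrary: M rule: less_induct)
  case less
  show ?case
  proof (cases "primitive M")
    case True
    then show ?thesis by (auto simp: homologous_def)
  next
    case False
    then obtain M' where "extension\<^sup>+\<^sup>+ M' M" using less.prems by (auto simp: primitive_def)
    then obtain N where N: "extension N M" by (cases rule: tranclp.cases) auto
    then have "based_matrix N" by (auto simp: extension_iff extends_def)
    then obtain H where H: "primitive H" "homologous N H"
      using less.hyps[of N] extension_card[OF N] by blast
    moreover have "homologous M N"
      unfolding homologous_def using N by (blast intro: equivclp_sym r_into_equivclp)
    ultimately show ?thesis unfolding homologous_def by (blast intro: equivclp_trans)
  qed
qed

section \<open>Exchanging core and annihilating elements\<close>

text \<open>
  The new column is forced by skew-symmetry.
\<close>

definition adjoin :: "('a, 'h::ab_group_add) bmat \<Rightarrow> 'a \<Rightarrow> ('a \<Rightarrow> 'h) \<Rightarrow> ('a, 'h) bmat" where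
  "adjoin M c v = \<lparr>elems = insert c (elems M), base = base M,
     bform = (\<lambda>x y. if x = c then (if y = c then 0 else v y) else if y = c then - v x else bform M x y)\<rparr>"

lemma adjoin_simps [simp]:
  "elems (adjoin M c v) = insert c (elems M)" "base (adjoin M c v) = base M"
  "bform (adjoin M c v) x y =
     (if x = c then (if y = c then 0 else v y) else if y = c then - v x else bform M x y)"
  by (simp_all add: adjoin_def)

lemma based_matrix_adjoin:
  assumes M: "based_matrix M" shows "based_matrix (adjoin M c v)"
proof (rule based_matrixI)
  fix g h assume "g \<in> elems (adjoin M c v)" "h \<in> elems (adjoin M c v)"
  then show "bform (adjoin M c v) g h = - bform (adjoin M c v) h g"
    by (auto intro: based_matrixD(3)[OF M])
qed (use based_matrixD(1,2,4)[OF M] in auto)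

text \<open>
  The condition at the new column \<open>c\<close> holds because \<open>b(s, d) = - b(d, s)\<close>.
\<close>

lemma complementary_adjoin:
  assumes M: "based_matrix M" and d: "d \<in> elems M - {base M}" and c: "c \<notin> elems M"
  shows "complementary (adjoin M c (\<lambda>y. bform M (base M) y - bform M d y)) c d"
proof -
  have s: "base M \<in> elems M" using M by (rule based_matrixD(2))
  have "bform M (base M) d = - bform M d (base M)"
    using s d by (intro based_matrixD(3)[OF M]) auto
  moreover have "bform M d d = 0" "bform M (base M) (base M) = 0"
    using s d by (auto intro: based_matrixD(4)[OF M])
  ultimately show ?thesis using d c s by (auto simp: complementary_def)
qed

lemma extends_adjoin:
  assumes "based_matrix M" "c \<notin> elems M" shows "extends M (adjoin M c v) {c}"
  using assms based_matrix_adjoin[OF assms(1)] by (auto simp: extends_def)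

definition flip_sign :: "('a, 'h) sbmat \<Rightarrow> ('a, 'h) sbmat" where
  "flip_sign P = P\<lparr>sgn_of := flip (sgn_of P)\<rparr>"

lemma flip_flip [simp]: "flip (flip \<epsilon>) = \<epsilon>"
  by (cases \<epsilon>) auto

lemma flip_sign_simps [simp]:
  "underlying (flip_sign P) = underlying P" "dist_elem (flip_sign P) = dist_elem P"
  "sgn_of (flip_sign P) = flip (sgn_of P)" "flip_sign (flip_sign P) = P"
  by (simp_all add: flip_sign_def)

lemma singular_extension_flip: "singular_extension P Q \<Longrightarrow> singular_extension (flip_sign P) (flip_sign Q)"
  by (auto simp: singular_extension_def singular_matrix_def)

lemma N_move_flip: "N_move P Q \<Longrightarrow> N_move (flip_sign P) (flip_sign Q)"
  by (auto simp: N_move_def singular_matrix_def flip_sign_def)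

lemma singular_homologous_flip:
  assumes "singular_homologous P Q" shows "singular_homologous (flip_sign P) (flip_sign Q)"
  using assms unfolding singular_homologous_def
proof (induction rule: equivclp_induct)
  case (step Q R)
  let ?r = "\<lambda>P Q :: ('a, 'b) sbmat. singular_extension P Q \<or> N_move P Q"
  have "?r (flip_sign Q) (flip_sign R) \<or> ?r (flip_sign R) (flip_sign Q)"
    using step(2) singular_extension_flip N_move_flip by blast
  with step(3) show ?case by (rule equivclp_into_equivclp)
qed simp

text \<open>
  An \<open>N\<close>-move from a core or annihilating element goes to an annihilating or core element. If this
  is a different element it could be removed directly, so \<open>N\<close>-moves give nothing new here.
\<close>

lemma singular_primitive_iff_trivial:
  assumes P: "singular_matrix P" and t: "trivial_dist P"
  shows "singular_primitive P \<longleftrightarrow> (\<forall>D. \<not> sremovable P D)"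
proof
  assume "singular_primitive P"
  then show "\<forall>D. \<not> sremovable P D"
    using singular_extension_sremove[OF P] by (auto simp: singular_primitive_def)
next
  assume irr: "\<forall>D. \<not> sremovable P D"
  have "\<not> singular_extension Q P" for Q
    using irr by (auto elim: singular_extensionE)
  moreover have "\<not> (N_move P P' \<and> singular_extension Q P')" for P' Q
  proof
    assume "N_move P P' \<and> singular_extension Q P'"
    then obtain g D where g: "complementary (underlying P) g (dist_elem P)"
      and P': "P' = smat (underlying P) g (flip (sgn_of P))"
      and D: "sremovable P' D"
      by (auto simp: N_move_def elim: singular_extensionE)
    show False
    proof (cases "g = dist_elem P")
      case True
      then show False using D irr by (auto simp: P' sremovable_def)
    next
      case False
      have "annihilating (underlying P) g \<or> core (underlying P) g"
        using g t by (auto simp: trivial_dist_def annihilating_def core_def complementary_def)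
      then have "sremovable P {g}" using False by (auto simp: sremovable_def removable_def)
      then show False using irr by blast
    qed
  qed
  ultimately show "singular_primitive P" using P by (auto simp: singular_primitive_def)
qed

text \<open>
  Adjoin a complement \<open>c\<close> of the distinguished element \<open>d\<close>, which is an extension since \<open>c\<close> is
  core or annihilating, make an \<open>N\<close>-move to \<open>c\<close>, and remove \<open>d\<close>. The result is again primitive:
  the column of \<open>d\<close> is zero or the column of \<open>s\<close>, and likewise for \<open>c\<close>, so removability of other
  elements does not depend on which of the two columns is present.
\<close>

lemma ordinary_swap:
  fixes P :: "('a, 'h::ab_group_add) sbmat"
  assumes inf: "infinite (UNIV :: 'a set)" and prim: "singular_primitive P"
    and ord: "\<not> annihilating_like (underlying P)" and t: "trivial_dist P"
  obtains Q where "singular_homologous P Q" "singular_primitive Q" "sgn_of Q = flip (sgn_of P)"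
    "annihilating (underlying P) (dist_elem P) \<Longrightarrow> ordinary_core Q"
    "core (underlying P) (dist_elem P) \<Longrightarrow> ordinary_annihilating Q"
proof -
  let ?M = "underlying P" and ?d = "dist_elem P"
  have P: "singular_matrix P" using prim by (simp add: singular_primitive_def)
  note M = singular_matrixD(1)[OF P] and d = singular_matrixD(2,3)[OF P]
  let ?s = "base ?M"
  have s: "?s \<in> elems ?M" using M by (rule based_matrixD(2))
  have irr: "\<not> sremovable P D" for D
    using prim singular_primitive_iff_trivial[OF P t] by blast
  obtain c where c: "c \<notin> elems ?M"
    using ex_new_if_finite[OF inf based_matrixD(1)[OF M]] by blast
  define W where "W = adjoin ?M c (\<lambda>y. bform ?M ?s y - bform ?M ?d y)"
  have W: "based_matrix W" unfolding W_def using M by (rule based_matrix_adjoin)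
  have com: "complementary W c ?d" unfolding W_def using complementary_adjoin[OF M _ c] d by blast
  have z: "bform ?M ?d ?s = 0" "bform ?M ?s ?d = 0" "bform ?M ?d ?d = 0" "bform ?M ?s ?s = 0"
    using t s d based_matrixD(4)[OF M s] based_matrixD(4)[OF M d(1)] based_matrixD(3)[OF M s d(1)]
    by (auto simp: trivial_dist_def annihilating_def core_def)
  have ex: "singular_extension P (smat W ?d (sgn_of P))"
  proof -
    have "annihilating W c \<or> core W c"
      using t c s d(1) z by (auto simp: trivial_dist_def annihilating_def core_def W_def)
    then have "extension ?M W"
      using extends_adjoin[OF M c] unfolding extension_iff removable_def W_def by blast
    then show ?thesis using P W d by (auto simp: singular_extension_def singular_matrix_def W_def)
  qed
  let ?R = "(smat W c (flip (sgn_of P)))"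
  have N: "N_move (smat W ?d (sgn_of P)) ?R"
    using com W d by (auto simp: N_move_def singular_matrix_def W_def)
  have R: "singular_matrix ?R" using W c s by (auto simp: singular_matrix_def W_def)
  have rem: "sremovable ?R {?d}"
  proof -
    have "annihilating W ?d \<or> core W ?d"
      using t c s d z by (auto simp: trivial_dist_def annihilating_def core_def W_def)
    then show ?thesis using c d by (auto simp: sremovable_def removable_def)
  qed
  let ?Q = "sremove ?R {?d}"
  have Q: "singular_matrix ?Q" using R rem by (rule singular_matrix_sremove)
  have hom: "singular_homologous P ?Q"
    using singular_homologous_extension[OF ex] singular_homologous_N[OF N]
      singular_homologous_extension[OF singular_extension_sremove[OF R rem]]
      singular_homologous_sym singular_homologous_trans by blast
  have ne: "c \<noteq> ?d" "c \<noteq> ?s" using c d s by auto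
  have core_Q: "core (underlying ?Q) c" if "annihilating ?M ?d"
    using that c s d z ne by (auto simp: annihilating_def core_def W_def)
  have ann_Q: "annihilating (underlying ?Q) c" if "core ?M ?d"
    using that c s d z ne by (auto simp: annihilating_def core_def W_def)
  have tQ: "trivial_dist ?Q" using t core_Q ann_Q by (auto simp: trivial_dist_def)
  have ordQ: "\<not> annihilating_like (underlying ?Q)"
    using ord z ne c unfolding annihilating_like_def by (auto simp: W_def split: if_splits)
  have col: "bform ?M g ?d = 0 \<or> bform ?M g ?d = bform ?M g ?s" if "g \<in> elems ?M" for g
    using t based_matrixD(3)[OF M that d(1)] based_matrixD(3)[OF M that s] that
    by (auto simp: trivial_dist_def annihilating_def core_def)
  have col2: "(\<forall>g\<in>elems ?M. bform ?M g ?d = 0) \<or> (\<forall>g\<in>elems ?M. bform ?M g ?d = bform ?M g ?s)"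
    using t based_matrixD(3)[OF M _ d(1)] based_matrixD(3)[OF M _ s]
    by (auto simp: trivial_dist_def annihilating_def core_def)
  have irrQ: "\<not> sremovable ?Q D" for D
  proof
    assume D: "sremovable ?Q D"
    have mem: "g \<in> elems ?M - {?s}" "g \<noteq> ?d" "g \<noteq> c" if "g \<in> D" for g
      using D that removable_subset[of "underlying ?Q" D] c by (auto simp: sremovable_def W_def)
    have ann: "annihilating ?M g" if "annihilating (underlying ?Q) g" "g \<in> D" for g
    proof -
      have "bform ?M g h = 0" if "h \<in> elems ?M - {?d}" for h
        using \<open>annihilating (underlying ?Q) g\<close> mem[OF \<open>g \<in> D\<close>] that c
        by (auto simp: annihilating_def W_def split: if_splits)
      with mem[OF \<open>g \<in> D\<close>] col[of g] s d show ?thesis unfolding annihilating_def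
        by (metis DiffD1 DiffI singletonD)
    qed
    have cor: "core ?M g" if "core (underlying ?Q) g" "g \<in> D" for g
    proof -
      have "bform ?M g h = bform ?M ?s h" if "h \<in> elems ?M - {?d}" for h
        using \<open>core (underlying ?Q) g\<close> mem[OF \<open>g \<in> D\<close>] that c ne
        by (auto simp: core_def W_def split: if_splits)
      with mem[OF \<open>g \<in> D\<close>] col[of g] s d z show ?thesis unfolding core_def
        by (metis DiffD1 DiffI singletonD)
    qed
    have cpl: "complementary ?M g k" if "complementary (underlying ?Q) g k" "g \<in> D" "k \<in> D" for g k
    proof -
      have eq: "bform ?M g h + bform ?M k h = bform ?M ?s h" if "h \<in> elems ?M - {?d}" for h
        using \<open>complementary (underlying ?Q) g k\<close> mem[OF \<open>g \<in> D\<close>] mem[OF \<open>k \<in> D\<close>] that c ne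
        by (auto simp: complementary_def W_def split: if_splits)
      have "bform ?M g ?d + bform ?M k ?d = bform ?M ?s ?d"
        using col2 mem[OF \<open>g \<in> D\<close>] mem[OF \<open>k \<in> D\<close>] eq[of ?s] s d z by auto
      with mem[OF \<open>g \<in> D\<close>] mem[OF \<open>k \<in> D\<close>] eq show ?thesis unfolding complementary_def
        by (metis DiffI singletonD)
    qed
    have "removable ?M D"
      using D ann cor cpl unfolding sremovable_def removable_def by blast
    then show False using irr mem unfolding sremovable_def by blast
  qed
  have "singular_primitive ?Q" using singular_primitive_iff_trivial[OF Q tQ] irrQ by blast
  then show ?thesis
    using that[of ?Q] hom core_Q ann_Q ordQ by (auto simp: ordinary_core_def ordinary_annihilating_def)
qed

section \<open>Isomorphic matrices are homologous\<close>

text \<open>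
  To rename \<open>g\<close> to \<open>f g\<close>, add a copy \<open>f g\<close> of \<open>g\<close> together with a complement \<open>c\<close> of both, and
  remove the complementary pair \<open>{g, c}\<close>. The matrix \<open>W\<close> containing all three extends the old
  and the new matrix.
\<close>

lemma rename_one:
  fixes P Q :: "('a, 'h::ab_group_add) sbmat"
  assumes inf: "infinite (UNIV :: 'a set)" and P: "singular_matrix P"
    and iso: "singular_iso f P Q" and g: "g \<in> melems P" "f g \<notin> melems P"
    and id: "\<And>x. x \<in> melems P - {g} \<Longrightarrow> f x = x"
    and base: "mbase Q = mbase P"
  shows "singular_homologous P Q"
proof -
  let ?M = "underlying P" and ?N = "underlying Q" and ?s = "mbase P"
  note M = singular_matrixD(1)[OF P]
  have Q: "singular_matrix Q" using iso P by (rule singular_iso_matrix)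
  have s: "?s \<in> elems ?M" using M by (rule based_matrixD(2))
  have gs: "g \<noteq> ?s" using iso g(2) s by (auto simp: singular_iso_def base)
  have eN: "elems ?N = insert (f g) (elems ?M - {g})"
  proof -
    have "elems ?N = f ` elems ?M" using iso by (auto simp: singular_iso_def bij_betw_def)
    also have "\<dots> = insert (f g) (f ` (elems ?M - {g}))" using g(1) by blast
    also have "f ` (elems ?M - {g}) = elems ?M - {g}" using id by force
    finally show ?thesis .
  qed
  obtain c where c: "c \<notin> insert (f g) (elems ?M)"
    using ex_new_if_finite[OF inf] based_matrixD(1)[OF M] by blast
  define V where "V = adjoin ?M (f g) (bform ?M g)"
  define W where "W = adjoin V c (\<lambda>y. bform V (base V) y - bform V (f g) y)"
  have V: "based_matrix V" unfolding V_def using M by (rule based_matrix_adjoin)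
  have W: "based_matrix W" unfolding W_def using V by (rule based_matrix_adjoin)
  have fs: "f g \<noteq> ?s" "f g \<noteq> g" "c \<noteq> f g" "c \<noteq> g" "c \<noteq> ?s" using g s c by auto
  have eW: "elems W = insert c (insert (f g) (elems ?M))" "base W = ?s"
    by (simp_all add: W_def V_def)
  have com: "complementary W c (f g)"
    unfolding W_def by (rule complementary_adjoin[OF V]) (use c fs in \<open>auto simp: V_def\<close>)
  have row: "bform W g y = bform W (f g) y" if "y \<in> elems W" for y
  proof -
    have "bform ?M g ?s = - bform ?M ?s g" "bform ?M g g = 0"
      using g(1) s by (auto intro: based_matrixD(3,4)[OF M])
    then show ?thesis using that fs g by (auto simp: W_def V_def)
  qed
  have com': "complementary W c g"
    using com row g fs gs by (auto simp: complementary_def eW)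
  have MW: "extends ?M W {c, f g}"
    using M W g c by (auto simp: extends_def W_def V_def)
  have NW: "extends ?N W {c, g}"
    unfolding extends_def
  proof (intro conjI ballI)
    fix x y assume xy: "x \<in> elems ?N" "y \<in> elems ?N"
    define u where "u x = (if x = f g then g else x)" for x
    have u: "u x \<in> elems ?M" "f (u x) = x" if "x \<in> elems ?N" for x
      using that id g by (auto simp: u_def eN)
    have "bform ?N x y = bform ?M (u x) (u y)"
    proof -
      have "bform ?N (f (u x)) (f (u y)) = bform ?M (u x) (u y)"
        using iso u(1)[OF xy(1)] u(1)[OF xy(2)] unfolding singular_iso_def by blast
      then show ?thesis using u(2)[OF xy(1)] u(2)[OF xy(2)] by simp
    qed
    also have "\<dots> = bform W x y"
    proof -
      have "- bform ?M g x = bform ?M x g" if "x \<in> elems ?M"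
        using based_matrixD(3)[OF M that g(1)] by simp
      moreover have "bform ?M g g = 0" using g(1) by (rule based_matrixD(4)[OF M])
      moreover have "x \<noteq> c" "y \<noteq> c" using xy c by (auto simp: eN)
      ultimately show ?thesis using xy by (auto simp: u_def W_def V_def eN)
    qed
    finally show "bform W x y = bform ?N x y" by simp
  qed (use W Q g c eN base fs gs in \<open>auto simp: eW dest: singular_matrixD(1)\<close>)
  have ext: "extension ?M W" "extension ?N W"
    using MW NW com com' fs unfolding extension_iff removable_def by blast+
  let ?S = "\<lambda>d \<epsilon>. smat W d \<epsilon>"
  have 1: "singular_homologous P (?S (dist_elem P) (sgn_of P))"
    using P W ext(1) singular_matrixD[OF P]
    by (intro singular_homologous_extension) (auto simp: singular_extension_def singular_matrix_def eW)
  have 2: "singular_homologous Q (?S (dist_elem Q) (sgn_of Q))"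
    using Q W ext(2) singular_matrixD[OF Q]
    by (intro singular_homologous_extension)
       (auto simp: singular_extension_def singular_matrix_def eW eN base gs)
  have sd: "sgn_of Q = sgn_of P" "dist_elem Q = f (dist_elem P)"
    using iso by (auto simp: singular_iso_def)
  show ?thesis
  proof (cases "dist_elem P = g")
    case False
    then have "dist_elem Q = dist_elem P" using id singular_matrixD(2)[OF P] sd(2) by simp
    then show ?thesis using 1 2 sd(1) singular_homologous_sym singular_homologous_trans by metis
  next
    case True
    \<comment> \<open>Two \<open>N\<close>-moves rename the distinguished element and restore the sign.\<close>
    have "N_move (?S g (sgn_of P)) (?S c (flip (sgn_of P)))"
      using com' W by (auto simp: N_move_def singular_matrix_def complementary_def)
    moreover have "N_move (?S c (flip (sgn_of P))) (?S (f g) (sgn_of P))"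
      using complementary_sym[OF com] W by (auto simp: N_move_def singular_matrix_def complementary_def)
    ultimately have "singular_homologous (?S g (sgn_of P)) (?S (f g) (sgn_of P))"
      using singular_homologous_N singular_homologous_trans by blast
    then show ?thesis
      using 1 2 True sd singular_homologous_sym singular_homologous_trans by metis
  qed
qed

definition transport :: "('a \<Rightarrow> 'a) \<Rightarrow> ('a, 'h) sbmat \<Rightarrow> ('a, 'h) sbmat" where
  "transport f P =
     (let i = inv_into (melems P) f in
      \<lparr>underlying = \<lparr>elems = f ` melems P, base = f (mbase P),
          bform = (\<lambda>x y. mform P (i x) (i y))\<rparr>,
        dist_elem = f (dist_elem P), sgn_of = sgn_of P\<rparr>)"

lemma singular_iso_transport:
  assumes "inj_on f (melems P)" shows "singular_iso f P (transport f P)"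
  using assms by (auto simp: singular_iso_def transport_def Let_def bij_betw_def)

text \<open>
  Elements are renamed one at a time. Freshness of the new names guarantees that no intermediate
  matrix has a clash. The induction starts with a single moved element.
\<close>

lemma rename_fresh:
  fixes P Q :: "('a, 'h::ab_group_add) sbmat"
  assumes inf: "infinite (UNIV :: 'a set)" and P: "singular_matrix P"
    and iso: "singular_iso f P Q" and base: "mbase Q = mbase P"
    and fresh: "\<And>x. x \<in> melems P \<Longrightarrow> f x \<noteq> x \<Longrightarrow> f x \<notin> melems P"
    and moved: "\<exists>x\<in>melems P. f x \<noteq> x"
  shows "singular_homologous P Q"
proof -
  show ?thesis
    using assms(2-)
  proof (induction "card {x \<in> melems P. f x \<noteq> x}" arbitrary: P f rule: less_induct)
    case less
    let ?M = "underlying P" and ?X = "{x \<in> melems P. f x \<noteq> x}"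
    note P = less.prems(1) and iso = less.prems(2) and base = less.prems(3) and fresh = less.prems(4)
    have fin: "finite (elems ?M)" using P by (blast dest: singular_matrixD based_matrixD)
    have inj: "inj_on f (elems ?M)" using iso by (auto simp: singular_iso_def bij_betw_def)
    have s: "base ?M \<in> elems ?M" "f (base ?M) = base ?M"
      using P iso base by (auto simp: singular_iso_def dest: singular_matrixD based_matrixD)
    obtain g where g: "g \<in> elems ?M" "f g \<noteq> g" using less.prems(5) by blast
    have fg: "f g \<notin> elems ?M" using fresh g by blast
    show ?case
    proof (cases "\<forall>x\<in>elems ?M - {g}. f x = x")
      case True
      then show ?thesis using rename_one[OF inf P iso g(1) fg _ base] by blast
    next
      case False
      then obtain y where y: "y \<in> elems ?M" "y \<noteq> g" "f y \<noteq> y" by blast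
      define f1 where "f1 x = (if x = g then f g else x)" for x
      define f2 where "f2 x = (if x = f g then x else f x)" for x
      have gs: "g \<noteq> base ?M" using g s by auto
      define R where "R = transport f1 P"
      have R1: "singular_iso f1 P R"
        unfolding R_def by (rule singular_iso_transport) (use fg in \<open>auto simp: inj_on_def f1_def\<close>)
      have R: "singular_matrix R" using R1 P by (rule singular_iso_matrix)
      have bR: "mbase R = base ?M" using gs by (simp add: f1_def R_def transport_def Let_def)
      have eR: "melems R = insert (f g) (elems ?M - {g})"
        using g(1) by (auto simp: f1_def R_def transport_def Let_def)
      have PR: "singular_homologous P R"
        by (rule rename_one[OF inf P R1 g(1)]) (use fg bR in \<open>auto simp: f1_def\<close>)
      have comp: "f x = f2 (f1 x)" if "x \<in> elems ?M" for x
        using that fg by (auto simp: f1_def f2_def)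
      have R2: "singular_iso f2 R Q"
      proof -
        have "bij_betw f1 (elems ?M) (melems R)" using R1 by (simp add: singular_iso_def)
        moreover have "bij_betw (f2 \<circ> f1) (elems ?M) (melems Q)"
          using iso comp bij_betw_cong[of "elems ?M" f "f2 \<circ> f1"] by (simp add: singular_iso_def)
        ultimately have bij: "bij_betw f2 (melems R) (melems Q)"
          by (rule bij_betw_comp_iff[THEN iffD2])
        have b: "mform Q (f2 x) (f2 y) = mform R x y"
          if xy: "x \<in> melems R" "y \<in> melems R" for x y
        proof -
          have "x \<in> f1 ` elems ?M" "y \<in> f1 ` elems ?M"
            using xy R1 by (auto simp: singular_iso_def bij_betw_def)
          then obtain u v where uv: "u \<in> elems ?M" "x = f1 u" "v \<in> elems ?M" "y = f1 v" by blast
          have "mform R x y = bform ?M u v"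
            using R1 uv unfolding singular_iso_def by blast
          also have "\<dots> = mform Q (f u) (f v)"
            using iso uv unfolding singular_iso_def by metis
          finally show ?thesis using comp uv by metis
        qed
        have "f2 (dist_elem R) = dist_elem Q" "sgn_of R = sgn_of Q"
          using R1 iso comp singular_matrixD(2)[OF P] unfolding singular_iso_def by metis+
        moreover have "f2 (mbase R) = mbase Q"
          using s fg by (auto simp: bR base f2_def)
        ultimately show ?thesis using bij b unfolding singular_iso_def by blast
      qed
      have "{x \<in> melems R. f2 x \<noteq> x} \<subseteq> ?X - {g}" by (auto simp: eR f2_def)
      then have "card {x \<in> melems R. f2 x \<noteq> x} \<le> card (?X - {g})"
        using fin by (intro card_mono) auto
      also have "\<dots> < card ?X" using fin g by (intro card_Diff1_less) auto
      finally have "singular_homologous R Q"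
      proof (rule less.hyps[OF _ R R2])
        fix x assume "x \<in> melems R" "f2 x \<noteq> x"
        then have "x \<in> elems ?M" "x \<noteq> g" "f x \<noteq> x" "f2 x = f x"
          by (auto simp: eR f2_def split: if_splits)
        moreover from this have "f x \<notin> elems ?M" "f x \<noteq> f g" using fresh inj g by (auto dest: inj_onD)
        ultimately show "f2 x \<notin> melems R" by (auto simp: eR)
      next
        have "y \<in> melems R" "f2 y \<noteq> y" using y fg by (auto simp: eR f2_def)
        then show "\<exists>x\<in>melems R. f2 x \<noteq> x" by blast
      qed (simp add: bR base)
      then show ?thesis using PR singular_homologous_trans by blast
    qed
  qed
qed

text \<open>
  An arbitrary isomorphism may permute names, so it is factored through a set of fresh names,
  which exists in an infinite type. The base keeps its name throughout.
\<close>

theorem iso_singular_homologous: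
  fixes P Q :: "('a, 'h::ab_group_add) sbmat"
  assumes inf: "infinite (UNIV :: 'a set)" and P: "singular_matrix P"
    and iso: "singular_iso f P Q" and base: "mbase Q = mbase P"
  shows "singular_homologous P Q"
proof -
  let ?M = "underlying P" and ?s = "mbase P"
  have Q: "singular_matrix Q" using iso P by (rule singular_iso_matrix)
  have fin: "finite (elems ?M)" "finite (melems Q)"
    using P Q by (blast dest: singular_matrixD based_matrixD)+
  have s: "?s \<in> elems ?M" using P by (blast dest: singular_matrixD based_matrixD)
  have "infinite (UNIV - (elems ?M \<union> melems Q))"
    using fin inf by (simp add: Diff_infinite_finite)
  then obtain F where F: "F \<subseteq> UNIV - (elems ?M \<union> melems Q)" "finite F"
      "card F = card (elems ?M)"
    using infinite_arbitrarily_large by metis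
  then obtain k where k: "bij_betw k (elems ?M) F"
    using fin finite_same_card_bij by metis
  let ?k = "\<lambda>x. if x = ?s then ?s else k x"
  have kF: "k x \<in> F" if "x \<in> elems ?M" for x using k that by (rule bij_betwE[rule_format])
  have fresh: "k x \<notin> elems ?M" "k x \<notin> melems Q" if "x \<in> elems ?M" for x
    using kF[OF that] F(1) by auto
  have injk: "inj_on ?k (elems ?M)"
    using k fresh s unfolding bij_betw_def inj_on_def by metis
  define R where "R = transport ?k P"
  have R1: "singular_iso ?k P R" unfolding R_def using injk by (rule singular_iso_transport)
  have R: "singular_matrix R" using R1 P by (rule singular_iso_matrix)
  have bR: "mbase R = ?s" by (simp add: R_def transport_def Let_def)
  have eR: "melems R = ?k ` elems ?M" by (simp add: R_def transport_def Let_def)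
  have "singular_homologous P R"
  proof (rule rename_fresh[OF inf P R1])
    have "?k (dist_elem P) \<noteq> dist_elem P"
      using fresh(1) singular_matrixD(2,3)[OF P] by (metis (full_types))
    then show "\<exists>x\<in>elems ?M. ?k x \<noteq> x" using singular_matrixD(2)[OF P] by blast
  qed (use bR fresh in \<open>auto split: if_splits\<close>)
  moreover have "singular_homologous R Q"
  proof (rule rename_fresh[OF inf R])
    show "singular_iso (f \<circ> inv_into (elems ?M) ?k) R Q"
      using singular_iso_sym[OF R1 P] iso by (rule singular_iso_trans)
    fix y assume "y \<in> melems R" and ne: "(f \<circ> inv_into (elems ?M) ?k) y \<noteq> y"
    then obtain x where x: "x \<in> elems ?M" "y = ?k x" by (auto simp: eR)
    then have fx: "(f \<circ> inv_into (elems ?M) ?k) y = f x"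
      using inv_into_f_f[OF injk x(1)] unfolding x(2) by (simp only: comp_apply)
    have fsx: "f ?s = ?s" "inj_on f (elems ?M)" "f x \<in> melems Q"
      using iso base x(1) by (auto simp: singular_iso_def bij_betw_def)
    have "x \<noteq> ?s" using ne fx x fsx(1) by auto
    then have "f x \<noteq> ?s" using fsx x(1) s by (metis inj_onD)
    moreover have "f x \<notin> F" using fsx(3) F(1) by auto
    moreover have "?k ` elems ?M \<subseteq> insert ?s F" using kF by auto
    ultimately show "(f \<circ> inv_into (elems ?M) ?k) y \<notin> melems R"
      unfolding fx eR by blast
  next
    have d: "dist_elem P \<in> elems ?M" "dist_elem P \<noteq> ?s" using singular_matrixD(2,3)[OF P] by simp_all
    have "dist_elem R = k (dist_elem P)" "dist_elem Q \<in> melems Q"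
      using d(2) singular_matrixD(2)[OF Q] by (simp_all add: R_def transport_def Let_def)
    moreover have "(f \<circ> inv_into (elems ?M) ?k) (dist_elem R) = dist_elem Q"
      using singular_iso_trans[OF singular_iso_sym[OF R1 P] iso] by (simp add: singular_iso_def)
    ultimately have "(f \<circ> inv_into (elems ?M) ?k) (dist_elem R) \<noteq> dist_elem R"
      using fresh(2)[OF d(1)] by metis
    then show "\<exists>x\<in>melems R. (f \<circ> inv_into (elems ?M) ?k) x \<noteq> x"
      using singular_matrixD(2)[OF R] by blast
  qed (simp add: bR base)
  ultimately show ?thesis by (rule singular_homologous_trans)
qed

section \<open>Arc weights\<close>

lemma S1_cis_Arg2pi: "z \<in> S1 \<Longrightarrow> z = cis (Arg2pi z)"
  using Arg2pi_eq[of z] by (simp add: cis_conv_exp mult.commute)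

lemma Arg2pi_inj_S1: "x \<in> S1 \<Longrightarrow> y \<in> S1 \<Longrightarrow> Arg2pi x = Arg2pi y \<longleftrightarrow> x = y"
  by (metis S1_cis_Arg2pi)

lemma Arg2pi_divide_S1:
  assumes "x \<in> S1" "z \<in> S1"
  shows "Arg2pi (z / x) = (if Arg2pi x \<le> Arg2pi z then Arg2pi z - Arg2pi x
                            else Arg2pi z - Arg2pi x + 2 * pi)"
proof -
  have q: "z / x = cis (Arg2pi z - Arg2pi x)"
    using S1_cis_Arg2pi[OF assms(1)] S1_cis_Arg2pi[OF assms(2)] by (metis cis_divide)
  have "z / x = cis (Arg2pi z - Arg2pi x + 2 * pi)"
    by (simp add: q cis_conv_exp ring_distribs exp_add exp_two_pi_i' mult.commute mult.left_commute)
  note q2 = this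
  have b: "0 \<le> Arg2pi x" "Arg2pi x < 2 * pi" "0 \<le> Arg2pi z" "Arg2pi z < 2 * pi"
    by (auto simp: Arg2pi_ge_0 Arg2pi_lt_2pi)
  show ?thesis
  proof (cases "Arg2pi x \<le> Arg2pi z")
    case True
    have "Arg2pi (z / x) = Arg2pi z - Arg2pi x"
      by (rule Arg2pi_unique[of 1]) (use True b q in \<open>auto simp: cis_conv_exp\<close>)
    then show ?thesis using True by simp
  next
    case False
    have "Arg2pi (z / x) = Arg2pi z - Arg2pi x + 2 * pi"
      by (rule Arg2pi_unique[of 1]) (use False b q2 in \<open>auto simp: cis_conv_exp\<close>)
    then show ?thesis using False by simp
  qed
qed

text \<open>
  In terms of angles the arcs are given by the cyclic order on \<open>[0, 2 \<pi>)\<close>; everything about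
  positions of points on the circle is thereby reduced to linear order.
\<close>

lemma arc_interior_iff:
  assumes "x \<in> S1" "y \<in> S1" "z \<in> S1"
  shows "z \<in> arc_interior x y \<longleftrightarrow>
    Arg2pi x < Arg2pi z \<and> Arg2pi z < Arg2pi y \<or>
    Arg2pi z < Arg2pi y \<and> Arg2pi y < Arg2pi x \<or>
    Arg2pi y < Arg2pi x \<and> Arg2pi x < Arg2pi z"
proof -
  have "0 \<le> Arg2pi x" "Arg2pi x < 2 * pi" "0 \<le> Arg2pi y" "Arg2pi y < 2 * pi"
      "0 \<le> Arg2pi z" "Arg2pi z < 2 * pi"
    by (auto simp: Arg2pi_ge_0 Arg2pi_lt_2pi)
  then show ?thesis
    using assms(3) unfolding arc_interior_def
    by (simp add: Arg2pi_divide_S1[OF assms(1) assms(3)] Arg2pi_divide_S1[OF assms(1) assms(2)])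
qed

text \<open>
  The indicator function of the arc from \<open>a\<close> to \<open>b\<close>, with the boundary points counted half. This
  symmetric convention makes the weights of the two arcs of an arrow add up to \<open>1\<close>, and it
  absorbs the linking term of the based matrix.
\<close>

definition weight :: "complex \<Rightarrow> complex \<Rightarrow> complex \<Rightarrow> real" where
  "weight a b z = (if z = a \<or> z = b then 1/2 else if z \<in> arc_interior a b then 1 else 0)"

definition rweight :: "real \<Rightarrow> real \<Rightarrow> real \<Rightarrow> real" where
  "rweight a b z = (if z = a \<or> z = b then 1/2
     else if a < z \<and> z < b \<or> z < b \<and> b < a \<or> b < a \<and> a < z then 1 else 0)"

lemma weight_eq:
  "a \<in> S1 \<Longrightarrow> b \<in> S1 \<Longrightarrow> z \<in> S1 \<Longrightarrow> weight a b z = rweight (Arg2pi a) (Arg2pi b) (Arg2pi z)"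
  unfolding weight_def rweight_def by (simp add: arc_interior_iff Arg2pi_inj_S1)

lemma circle_arc_iff:
  assumes "x \<in> S1" "y \<in> S1" "z \<in> S1"
  shows "z \<in> circle_arc x y \<longleftrightarrow> Arg2pi z = Arg2pi x \<or> Arg2pi z = Arg2pi y \<or>
    Arg2pi x < Arg2pi z \<and> Arg2pi z < Arg2pi y \<or>
    Arg2pi z < Arg2pi y \<and> Arg2pi y < Arg2pi x \<or>
    Arg2pi y < Arg2pi x \<and> Arg2pi x < Arg2pi z"
  using assms by (simp add: circle_arc_def arc_interior_iff Arg2pi_inj_S1)

lemma weight_swap:
  assumes "a \<in> S1" "b \<in> S1" "z \<in> S1" "a \<noteq> b"
  shows "weight b a z = 1 - weight a b z"
  using assms(4) Arg2pi_inj_S1[OF assms(1,2)] unfolding weight_eq[OF assms(1-3)] weight_eq[OF assms(2,1,3)]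
  by (auto simp: rweight_def)

lemma weight_ends [simp]: "weight a b a = 1/2" "weight a b b = 1/2"
  by (auto simp: weight_def)

lemma weight_01:
  assumes "z \<noteq> a" "z \<noteq> b" shows "weight a b z = 0 \<or> weight a b z = 1"
  using assms by (simp add: weight_def)

text \<open>
  Both sides say how the pairs \<open>{a, b}\<close> and \<open>{c, d}\<close> are linked: they vanish unless the pairs
  separate each other on the circle.
\<close>

lemma weight_link:
  assumes "{a, b, c, d} \<subseteq> S1" "distinct [a, b, c, d]"
  shows "weight a b c - weight a b d = weight c d b - weight c d a"
proof -
  have "Arg2pi a \<noteq> Arg2pi b" "Arg2pi a \<noteq> Arg2pi c" "Arg2pi a \<noteq> Arg2pi d"
    "Arg2pi b \<noteq> Arg2pi c" "Arg2pi b \<noteq> Arg2pi d" "Arg2pi c \<noteq> Arg2pi d"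
    using assms by (auto simp: Arg2pi_inj_S1)
  then show ?thesis
    using assms(1) by (simp add: weight_eq) (simp add: rweight_def)
qed

lemma weight_rotate:
  assumes "{a, b, c} \<subseteq> S1" "distinct [a, b, c]"
  shows "weight a b c = weight b c a"
proof -
  have "Arg2pi a \<noteq> Arg2pi b" "Arg2pi a \<noteq> Arg2pi c" "Arg2pi b \<noteq> Arg2pi c"
    using assms by (auto simp: Arg2pi_inj_S1)
  then show ?thesis
    using assms(1) by (simp add: weight_eq) (auto simp add: rweight_def)
qed

text \<open>
  The points \<open>a\<close> and \<open>a'\<close> are neighbours as seen from \<open>V\<close>: exchanging them does not affect any
  weight between points of \<open>V\<close>. What their own order on the circle affects is recorded by \<open>t\<close>,
  which is \<open>1/2\<close> if \<open>a'\<close> comes after \<open>a\<close> and \<open>-1/2\<close> otherwise.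
\<close>

definition adjacent :: "complex set \<Rightarrow> complex \<Rightarrow> complex \<Rightarrow> real \<Rightarrow> bool" where
  "adjacent V a a' t \<longleftrightarrow>
     (\<forall>u\<in>V. weight a u a' = 1/2 + t \<and> weight a' u a = 1/2 - t \<and>
        weight u a a' = 1/2 - t \<and> weight u a' a = 1/2 + t \<and>
        (\<forall>z\<in>V. weight a u z = weight a' u z \<and> weight u a z = weight u a' z \<and>
           weight u z a = weight u z a'))"

lemma rweight_adjacent:
  assumes "p \<noteq> q"
    and u: "\<not> (u = p \<or> u = q \<or> p < u \<and> u < q \<or> u < q \<and> q < p \<or> q < p \<and> p < u)"
  shows "rweight p u q = 1" "rweight q u p = 0"
    and "\<not> (z = p \<or> z = q \<or> p < z \<and> z < q \<or> z < q \<and> q < p \<or> q < p \<and> p < z) \<Longrightarrow>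
      rweight p u z = rweight q u z \<and> rweight u z p = rweight u z q"
proof -
  have u': "p < q \<and> (u < p \<or> q < u) \<or> q < u \<and> u < p" using assms by argo
  show "rweight p u q = 1" "rweight q u p = 0"
    using u' by (auto simp: rweight_def)
  assume "\<not> (z = p \<or> z = q \<or> p < z \<and> z < q \<or> z < q \<and> q < p \<or> q < p \<and> p < z)"
  then have "p < q \<and> (z < p \<or> q < z) \<or> q < z \<and> z < p" using assms(1) by argo
  then show "rweight p u z = rweight q u z \<and> rweight u z p = rweight u z q"
    using u' by (elim disjE conjE; cases u z rule: linorder_cases; simp add: rweight_def)
qed

lemma adjacent_arc:
  assumes xy: "x \<in> S1" "y \<in> S1" "x \<noteq> y" and V: "V \<subseteq> S1 - circle_arc x y"
  shows "adjacent V x y (1/2)"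
  unfolding adjacent_def
proof (intro ballI conjI)
  have ne: "Arg2pi x \<noteq> Arg2pi y" using xy by (simp add: Arg2pi_inj_S1)
  fix u assume u: "u \<in> V"
  have u1: "u \<in> S1" and uA: "u \<notin> circle_arc x y" using u V by auto
  note eqs = rweight_adjacent[OF ne uA[unfolded circle_arc_iff[OF xy(1,2) u1]]]
  have "u \<noteq> x" "u \<noteq> y" using uA by (auto simp: circle_arc_def)
  then have swap: "weight u x z = 1 - weight x u z" "weight u y z = 1 - weight y u z"
    if "z \<in> S1" for z
    using that u1 xy by (auto intro!: weight_swap)
  show "weight x u y = 1/2 + 1/2" "weight y u x = 1/2 - 1/2"
    using eqs(1,2) xy u1 by (simp_all add: weight_eq)
  then show "weight u x y = 1/2 - 1/2" "weight u y x = 1/2 + 1/2"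
    using swap xy by simp_all
  fix z assume z: "z \<in> V"
  have z1: "z \<in> S1" and zA: "z \<notin> circle_arc x y" using z V by auto
  show "weight x u z = weight y u z" "weight u z x = weight u z y"
    using eqs(3)[OF zA[unfolded circle_arc_iff[OF xy(1,2) z1]]] xy u1 z1 by (simp_all add: weight_eq)
  then show "weight u x z = weight u y z" using swap z1 by simp
qed

lemma adjacent_sym: "adjacent V a a' t \<Longrightarrow> adjacent V a' a (- t)"
  by (simp add: adjacent_def)

section \<open>The based matrix as a skew form in arc weights\<close>

text \<open>
  The base behaves like an arrow whose arc is the whole circle.
\<close>

fun arrow_weight :: "arrow option \<Rightarrow> complex \<Rightarrow> real" where
  "arrow_weight None z = 1"
| "arrow_weight (Some (a, b)) z = weight a b z"

text \<open>
  The skew form that underlies the based matrix: it pairs the values at the tails with those at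
  the heads of all arrows.
\<close>

definition wedge :: "arrow set \<Rightarrow> (complex \<Rightarrow> real) \<Rightarrow> (complex \<Rightarrow> real) \<Rightarrow> real" where
  "wedge \<alpha> u v = (\<Sum>(p, q)\<in>\<alpha>. u p * v q - v p * u q)"

lemma wedge_swap: "wedge \<alpha> u v = - wedge \<alpha> v u"
  by (simp add: wedge_def case_prod_unfold flip: sum_negf)

lemma wedge_self: "wedge \<alpha> u u = 0"
  by (simp add: wedge_def case_prod_unfold)

lemma virtual_stringD:
  assumes "virtual_string \<alpha>"
  shows "finite \<alpha>" "\<And>a b. (a, b) \<in> \<alpha> \<Longrightarrow> a \<in> S1 \<and> b \<in> S1 \<and> a \<noteq> b"
    "\<And>a b c d. (a, b) \<in> \<alpha> \<Longrightarrow> (c, d) \<in> \<alpha> \<Longrightarrow> (a, b) \<noteq> (c, d) \<Longrightarrow>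
       a \<noteq> c \<and> a \<noteq> d \<and> b \<noteq> c \<and> b \<noteq> d"
proof -
  show "finite \<alpha>" using assms by (simp add: virtual_string_def)
  show "a \<in> S1 \<and> b \<in> S1 \<and> a \<noteq> b" if "(a, b) \<in> \<alpha>" for a b
  proof -
    have "a \<in> endpoints \<alpha>" "b \<in> endpoints \<alpha>" using that by (force simp: endpoints_def)+
    moreover have "a \<noteq> b" using assms that unfolding virtual_string_def by fast
    ultimately show ?thesis using assms unfolding virtual_string_def by blast
  qed
  show "a \<noteq> c \<and> a \<noteq> d \<and> b \<noteq> c \<and> b \<noteq> d"
    if "(a, b) \<in> \<alpha>" "(c, d) \<in> \<alpha>" "(a, b) \<noteq> (c, d)" for a b c d
  proof -
    have "{a, b} \<inter> {c, d} = {}" using assms that unfolding virtual_string_def by fast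
    then show ?thesis by auto
  qed
qed

lemma endpointsI: "(a, b) \<in> \<alpha> \<Longrightarrow> a \<in> endpoints \<alpha> \<and> b \<in> endpoints \<alpha>"
  by (force simp: endpoints_def)

lemma endpointsE:
  assumes "z \<in> endpoints \<alpha>"
  obtains p q where "(p, q) \<in> \<alpha>" "z = p \<or> z = q"
proof -
  obtain e where "e \<in> \<alpha>" "z = fst e \<or> z = snd e" using assms by (auto simp: endpoints_def)
  then show ?thesis using that[of "fst e" "snd e"] by simp
qed

lemma weight_indicator:
  "z \<noteq> a \<Longrightarrow> z \<noteq> b \<Longrightarrow> weight a b z = of_bool (z \<in> arc_interior a b)"
  by (simp add: weight_def)

lemma ends_not_in_arc_interior [simp]:
  "a \<notin> arc_interior a b" "b \<notin> arc_interior a b"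
  using Arg2pi_of_real[of 1] by (auto simp: arc_interior_def)

lemma arc_interior_swap:
  assumes "a \<in> S1" "b \<in> S1" "z \<in> S1" "a \<noteq> b" "z \<noteq> a" "z \<noteq> b"
  shows "z \<in> arc_interior b a \<longleftrightarrow> z \<notin> arc_interior a b"
  using weight_swap[OF assms(1-4)] weight_indicator[of z a b] weight_indicator[of z b a] assms(5,6)
  by (auto split: if_splits)

lemma real_card_filter:
  "finite A \<Longrightarrow> real (card {x \<in> A. P x}) = (\<Sum>x\<in>A. of_bool (P x))"
  by (simp add: of_bool_def sum.If_cases Int_def)

text \<open>
  An arrow \<open>(p, q)\<close> links \<open>(a, b)\<close> positively, negatively or not at all according as the weight
  drops, rises or stays the same from \<open>p\<close> to \<open>q\<close>.
\<close>

lemma link_number_weight: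
  assumes "virtual_string \<alpha>" "(a, b) \<in> \<alpha>"
  shows "real_of_int (link_number \<alpha> (a, b)) = wedge \<alpha> (weight a b) (\<lambda>_. 1)"
proof -
  note v = virtual_stringD[OF assms(1)]
  have "of_bool (links_pos f (a, b)) - of_bool (links_neg f (a, b)) =
      (case f of (p, q) \<Rightarrow> weight a b p * 1 - 1 * weight a b q)" if "f \<in> \<alpha>" for f
  proof (cases "f = (a, b)")
    case False
    obtain p q where f: "f = (p, q)" by (cases f)
    have "p \<noteq> a" "p \<noteq> b" "q \<noteq> a" "q \<noteq> b" using v(3)[OF assms(2), of p q] that False f by auto
    then show ?thesis
      using arc_interior_swap[of a b p] arc_interior_swap[of a b q] v(2)[OF assms(2)] v(2)[of p q] that
      by (auto simp: f weight_indicator)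
  qed simp
  then have "(\<Sum>f\<in>\<alpha>. of_bool (links_pos f (a, b)) - of_bool (links_neg f (a, b))) =
      wedge \<alpha> (weight a b) (\<lambda>_. 1)"
    unfolding wedge_def by (rule sum.cong[OF refl])
  then show ?thesis
    by (simp add: link_number_def real_card_filter[OF v(1)] sum_subtractf)
qed

text \<open>
  For arrows other than \<open>e\<close> and \<open>f\<close> the weights are indicators, and their terms add up to the
  product of the open arcs. The terms of \<open>e\<close> and \<open>f\<close> themselves involve the value \<open>1/2\<close>; by
  \<open>weight_link\<close> each of them is half of the linking term.
\<close>

lemma arc_product_weight:
  assumes "virtual_string \<alpha>" "e \<in> \<alpha>" "f \<in> \<alpha>"
  shows "real_of_int (arc_product \<alpha> e f + link_sign e f) = wedge \<alpha> (arrow_weight (Some e)) (arrow_weight (Some f))"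
proof (cases "e = f")
  case True
  then show ?thesis
    by (cases f) (simp add: arc_product_def link_sign_def wedge_self)
next
  case ne: False
  note v = virtual_stringD[OF assms(1)]
  obtain a b c d where ef: "e = (a, b)" "f = (c, d)" by (cases e; cases f)
  have S: "{a, b, c, d} \<subseteq> S1" and dist: "distinct [a, b, c, d]"
    using v(2)[of a b] v(2)[of c d] v(3)[of a b c d] assms(2,3) ne by (auto simp: ef)
  let ?I = "\<lambda>(p, q). of_bool (p \<in> arc_interior a b \<and> q \<in> arc_interior c d) -
       of_bool (p \<in> arc_interior c d \<and> q \<in> arc_interior a b) :: real"
  let ?T = "\<lambda>(p, q). weight a b p * weight c d q - weight c d p * weight a b q"
  have "real_of_int (arc_product \<alpha> e f) = (\<Sum>g\<in>\<alpha>. ?I g)"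
    by (simp add: arc_product_def ef case_prod_unfold real_card_filter[OF v(1)] sum_subtractf)
  also have "\<dots> = (\<Sum>g\<in>\<alpha> - {e, f}. ?I g)"
    by (rule sum.mono_neutral_right) (use v(1) in \<open>auto simp: ef\<close>)
  also have "\<dots> = (\<Sum>g\<in>\<alpha> - {e, f}. ?T g)"
  proof (rule sum.cong[OF refl])
    fix g assume g: "g \<in> \<alpha> - {e, f}"
    obtain p q where pq: "g = (p, q)" by (cases g)
    have "p \<noteq> a" "p \<noteq> b" "q \<noteq> a" "q \<noteq> b" "p \<noteq> c" "p \<noteq> d" "q \<noteq> c" "q \<noteq> d"
      using v(3)[of p q a b] v(3)[of p q c d] g assms(2,3) by (auto simp: ef pq)
    then show "?I g = ?T g" by (auto simp: pq weight_indicator)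
  qed
  finally have prod: "real_of_int (arc_product \<alpha> e f) = (\<Sum>g\<in>\<alpha> - {e, f}. ?T g)" .
  have "(\<Sum>g\<in>\<alpha>. ?T g) = (\<Sum>g\<in>\<alpha> - {e, f}. ?T g) + (\<Sum>g\<in>{e, f}. ?T g)"
    by (rule sum.subset_diff) (use v(1) assms in auto)
  also have "(\<Sum>g\<in>{e, f}. ?T g) = (weight c d b - weight c d a) / 2 + (weight a b c - weight a b d) / 2"
    using ne by (simp add: ef field_simps)
  also have "\<dots> = weight a b c - weight a b d"
    using weight_link[OF S dist] by simp
  also have "\<dots> = real_of_int (link_sign e f)"
    using dist S arc_interior_swap[of a b c] arc_interior_swap[of a b d]
    by (auto simp: ef link_sign_def weight_indicator)
  finally show ?thesis using prod by (simp add: wedge_def ef)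
qed

lemma arrow_weight_fun: "arrow_weight None = (\<lambda>_. 1)" "arrow_weight (Some (a, b)) = weight a b"
  by (rule ext, simp)+

text \<open>
  All four cases in the definition of the matrix are instances of a single bilinear expression.
  Skew-symmetry becomes obvious, and the effect of a move can be computed from the few weights
  that it changes.
\<close>

lemma string_form_wedge:
  assumes v: "virtual_string \<alpha>" and "x \<in> with_base \<alpha>" "y \<in> with_base \<alpha>"
  shows "real_of_int (string_form \<alpha> x y) = wedge \<alpha> (arrow_weight x) (arrow_weight y)"
proof -
  have ln: "real_of_int (link_number \<alpha> e) = wedge \<alpha> (arrow_weight (Some e)) (arrow_weight None)"
    if "e \<in> \<alpha>" for e
  proof -
    obtain a b where "e = (a, b)" by (cases e)
    moreover have "arrow_weight (Some (a, b)) = weight a b" by (rule ext) simp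
    ultimately show ?thesis using link_number_weight[OF v, of a b] that by (simp add: arrow_weight_fun(1))
  qed
  show ?thesis
  proof (cases x)
    case None
    then show ?thesis
      using assms(3) ln wedge_swap[of \<alpha> "arrow_weight None"] by (auto simp: wedge_self)
  next
    case (Some e)
    then show ?thesis
      using assms ln arc_product_weight[OF v] by (cases y) auto
  qed
qed

lemma string_matrix_simps [simp]:
  "elems (string_matrix \<alpha>) = with_base \<alpha>" "base (string_matrix \<alpha>) = None"
  "bform (string_matrix \<alpha>) = string_form \<alpha>"
  by (simp_all add: string_matrix_def)

lemma string_form_eqI:
  assumes "virtual_string \<alpha>" "virtual_string \<beta>"
    "x \<in> with_base \<alpha>" "y \<in> with_base \<alpha>"
    "x' \<in> with_base \<beta>" "y' \<in> with_base \<beta>"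
    "wedge \<alpha> (arrow_weight x) (arrow_weight y) = wedge \<beta> (arrow_weight x') (arrow_weight y')"
  shows "string_form \<alpha> x y = string_form \<beta> x' y'"
  using string_form_wedge[OF assms(1,3,4)] string_form_wedge[OF assms(2,5,6)] assms(7) by linarith

lemma based_string_matrix:
  assumes v: "virtual_string \<alpha>" shows "based_matrix (string_matrix \<alpha>)"
proof (rule based_matrixI)
  show "finite (elems (string_matrix \<alpha>))" using virtual_stringD(1)[OF v] by simp
  fix x assume x: "x \<in> elems (string_matrix \<alpha>)"
  show "bform (string_matrix \<alpha>) x x = 0"
    using string_form_wedge[OF v, of x x] x by (simp add: wedge_self)
  fix y assume y: "y \<in> elems (string_matrix \<alpha>)"
  show "bform (string_matrix \<alpha>) x y = - bform (string_matrix \<alpha>) y x"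
    using string_form_wedge[OF v, of x y] string_form_wedge[OF v, of y x] x y
      wedge_swap[of \<alpha> "arrow_weight x" "arrow_weight y"] by simp
qed simp

lemma singular_matrix_string:
  "virtual_string \<alpha> \<Longrightarrow> d \<in> \<alpha> \<Longrightarrow> singular_matrix (singular_string_matrix (\<alpha>, d, \<epsilon>))"
  using based_string_matrix by (auto simp: singular_matrix_def)

section \<open>Arrows with an empty arc\<close>

lemma adjacent_weight:
  assumes "adjacent V a a' t" "x \<in> V" "y \<in> V"
  shows "arrow_weight (Some (x, y)) a = arrow_weight (Some (x, y)) a'"
  using assms by (simp add: adjacent_def)

lemma wedge_cong:
  assumes "\<And>z. z \<in> endpoints \<alpha> \<Longrightarrow> u z = u' z" "\<And>z. z \<in> endpoints \<alpha> \<Longrightarrow> v z = v' z"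
  shows "wedge \<alpha> u v = wedge \<alpha> u' v'"
  unfolding wedge_def using assms endpointsI by (intro sum.cong refl) (auto split: prod.split)

lemma wedge_add: "wedge \<alpha> (\<lambda>z. u z + v z) w = wedge \<alpha> u w + wedge \<alpha> v w"
  by (simp add: wedge_def case_prod_unfold algebra_simps flip: sum.distrib sum_subtractf)

lemma wedge_insert:
  assumes "finite \<alpha>" "(p, q) \<notin> \<alpha>"
  shows "wedge (insert (p, q) \<alpha>) u v = u p * v q - v p * u q + wedge \<alpha> u v"
  using assms by (simp add: wedge_def)

lemma wedge_zero: "(\<And>z. z \<in> endpoints \<alpha> \<Longrightarrow> u z = 0) \<Longrightarrow> wedge \<alpha> u v = 0"
  using wedge_cong[of \<alpha> u "\<lambda>_. 0" v v] by (simp add: wedge_def)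

lemma endpoints_insert [simp]: "endpoints (insert (p, q) \<alpha>) = insert p (insert q (endpoints \<alpha>))"
  by (auto simp: endpoints_def)

lemma endpoints_Diff_arrow:
  assumes "virtual_string \<alpha>" "(a, b) \<in> \<alpha>"
  shows "endpoints (\<alpha> - {(a, b)}) = endpoints \<alpha> - {a, b}"
proof -
  note v = virtual_stringD(3)[OF assms(1) _ assms(2)]
  show ?thesis using v assms(2) unfolding endpoints_def by (fastforce simp: image_iff)
qed

text \<open>
  The weight of an empty arc lives only at its ends \<open>a\<close> and \<open>b\<close>, where every other weight takes
  equal values; so the single remaining term of the form cancels.
\<close>

lemma wedge_empty_arc:
  assumes v: "virtual_string \<alpha>" and e: "e \<in> \<alpha>" "e = (a, b) \<or> e = (b, a)"
    and empty: "arc_interior a b \<inter> endpoints \<alpha> = {}" and y: "y \<in> with_base \<alpha>"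
  shows "wedge \<alpha> (weight a b) (arrow_weight y) = 0"
proof -
  let ?u = "arrow_weight y"
  let ?\<alpha> = "\<alpha> - {e}"
  have ab: "a \<in> S1" "b \<in> S1" "a \<noteq> b" using virtual_stringD(2)[OF v] e by auto
  have V: "endpoints ?\<alpha> = endpoints \<alpha> - {a, b}"
    using endpoints_Diff_arrow[OF v] e by (auto simp: insert_commute)
  have "endpoints \<alpha> \<subseteq> S1" using v by (simp add: virtual_string_def)
  then have adj: "adjacent (endpoints ?\<alpha>) a b (1/2)"
    using empty V by (intro adjacent_arc ab) (auto simp: circle_arc_def)
  have u: "?u a = ?u b"
  proof (cases "y \<in> {None, Some e}")
    case True
    then show ?thesis using e(2) by auto
  next
    case False
    then obtain p q where "y = Some (p, q)" "(p, q) \<in> ?\<alpha>" using y by auto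
    then show ?thesis using adjacent_weight[OF adj] endpointsI[of p q ?\<alpha>] by auto
  qed
  have "wedge ?\<alpha> (weight a b) ?u = 0"
    using V empty by (intro wedge_zero) (auto simp: weight_def)
  moreover have "wedge (insert e ?\<alpha>) (weight a b) ?u = wedge ?\<alpha> (weight a b) ?u"
    using e(2) u virtual_stringD(1)[OF v] wedge_insert[of ?\<alpha> a b] wedge_insert[of ?\<alpha> b a] by auto
  ultimately show ?thesis using e(1) by (simp add: insert_absorb)
qed

lemma empty_arc_annihilating:
  assumes v: "virtual_string \<alpha>" and e: "(a, b) \<in> \<alpha>" and empty: "arc_interior a b \<inter> endpoints \<alpha> = {}"
  shows "annihilating (string_matrix \<alpha>) (Some (a, b))"
proof -
  have "arrow_weight (Some (a, b)) = weight a b" by (rule ext) simp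
  then have "string_form \<alpha> (Some (a, b)) y = 0" if "y \<in> with_base \<alpha>" for y
    using wedge_empty_arc[OF v e _ empty that] string_form_wedge[OF v _ that, of "Some (a, b)"] e by simp
  then show ?thesis using e by (simp add: annihilating_def)
qed

text \<open>
  The weight of the other arc is one minus the weight of the empty arc, hence acts like that of
  the base.
\<close>

lemma empty_arc_core:
  assumes v: "virtual_string \<alpha>" and e: "(b, a) \<in> \<alpha>" and empty: "arc_interior a b \<inter> endpoints \<alpha> = {}"
  shows "core (string_matrix \<alpha>) (Some (b, a))"
proof -
  have ab: "a \<in> S1" "b \<in> S1" "a \<noteq> b" using virtual_stringD(2)[OF v e] by auto
  have S: "endpoints \<alpha> \<subseteq> S1" using v by (simp add: virtual_string_def)
  have "string_form \<alpha> (Some (b, a)) y = string_form \<alpha> None y" if y: "y \<in> with_base \<alpha>" for y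
  proof -
    let ?u = "arrow_weight y"
    have "wedge \<alpha> (arrow_weight None) ?u = wedge \<alpha> (\<lambda>z. arrow_weight (Some (b, a)) z + weight a b z) ?u"
      using weight_swap[OF ab(1,2) _ ab(3)] S by (intro wedge_cong) auto
    also have "\<dots> = wedge \<alpha> (arrow_weight (Some (b, a))) ?u"
      using wedge_empty_arc[OF v e _ empty y] by (simp add: wedge_add arrow_weight_fun(2))
    finally show ?thesis using e y by (intro string_form_eqI[OF v v]) auto
  qed
  then show ?thesis using e by (simp add: core_def)
qed

lemma semi_trivial_dist:
  assumes "virtual_string \<alpha>" "d \<in> \<alpha>" "semi_trivial (\<alpha>, d, \<epsilon>)"
  shows "trivial_dist (singular_string_matrix (\<alpha>, d, \<epsilon>))"
proof -
  obtain a b where d: "d = (a, b)" by (cases d)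
  then show ?thesis
    using assms empty_arc_annihilating[of \<alpha> a b] empty_arc_core[of \<alpha> a b]
    by (auto simp: trivial_dist_def)
qed

section \<open>The matrix under moves of Types 1 and 2\<close>

lemma extends_string_matrix:
  assumes "virtual_string \<alpha>" "virtual_string \<beta>" "\<alpha> \<subseteq> \<beta>"
    and "\<And>x y. x \<in> with_base \<alpha> \<Longrightarrow> y \<in> with_base \<alpha> \<Longrightarrow>
      wedge (\<beta> - \<alpha>) (arrow_weight x) (arrow_weight y) = 0"
  shows "extends (string_matrix \<alpha>) (string_matrix \<beta>) (Some ` (\<beta> - \<alpha>))"
proof -
  have "string_form \<beta> x y = string_form \<alpha> x y"
    if "x \<in> with_base \<alpha>" "y \<in> with_base \<alpha>" for x y
  proof (rule string_form_eqI[OF assms(2,1)])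
    have "wedge \<beta> (arrow_weight x) (arrow_weight y) =
        wedge (\<beta> - \<alpha>) (arrow_weight x) (arrow_weight y) + wedge \<alpha> (arrow_weight x) (arrow_weight y)"
      unfolding wedge_def using virtual_stringD(1)[OF assms(2)] assms(3) by (rule sum.subset_diff[rotated])
    then show "wedge \<beta> (arrow_weight x) (arrow_weight y) = wedge \<alpha> (arrow_weight x) (arrow_weight y)"
      using assms(4) that by simp
  qed (use that assms(3) in auto)
  then show ?thesis
    unfolding extends_def using based_string_matrix assms by auto
qed

lemma type1E:
  assumes "type1 \<alpha> \<beta>"
  obtains a b e where "a \<in> S1" "b \<in> S1" "a \<noteq> b" "circle_arc a b \<inter> endpoints \<alpha> = {}"
    "\<beta> = insert e \<alpha>" "e = (a, b) \<or> e = (b, a)" "e \<notin> \<alpha>" "arc_interior a b \<inter> endpoints \<beta> = {}"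
proof -
  obtain a b e where ab: "a \<in> S1" "b \<in> S1" "a \<noteq> b" "circle_arc a b \<inter> endpoints \<alpha> = {}"
    and \<beta>: "\<beta> = insert e \<alpha>" and e: "e = (a, b) \<or> e = (b, a)"
    using assms unfolding type1_def by blast
  have "e \<notin> \<alpha>"
    using ab(4) e endpointsI[of a b \<alpha>] endpointsI[of b a \<alpha>] by (auto simp: circle_arc_def)
  moreover have "arc_interior a b \<inter> endpoints \<beta> = {}"
    using ab(4) e by (auto simp: \<beta> circle_arc_def)
  ultimately show ?thesis using that ab \<beta> e by blast
qed

lemma type1_extension:
  assumes v: "virtual_string \<alpha>" "virtual_string \<beta>" and t: "type1 \<alpha> \<beta>"
  shows "extension (string_matrix \<alpha>) (string_matrix \<beta>)"
proof -
  obtain a b e where ab: "a \<in> S1" "b \<in> S1" "a \<noteq> b" "circle_arc a b \<inter> endpoints \<alpha> = {}"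
    and \<beta>: "\<beta> = insert e \<alpha>" and e: "e = (a, b) \<or> e = (b, a)" and eA: "e \<notin> \<alpha>"
    and empty: "arc_interior a b \<inter> endpoints \<beta> = {}"
    using t by (rule type1E)
  have d: "\<beta> - \<alpha> = {e}" using \<beta> eA by auto
  have S: "endpoints \<alpha> \<subseteq> S1" using v by (simp add: virtual_string_def)
  then have adj: "adjacent (endpoints \<alpha>) a b (1/2)"
    using ab(4) by (intro adjacent_arc ab) auto
  have eq: "arrow_weight x a = arrow_weight x b" if "x \<in> with_base \<alpha>" for x
    using that adjacent_weight[OF adj] endpointsI by fastforce
  have "extends (string_matrix \<alpha>) (string_matrix \<beta>) (Some ` (\<beta> - \<alpha>))"
  proof (rule extends_string_matrix[OF v])
    fix x y assume "x \<in> with_base \<alpha>" "y \<in> with_base \<alpha>"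
    from eq[OF this(1)] eq[OF this(2)]
    show "wedge (\<beta> - \<alpha>) (arrow_weight x) (arrow_weight y) = 0"
      unfolding d using e by (auto simp: wedge_def)
  qed (auto simp: \<beta>)
  then have ext: "extends (string_matrix \<alpha>) (string_matrix \<beta>) {Some e}" by (simp add: d)
  have "annihilating (string_matrix \<beta>) (Some e) \<or> core (string_matrix \<beta>) (Some e)"
    using e empty_arc_annihilating[OF v(2)] empty_arc_core[OF v(2)] \<beta> empty by blast
  then show ?thesis using ext unfolding extension_iff removable_def by blast
qed

text \<open>
  The definition of a Type 2 move leaves open which end of an arc is called \<open>a\<close>; the sign of \<open>t\<close>
  accounts for that.
\<close>

lemma disjoint_arcs2_adjacent:
  assumes "disjoint_arcs2 a a' b b' x x' y y'"
  obtains t where "\<And>V. V \<subseteq> S1 - circle_arc x x' \<Longrightarrow> adjacent V a a' t"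
proof -
  have S: "a \<in> S1" "a' \<in> S1" "a \<noteq> a'" and xx: "{x, x'} = {a, a'}"
    using assms by (auto simp: disjoint_arcs2_def)
  consider "x = a" "x' = a'" | "x = a'" "x' = a" using xx by (auto simp: doubleton_eq_iff)
  then show ?thesis
  proof cases
    case 1
    then show ?thesis using that[of "1/2"] adjacent_arc[OF S] by auto
  next
    case 2
    then show ?thesis
      using that[of "- (1/2)"] adjacent_arc[OF S(2,1)] adjacent_sym S(3) by metis
  qed
qed

lemma disjoint_arcs2_swap:
  "disjoint_arcs2 a a' b b' x x' y y' \<Longrightarrow> disjoint_arcs2 b b' a a' y y' x x'"
  by (auto simp: disjoint_arcs2_def)

lemma disjoint_arcs2_ends:
  assumes "disjoint_arcs2 a a' b b' x x' y y'"
  shows "a \<in> circle_arc x x'" "a' \<in> circle_arc x x'" "b \<in> circle_arc y y'" "b' \<in> circle_arc y y'"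
proof -
  have "{a, a'} = {x, x'}" "{b, b'} = {y, y'}"
    using assms by (auto simp: disjoint_arcs2_def)
  moreover have "{x, x'} \<subseteq> circle_arc x x'" "{y, y'} \<subseteq> circle_arc y y'"
    by (auto simp: circle_arc_def)
  ultimately have "{a, a'} \<subseteq> circle_arc x x'" "{b, b'} \<subseteq> circle_arc y y'" by simp_all
  then show "a \<in> circle_arc x x'" "a' \<in> circle_arc x x'" "b \<in> circle_arc y y'" "b' \<in> circle_arc y y'"
    by auto
qed

text \<open>
  The weights of \<open>(a, b)\<close> and \<open>(b', a')\<close> add up to \<open>1 + \<delta>\<close>, where \<open>\<delta>\<close> is supported on the four
  points \<open>a, a', b, b'\<close> and constant on each of the two arcs. The form pairs \<open>\<delta>\<close> to zero with
  all weights, because the two arrows contribute opposite amounts.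
\<close>

lemma bigon_complementary:
  assumes v: "virtual_string \<beta>" and e: "(a, b) \<in> \<beta>" "(b', a') \<in> \<beta>"
    and arcs: "disjoint_arcs2 a a' b b' x x' y y'"
    and empty: "(arc_interior x x' \<union> arc_interior y y') \<inter> endpoints \<beta> = {}"
  shows "complementary (string_matrix \<beta>) (Some (a, b)) (Some (b', a'))"
proof -
  note vD = virtual_stringD[OF v]
  have ends: "{x, x'} = {a, a'}" "{y, y'} = {b, b'}" and ne: "a \<noteq> a'" "b \<noteq> b'"
    and dis: "circle_arc x x' \<inter> circle_arc y y' = {}" and S: "{a, a', b, b'} \<subseteq> S1"
    using arcs by (auto simp: disjoint_arcs2_def)
  note mem = disjoint_arcs2_ends[OF arcs]
  have ab: "a \<noteq> b'" "a' \<noteq> b" "a \<noteq> b" "a' \<noteq> b'" using dis mem by auto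
  let ?\<alpha> = "\<beta> - {(a, b), (b', a')}"
  let ?V = "endpoints ?\<alpha>"
  have SB: "endpoints \<beta> \<subseteq> S1" using v by (simp add: virtual_string_def)
  have V: "?V \<subseteq> endpoints \<beta> - {a, a', b, b'}"
  proof
    fix z assume "z \<in> ?V"
    then obtain p q where pq: "(p, q) \<in> ?\<alpha>" "z = p \<or> z = q" by (rule endpointsE)
    then show "z \<in> endpoints \<beta> - {a, a', b, b'}"
      using vD(3)[OF _ e(1), of p q] vD(3)[OF _ e(2), of p q] endpointsI[of p q \<beta>] by auto
  qed
  have "?V \<union> {b, b'} \<subseteq> S1 - circle_arc x x'" "?V \<union> {a, a'} \<subseteq> S1 - circle_arc y y'"
    using V SB S empty ends dis mem by (auto simp: circle_arc_def)
  then obtain s t where A: "adjacent (?V \<union> {b, b'}) a a' s" and B: "adjacent (?V \<union> {a, a'}) b b' t"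
    using disjoint_arcs2_adjacent[OF arcs] disjoint_arcs2_adjacent[OF disjoint_arcs2_swap[OF arcs]]
    by metis
  \<comment> \<open>The deviation from complementarity.\<close>
  define \<delta> where "\<delta> z = weight a b z + weight b' a' z - 1" for z
  have swap: "weight b' a' z = 1 - weight a' b' z" "weight b' a z = 1 - weight a b' z"
    "weight b a' z = 1 - weight a' b z" "weight b a z = 1 - weight a b z" if "z \<in> S1" for z
    using that S ab by (auto intro!: weight_swap)
  have \<delta>V: "\<delta> z = 0" if "z \<in> ?V" for z
  proof -
    have "z \<in> S1" using that V SB by auto
    moreover have "weight a b z = weight a' b z" "weight a' b z = weight a' b' z"
      using A B that by (auto simp: adjacent_def)
    ultimately show ?thesis using swap by (simp add: \<delta>_def)
  qed
  have \<delta>: "\<delta> a = s" "\<delta> a' = s" "\<delta> b = - t" "\<delta> b' = - t"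
    using A B S by (auto simp: \<delta>_def adjacent_def swap)
  have "wedge \<beta> \<delta> (arrow_weight z) = 0" if z: "z \<in> with_base \<beta>" for z
  proof -
    let ?u = "arrow_weight z"
    have ins: "\<beta> = insert (a, b) (insert (b', a') ?\<alpha>)" using e by auto
    have "wedge (insert (a, b) (insert (b', a') ?\<alpha>)) \<delta> ?u =
        s * ?u b + t * ?u a - t * ?u a' - s * ?u b' + wedge ?\<alpha> \<delta> ?u"
      using vD(1) ab by (subst wedge_insert, simp, simp, subst wedge_insert) (auto simp: \<delta>)
    then have "wedge \<beta> \<delta> ?u = s * (?u b - ?u b') + t * (?u a - ?u a')"
      using ins wedge_zero[of ?\<alpha> \<delta> ?u] \<delta>V by (simp add: algebra_simps)
    also have "\<dots> = 0"
    proof -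
      consider "z = None" | "z = Some (a, b)" | "z = Some (b', a')" | p q where "z = Some (p, q)" "(p, q) \<in> ?\<alpha>"
        using z by auto
      then show ?thesis
      proof cases
        case 2
        have w: "weight a b a' = 1/2 + s" "weight a b b' = 1/2 - t"
          using A B unfolding adjacent_def by blast+
        show ?thesis unfolding 2 arrow_weight.simps w weight_ends by (simp add: algebra_simps)
      next
        case 3
        have w: "weight b' a' a = 1/2 + s" "weight b' a' b = 1/2 - t"
          using A B unfolding adjacent_def by blast+
        show ?thesis unfolding 3 arrow_weight.simps w weight_ends by (simp add: algebra_simps)
      next
        case 4
        then show ?thesis using adjacent_weight[OF A, of p q] adjacent_weight[OF B, of p q] endpointsI[of p q ?\<alpha>]
          by auto
      qed simp
    qed
    finally show ?thesis .
  qed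
  moreover have "real_of_int (string_form \<beta> (Some (a, b)) z + string_form \<beta> (Some (b', a')) z -
      string_form \<beta> None z) = wedge \<beta> \<delta> (arrow_weight z)" if z: "z \<in> with_base \<beta>" for z
  proof -
    have "wedge \<beta> \<delta> (arrow_weight z) = wedge \<beta> (weight a b) (arrow_weight z) +
        wedge \<beta> (weight b' a') (arrow_weight z) - wedge \<beta> (\<lambda>_. 1) (arrow_weight z)"
      by (simp add: \<delta>_def wedge_def case_prod_unfold algebra_simps flip: sum.distrib sum_subtractf)
    then show ?thesis
      using string_form_wedge[OF v _ z] e by (simp add: arrow_weight_fun)
  qed
  ultimately have "string_form \<beta> (Some (a, b)) z + string_form \<beta> (Some (b', a')) z = string_form \<beta> None z"
    if "z \<in> with_base \<beta>" for z
    using that by (metis (no_types, lifting) eq_iff_diff_eq_0 of_int_eq_0_iff)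
  then show ?thesis using e by (simp add: complementary_def)
qed

lemma type2E:
  assumes v: "virtual_string \<alpha>" "virtual_string \<beta>" and t: "type2 \<alpha> \<beta>"
  obtains a a' b b' x x' y y' where "disjoint_arcs2 a a' b b' x x' y y'"
    "\<beta> = insert (a, b) (insert (b', a') \<alpha>)" "(a, b) \<notin> \<alpha>" "(b', a') \<notin> \<alpha>" "(a, b) \<noteq> (b', a')"
    "(circle_arc x x' \<union> circle_arc y y') \<inter> endpoints \<alpha> = {}"
    "(arc_interior x x' \<union> arc_interior y y') \<inter> endpoints \<beta> = {}"
proof -
  obtain a a' b b' x x' y y' where arcs: "disjoint_arcs2 a a' b b' x x' y y'"
    and empty: "(circle_arc x x' \<union> circle_arc y y') \<inter> endpoints \<alpha> = {}"
    and \<beta>: "\<beta> = \<alpha> \<union> {(a, b), (b', a')}"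
    using t unfolding type2_def by blast
  have ends: "{x, x'} = {a, a'}" "{y, y'} = {b, b'}"
    and dis: "circle_arc x x' \<inter> circle_arc y y' = {}"
    using arcs by (auto simp: disjoint_arcs2_def)
  note mem = disjoint_arcs2_ends[OF arcs]
  have sub: "arc_interior x x' \<subseteq> circle_arc x x' - {x, x'}" "arc_interior y y' \<subseteq> circle_arc y y' - {y, y'}"
    by (auto simp: circle_arc_def)
  have ins: "\<beta> = insert (a, b) (insert (b', a') \<alpha>)" using \<beta> by auto
  have "endpoints \<beta> = endpoints \<alpha> \<union> {a, a', b, b'}" by (auto simp: ins)
  then have emp: "(arc_interior x x' \<union> arc_interior y y') \<inter> endpoints \<beta> = {}"
    using empty sub mem dis unfolding ends by blast
  have "a \<notin> endpoints \<alpha>" "a' \<notin> endpoints \<alpha>" "a \<noteq> b'" using mem empty dis by auto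
  then show ?thesis
    using that[OF arcs ins _ _ _ empty emp] endpointsI[of a b \<alpha>] endpointsI[of b' a' \<alpha>] by blast
qed

lemma type2_extension:
  assumes v: "virtual_string \<alpha>" "virtual_string \<beta>" and t: "type2 \<alpha> \<beta>"
  shows "extension (string_matrix \<alpha>) (string_matrix \<beta>)"
proof -
  obtain a a' b b' x x' y y' where arcs: "disjoint_arcs2 a a' b b' x x' y y'"
    and \<beta>: "\<beta> = insert (a, b) (insert (b', a') \<alpha>)"
    and new: "(a, b) \<notin> \<alpha>" "(b', a') \<notin> \<alpha>" "(a, b) \<noteq> (b', a')"
    and empty: "(circle_arc x x' \<union> circle_arc y y') \<inter> endpoints \<alpha> = {}"
    and emp: "(arc_interior x x' \<union> arc_interior y y') \<inter> endpoints \<beta> = {}"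
    using v t by (rule type2E)
  have d: "\<beta> - \<alpha> = {(a, b), (b', a')}" using new by (auto simp: \<beta>)
  have S: "endpoints \<alpha> \<subseteq> S1" using v by (simp add: virtual_string_def)
  obtain s where A: "\<And>V. V \<subseteq> S1 - circle_arc x x' \<Longrightarrow> adjacent V a a' s"
    using disjoint_arcs2_adjacent[OF arcs] by blast
  obtain t where B: "\<And>V. V \<subseteq> S1 - circle_arc y y' \<Longrightarrow> adjacent V b b' t"
    using disjoint_arcs2_adjacent[OF disjoint_arcs2_swap[OF arcs]] by blast
  have A': "adjacent (endpoints \<alpha>) a a' s" and B': "adjacent (endpoints \<alpha>) b b' t"
    using A B S empty by auto
  have eq: "arrow_weight z a = arrow_weight z a' \<and> arrow_weight z b = arrow_weight z b'"
    if "z \<in> with_base \<alpha>" for z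
  proof (cases z)
    case (Some e)
    moreover obtain p q where "e = (p, q)" by (cases e)
    ultimately have "z = Some (p, q)" "(p, q) \<in> \<alpha>" using that by auto
    then show ?thesis
      using adjacent_weight[OF A', of p q] adjacent_weight[OF B', of p q] endpointsI[of p q \<alpha>] by simp
  qed simp
  have "extends (string_matrix \<alpha>) (string_matrix \<beta>) (Some ` (\<beta> - \<alpha>))"
  proof (rule extends_string_matrix[OF v])
    fix x y assume "x \<in> with_base \<alpha>" "y \<in> with_base \<alpha>"
    then show "wedge (\<beta> - \<alpha>) (arrow_weight x) (arrow_weight y) = 0"
      unfolding d using new(3) eq by (simp add: wedge_def)
  qed (auto simp: \<beta>)
  then have "extends (string_matrix \<alpha>) (string_matrix \<beta>) {Some (a, b), Some (b', a')}" by (simp add: d)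
  moreover have "complementary (string_matrix \<beta>) (Some (a, b)) (Some (b', a'))"
    by (rule bigon_complementary[OF v(2) _ _ arcs emp]) (auto simp: \<beta>)
  then have "removable (string_matrix \<beta>) {Some (a, b), Some (b', a')}"
    using new(3) unfolding removable_def by (metis option.inject)
  ultimately show ?thesis unfolding extension_iff by blast
qed

text \<open>
  A bijection of arrows that respects the skew form on weights; by \<open>string_form_wedge\<close> it
  induces an isomorphism of based matrices.
\<close>

definition wedge_iso :: "(arrow \<Rightarrow> arrow) \<Rightarrow> arrow set \<Rightarrow> arrow set \<Rightarrow> bool" where
  "wedge_iso r \<alpha> \<beta> \<longleftrightarrow> bij_betw r \<alpha> \<beta> \<and>
     (\<forall>x\<in>with_base \<alpha>. \<forall>y\<in>with_base \<alpha>.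
        wedge \<beta> (arrow_weight (map_option r x)) (arrow_weight (map_option r y)) =
        wedge \<alpha> (arrow_weight x) (arrow_weight y))"

lemma singular_iso_string:
  assumes v: "virtual_string \<alpha>" "virtual_string \<beta>" and r: "wedge_iso r \<alpha> \<beta>"
  shows "singular_iso (map_option r) (singular_string_matrix (\<alpha>, d, \<epsilon>)) (singular_string_matrix (\<beta>, r d, \<epsilon>))"
proof -
  have inj: "inj_on r \<alpha>" and im: "r ` \<alpha> = \<beta>" using r by (auto simp: wedge_iso_def bij_betw_def)
  have w: "wedge \<beta> (arrow_weight (map_option r x)) (arrow_weight (map_option r y)) =
      wedge \<alpha> (arrow_weight x) (arrow_weight y)"
    if "x \<in> with_base \<alpha>" "y \<in> with_base \<alpha>" for x y
    using r that unfolding wedge_iso_def by blast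
  have mem: "map_option r x \<in> with_base \<beta>" if "x \<in> with_base \<alpha>" for x
    using that im by auto
  have "bij_betw (map_option r) (with_base \<alpha>) (with_base \<beta>)"
    unfolding bij_betw_def
  proof
    show "inj_on (map_option r) (with_base \<alpha>)" using inj by (auto simp: inj_on_def)
  qed (auto simp: im[symmetric] image_image)
  moreover have "string_form \<beta> (map_option r x) (map_option r y) = string_form \<alpha> x y"
    if "x \<in> with_base \<alpha>" "y \<in> with_base \<alpha>" for x y
    by (rule string_form_eqI[OF v(2,1) mem[OF that(1)] mem[OF that(2)] that w[OF that]])
  ultimately show ?thesis unfolding singular_iso_def by simp
qed

lemma infinite_arrow_option: "infinite (UNIV :: arrow option set)"
proof -
  have "infinite (UNIV :: complex set)" by (rule infinite_UNIV_char_0)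
  then show ?thesis by (simp add: finite_prod)
qed

lemma iso_string_homologous:
  assumes v: "virtual_string \<alpha>" "virtual_string \<beta>" and r: "wedge_iso r \<alpha> \<beta>" and d: "d \<in> \<alpha>"
  shows "singular_homologous (singular_string_matrix (\<alpha>, d, \<epsilon>)) (singular_string_matrix (\<beta>, r d, \<epsilon>))"
  by (rule iso_singular_homologous[OF infinite_arrow_option singular_matrix_string[OF v(1) d]
        singular_iso_string[OF v r]]) auto

section \<open>The matrix under homeomorphisms\<close>

lemma homeo_string:
  assumes v: "virtual_string \<alpha>" and h: "orientation_preserving_homeo h"
  shows "virtual_string (map_prod h h ` \<alpha>)" "wedge_iso (map_prod h h) \<alpha> (map_prod h h ` \<alpha>)"
proof -
  note vD = virtual_stringD[OF v]
  obtain k where "homeomorphism S1 S1 h k" using h by (auto simp: orientation_preserving_homeo_def)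
  then have img: "h ` S1 = S1" and "inj_on h S1"
    unfolding homeomorphism_def by (auto intro: inj_on_inverseI)
  then have eq: "h x = h y \<longleftrightarrow> x = y" if "x \<in> S1" "y \<in> S1" for x y
    using that by (auto dest: inj_onD)
  have mem: "h x \<in> S1" if "x \<in> S1" for x using img that by blast
  have arc: "h z \<in> arc_interior (h x) (h y) \<longleftrightarrow> z \<in> arc_interior x y"
    if "x \<in> S1" "y \<in> S1" "z \<in> S1" "x \<noteq> y" for x y z
    using h that unfolding orientation_preserving_homeo_def by blast
  have inj: "inj_on (map_prod h h) \<alpha>"
  proof (rule inj_onI)
    fix e f assume *: "e \<in> \<alpha>" "f \<in> \<alpha>" "map_prod h h e = map_prod h h f"
    obtain a b c d where ef: "e = (a, b)" "f = (c, d)" by (cases e; cases f)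
    then show "e = f" using * vD(2)[of a b] vD(2)[of c d] by (simp add: eq)
  qed
  show "virtual_string (map_prod h h ` \<alpha>)"
    unfolding virtual_string_def
  proof (intro conjI ballI)
    show "finite (map_prod h h ` \<alpha>)" using vD(1) by simp
    show "endpoints (map_prod h h ` \<alpha>) \<subseteq> S1"
      using vD(2) mem by (fastforce simp: endpoints_def)
    fix e assume "e \<in> map_prod h h ` \<alpha>"
    then obtain a b where ab: "(a, b) \<in> \<alpha>" "e = (h a, h b)" by auto
    then show "case e of (a, b) \<Rightarrow> a \<noteq> b" using vD(2)[of a b] by (simp add: eq)
    show "case e of (a, b) \<Rightarrow> \<forall>(c, d)\<in>map_prod h h ` \<alpha>. (a, b) \<noteq> (c, d) \<longrightarrow> {a, b} \<inter> {c, d} = {}"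
    proof -
      have key: "{h a, h b} \<inter> {h c, h d} = {}" if "(c, d) \<in> \<alpha>" "(h a, h b) \<noteq> (h c, h d)" for c d
      proof -
        have "(a, b) \<noteq> (c, d)" using that(2) by auto
        then show ?thesis
          using vD(3)[OF ab(1) that(1)] vD(2)[OF ab(1)] vD(2)[OF that(1)]
            eq[of a c] eq[of a d] eq[of b c] eq[of b d] by blast
      qed
      show ?thesis
        unfolding ab(2) prod.case
      proof
        fix f assume "f \<in> map_prod h h ` \<alpha>"
        then obtain c d where cd: "(c, d) \<in> \<alpha>" "f = (h c, h d)" by auto
        show "case f of (c, d) \<Rightarrow> (h a, h b) \<noteq> (c, d) \<longrightarrow> {h a, h b} \<inter> {c, d} = {}"
          unfolding cd(2) prod.case using key[OF cd(1)] by blast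
      qed
    qed
  qed
  have weight: "arrow_weight (map_option (map_prod h h) x) (h z) = arrow_weight x z"
    if "x \<in> with_base \<alpha>" "z \<in> S1" for x z
  proof (cases x)
    case (Some e)
    moreover obtain a b where "e = (a, b)" by (cases e)
    ultimately have e: "x = Some (a, b)" and ab: "a \<in> S1" "b \<in> S1" "a \<noteq> b"
      using that vD(2)[of a b] by auto
    show ?thesis
      unfolding e using eq[OF that(2) ab(1)] eq[OF that(2) ab(2)] arc[OF ab(1,2) that(2) ab(3)]
      by (simp add: weight_def)
  qed simp
  show "wedge_iso (map_prod h h) \<alpha> (map_prod h h ` \<alpha>)"
    unfolding wedge_iso_def
  proof (intro conjI ballI)
    show "bij_betw (map_prod h h) \<alpha> (map_prod h h ` \<alpha>)" using inj by (rule inj_on_imp_bij_betw)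
    fix x y assume x: "x \<in> with_base \<alpha>" and y: "y \<in> with_base \<alpha>"
    show "wedge (map_prod h h ` \<alpha>) (arrow_weight (map_option (map_prod h h) x))
          (arrow_weight (map_option (map_prod h h) y)) =
        wedge \<alpha> (arrow_weight x) (arrow_weight y)"
      unfolding wedge_def sum.reindex[OF inj]
    proof (rule sum.cong[OF refl])
      fix e assume "e \<in> \<alpha>"
      moreover obtain p q where "e = (p, q)" by (cases e)
      ultimately show "((\<lambda>(p, q). arrow_weight (map_option (map_prod h h) x) p * arrow_weight (map_option (map_prod h h) y) q -
            arrow_weight (map_option (map_prod h h) y) p * arrow_weight (map_option (map_prod h h) x) q) \<circ>
           map_prod h h) e =
        (case e of (p, q) \<Rightarrow> arrow_weight x p * arrow_weight y q - arrow_weight y p * arrow_weight x q)"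
        using vD(2)[of p q] x y by (simp add: weight del: arrow_weight.simps)
    qed
  qed
qed

section \<open>The matrix under moves of Type 3\<close>

text \<open>
  Possible weights \<open>U\<close>, \<open>U'\<close> before and after a Type 3a move at the points
  \<open>a, a\<^sup>+, b, b\<^sup>+, c, c\<^sup>+\<close>: in the first line of the base or an arrow that is not moved, then of
  the three moved arrows. The number \<open>\<gamma>\<close> is \<open>1\<close> if \<open>c\<close> lies on the arc from \<open>a\<close> to \<open>b\<close>
  and \<open>0\<close> otherwise.
\<close>

definition corner_table_3a :: "real \<Rightarrow> real list \<Rightarrow> real list \<Rightarrow> bool" where
  "corner_table_3a \<gamma> U U' \<longleftrightarrow>
     (\<exists>x y z. U = [x, x, y, y, z, z] \<and> U' = U) \<or>
     (U = [0, 1/2, 1/2, 0, \<gamma>, \<gamma>] \<and> U' = [1/2, 1, 1, 1/2, \<gamma>, \<gamma>]) \<or>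
     (U = [\<gamma>, \<gamma>, 0, 1/2, 1/2, 0] \<and> U' = [\<gamma>, \<gamma>, 1/2, 1, 1, 1/2]) \<or>
     (U = [1/2, 0, \<gamma>, \<gamma>, 0, 1/2] \<and> U' = [1, 1/2, \<gamma>, \<gamma>, 1/2, 1])"

text \<open>
  The same for a Type 3b move. One of the three arrows goes from \<open>a\<close> to \<open>c\<close>, against the cyclic
  order of the others, whence the entries \<open>1 - \<gamma>\<close>.
\<close>

definition corner_table_3b :: "real \<Rightarrow> real list \<Rightarrow> real list \<Rightarrow> bool" where
  "corner_table_3b \<gamma> U U' \<longleftrightarrow>
     (\<exists>x y z. U = [x, x, y, y, z, z] \<and> U' = U) \<or>
     (U = [1/2, 1, 1/2, 0, \<gamma>, \<gamma>] \<and> U' = [0, 1/2, 1, 1/2, \<gamma>, \<gamma>]) \<or>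
     (U = [0, 1/2, 1 - \<gamma>, 1 - \<gamma>, 1/2, 0] \<and> U' = [1/2, 1, 1 - \<gamma>, 1 - \<gamma>, 1, 1/2]) \<or>
     (U = [\<gamma>, \<gamma>, 0, 1/2, 1, 1/2] \<and> U' = [\<gamma>, \<gamma>, 1/2, 1, 1/2, 0])"

text \<open>
  The three moved arrows contribute equally before and after the move. This is a finite check of
  four by four cases; it uses \<open>\<gamma>\<^sup>2 = \<gamma>\<close>.
\<close>

lemma triangle_3a:
  assumes "corner_table_3a \<gamma> [ua, uap, ub, ubp, uc, ucp] [ua', uap', ub', ubp', uc', ucp']"
    "corner_table_3a \<gamma> [va, vap, vb, vbp, vc, vcp] [va', vap', vb', vbp', vc', vcp']" "\<gamma> = 0 \<or> \<gamma> = 1"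
  shows "(ua' * vbp' - va' * ubp') + (ub' * vcp' - vb' * ucp') + (uc' * vap' - vc' * uap') =
     (uap * vb - vap * ub) + (ubp * vc - vbp * uc) + (ucp * va - vcp * ua)"
  using assms unfolding corner_table_3a_def list.inject
  by (elim disjE exE conjE; hypsubst; simp add: field_simps)

lemma triangle_3b:
  assumes "corner_table_3b \<gamma> [ua, uap, ub, ubp, uc, ucp] [ua', uap', ub', ubp', uc', ucp']"
    "corner_table_3b \<gamma> [va, vap, vb, vbp, vc, vcp] [va', vap', vb', vbp', vc', vcp']" "\<gamma> = 0 \<or> \<gamma> = 1"
  shows "(uap' * vbp' - vap' * ubp') + (ua' * vcp' - va' * ucp') + (ub' * vc' - vb' * uc') =
     (ua * vb - va * ub) + (uap * vc - vap * uc) + (ubp * vcp - vbp * ucp)"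
  using assms unfolding corner_table_3b_def list.inject
  by (elim disjE exE conjE; hypsubst; simp add: field_simps)

lemma adjacentD:
  assumes "adjacent V a a' t" "u \<in> V"
  shows "weight a u a' = 1/2 + t" "weight a' u a = 1/2 - t"
    "weight u a a' = 1/2 - t" "weight u a' a = 1/2 + t"
    "z \<in> V \<Longrightarrow> weight a' u z = weight a u z" "z \<in> V \<Longrightarrow> weight u a' z = weight u a z"
    "z \<in> V \<Longrightarrow> weight u z a' = weight u z a"
  using assms unfolding adjacent_def by (blast, blast, blast, blast, metis, metis, metis)

text \<open>
  The values for the arrow from \<open>a\<close> or \<open>a\<^sup>+\<close> to \<open>b\<close> or \<open>b\<^sup>+\<close>. Permuting the three arcs
  gives the values for the other arrows.
\<close>

lemma corner_weights:
  assumes A: "adjacent (V \<union> {b, bp, c, cp}) a ap (1/2)" and B: "adjacent (V \<union> {a, ap, c, cp}) b bp (1/2)"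
    and C: "adjacent (V \<union> {a, ap, b, bp}) c cp (1/2)" and \<gamma>: "weight a b c = \<gamma>"
  shows "map (weight a b) [a, ap, b, bp, c, cp] = [1/2, 1, 1/2, 0, \<gamma>, \<gamma>]"
    "map (weight ap b) [a, ap, b, bp, c, cp] = [0, 1/2, 1/2, 0, \<gamma>, \<gamma>]"
    "map (weight a bp) [a, ap, b, bp, c, cp] = [1/2, 1, 1, 1/2, \<gamma>, \<gamma>]"
    "map (weight ap bp) [a, ap, b, bp, c, cp] = [0, 1/2, 1, 1/2, \<gamma>, \<gamma>]"
    "z \<in> V \<Longrightarrow> weight ap b z = weight a b z" "z \<in> V \<Longrightarrow> weight a bp z = weight a b z"
    "z \<in> V \<Longrightarrow> weight ap bp z = weight a b z"
proof -
  have z: "weight ap b z = weight a b z" "weight a bp z = weight a b z" "weight ap bp z = weight a b z"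
    if "z \<in> V \<union> {c, cp}" for z
  proof -
    show "weight ap b z = weight a b z" using that adjacentD(5)[OF A] by auto
    show ab: "weight a bp z = weight a b z" using that adjacentD(6)[OF B] by auto
    have "weight ap bp z = weight a bp z" using that adjacentD(5)[OF A] by auto
    then show "weight ap bp z = weight a b z" using ab by simp
  qed
  have cp: "weight a b cp = weight a b c" using adjacentD(7)[OF C, of a b] by auto
  note zc = z[of c] z[of cp]
  have ends: "weight a b ap = 1" "weight ap b a = 0" "weight a bp ap = 1" "weight ap bp a = 0"
    "weight a b bp = 0" "weight ap b bp = 0" "weight a bp b = 1" "weight ap bp b = 1"
    using adjacentD(1,2)[OF A, of b] adjacentD(1,2)[OF A, of bp]
      adjacentD(3,4)[OF B, of a] adjacentD(3,4)[OF B, of ap] by simp_all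
  show "map (weight a b) [a, ap, b, bp, c, cp] = [1/2, 1, 1/2, 0, \<gamma>, \<gamma>]"
    "map (weight ap b) [a, ap, b, bp, c, cp] = [0, 1/2, 1/2, 0, \<gamma>, \<gamma>]"
    "map (weight a bp) [a, ap, b, bp, c, cp] = [1/2, 1, 1, 1/2, \<gamma>, \<gamma>]"
    "map (weight ap bp) [a, ap, b, bp, c, cp] = [0, 1/2, 1, 1/2, \<gamma>, \<gamma>]"
    using ends zc cp \<gamma> by simp_all
  show "z \<in> V \<Longrightarrow> weight ap b z = weight a b z" "z \<in> V \<Longrightarrow> weight a bp z = weight a b z"
    "z \<in> V \<Longrightarrow> weight ap bp z = weight a b z"
    using z by auto
qed

text \<open>
  Since the moved arrows keep their weights away from the three arcs, only the three terms of
  the moved arrows have to be compared.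
\<close>

lemma replace_three:
  assumes fin: "finite \<alpha>" and R: "R = {(e1, f1), (e2, f2), (e3, f3)}" and dom: "Domain R \<subseteq> \<alpha>"
    and de: "distinct [e1, e2, e3]" and df: "distinct [f1, f2, f3]" and new: "f1 \<notin> \<alpha>" "f2 \<notin> \<alpha>" "f3 \<notin> \<alpha>"
    and \<beta>: "\<beta> = (\<alpha> - Domain R) \<union> Range R"
    and rest: "\<And>e f z. (e, f) \<in> R \<Longrightarrow> z \<in> endpoints (\<alpha> - Domain R) \<Longrightarrow>
      arrow_weight (Some f) z = arrow_weight (Some e) z"
  defines "r \<equiv> id(e1 := f1, e2 := f2, e3 := f3)"
  assumes three: "\<And>x y. x \<in> with_base \<alpha> \<Longrightarrow> y \<in> with_base \<alpha> \<Longrightarrow>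
      wedge {f1, f2, f3} (arrow_weight (map_option r x)) (arrow_weight (map_option r y)) =
      wedge {e1, e2, e3} (arrow_weight x) (arrow_weight y)"
  shows "wedge_iso r \<alpha> \<beta>" "\<forall>(e, f)\<in>R. r e = f" "\<forall>e\<in>\<alpha> - Domain R. r e = e"
proof -
  let ?\<rho> = "\<alpha> - Domain R"
  have D: "Domain R = {e1, e2, e3}" and Rg: "Range R = {f1, f2, f3}" by (auto simp: R)
  have rR: "r e = f" if "(e, f) \<in> R" for e f using that de by (auto simp: r_def R)
  have rid: "r e = e" if "e \<in> ?\<rho>" for e using that by (auto simp: r_def R)
  have img: "r ` ?\<rho> = ?\<rho>" "r ` {e1, e2, e3} = {f1, f2, f3}"
    using rid rR[of e1 f1] rR[of e2 f2] rR[of e3 f3] by (force, simp add: R)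
  have split: "\<alpha> = ?\<rho> \<union> {e1, e2, e3}" using dom D by auto
  have "r ` \<alpha> = \<beta>" using img unfolding \<beta> Rg by (subst split) (simp only: image_Un)
  moreover have "inj_on r \<alpha>"
    using de df new dom unfolding D by (auto simp: inj_on_def r_def)
  ultimately have bij: "bij_betw r \<alpha> \<beta>" by (simp add: bij_betw_def)
  show "\<forall>(e, f)\<in>R. r e = f" "\<forall>e\<in>\<alpha> - Domain R. r e = e" using rR rid by auto
  show "wedge_iso r \<alpha> \<beta>"
    unfolding wedge_iso_def
  proof (intro conjI ballI bij)
    fix x y assume x: "x \<in> with_base \<alpha>" and y: "y \<in> with_base \<alpha>"
    let ?u = "arrow_weight x" and ?v = "arrow_weight y"
    let ?u' = "arrow_weight (map_option r x)" and ?v' = "arrow_weight (map_option r y)"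
    have agree: "arrow_weight (map_option r w) z = arrow_weight w z"
      if w: "w \<in> with_base \<alpha>" and z: "z \<in> endpoints ?\<rho>" for w z
    proof (cases w)
      case (Some e)
      then show ?thesis
      proof (cases "e \<in> Domain R")
        case True
        then obtain f where "(e, f) \<in> R" by blast
        then show ?thesis using rest[OF _ z] rR Some by simp
      next
        case False
        then show ?thesis using rid w Some by auto
      qed
    qed simp
    have "wedge \<beta> ?u' ?v' = wedge ?\<rho> ?u' ?v' + wedge {f1, f2, f3} ?u' ?v'"
      unfolding wedge_def \<beta> Rg using fin new by (intro sum.union_disjoint) auto
    also have "wedge ?\<rho> ?u' ?v' = wedge ?\<rho> ?u ?v"
      using agree x y by (intro wedge_cong) auto
    also have "wedge {f1, f2, f3} ?u' ?v' = wedge {e1, e2, e3} ?u ?v" using three x y .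
    also have "wedge ?\<rho> ?u ?v + wedge {e1, e2, e3} ?u ?v = wedge \<alpha> ?u ?v"
      unfolding wedge_def using fin by (subst (2) split, intro sum.union_disjoint[symmetric]) (auto simp: D)
    finally show "wedge \<beta> ?u' ?v' = wedge \<alpha> ?u ?v" .
  qed
qed

lemma type3_replacement:
  assumes v: "virtual_string \<alpha>" and t: "type3_via R \<alpha> \<beta>"
  obtains r where "wedge_iso r \<alpha> \<beta>" "\<forall>(e, f)\<in>R. r e = f" "\<forall>e\<in>\<alpha> - Domain R. r e = e"
proof -
  note vD = virtual_stringD[OF v]
  obtain a ap b bp c cp where arcs: "type3_arcs \<alpha> a ap b bp c cp"
    and R: "R = {((ap, b), (a, bp)), ((bp, c), (b, cp)), ((cp, a), (c, ap))} \<or>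
         R = {((a, b), (ap, bp)), ((ap, c), (a, cp)), ((bp, cp), (b, c))}"
    and dom: "Domain R \<subseteq> \<alpha>" and \<beta>: "\<beta> = (\<alpha> - Domain R) \<union> Range R"
    using t unfolding type3_via_def by blast
  have S: "a \<in> S1" "ap \<in> S1" "b \<in> S1" "bp \<in> S1" "c \<in> S1" "cp \<in> S1" and ne: "a \<noteq> ap" "b \<noteq> bp" "c \<noteq> cp"
    and dis: "circle_arc a ap \<inter> circle_arc b bp = {}" "circle_arc b bp \<inter> circle_arc c cp = {}"
      "circle_arc a ap \<inter> circle_arc c cp = {}"
    and empty: "(arc_interior a ap \<union> arc_interior b bp \<union> arc_interior c cp) \<inter> endpoints \<alpha> = {}"
    using arcs unfolding type3_arcs_def by blast+
  have ends: "a \<in> circle_arc a ap" "ap \<in> circle_arc a ap" "b \<in> circle_arc b bp" "bp \<in> circle_arc b bp"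
    "c \<in> circle_arc c cp" "cp \<in> circle_arc c cp"
    by (auto simp: circle_arc_def)
  have dist: "distinct [a, ap, b, bp, c, cp]"
    using ne dis ends by auto
  let ?V = "endpoints (\<alpha> - Domain R)"
  have V: "?V \<subseteq> endpoints \<alpha> - {a, ap, b, bp, c, cp}"
  proof
    fix z assume "z \<in> ?V"
    then obtain p q where pq: "(p, q) \<in> \<alpha> - Domain R" "z = p \<or> z = q" by (rule endpointsE)
    have "z \<noteq> x \<and> z \<noteq> y" if "(x, y) \<in> Domain R" for x y
      using vD(3)[of p q x y] pq that dom by auto
    then show "z \<in> endpoints \<alpha> - {a, ap, b, bp, c, cp}"
      using R pq endpointsI[of p q \<alpha>] by (elim disjE) (simp_all, blast+)
  qed
  have VS: "?V \<subseteq> S1" using V v by (auto simp: virtual_string_def)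
  have VI: "?V \<inter> circle_arc a ap = {}" "?V \<inter> circle_arc b bp = {}" "?V \<inter> circle_arc c cp = {}"
    using V empty by (auto simp: circle_arc_def)
  have out: "b \<notin> circle_arc a ap" "bp \<notin> circle_arc a ap" "c \<notin> circle_arc a ap" "cp \<notin> circle_arc a ap"
    "a \<notin> circle_arc b bp" "ap \<notin> circle_arc b bp" "c \<notin> circle_arc b bp" "cp \<notin> circle_arc b bp"
    "a \<notin> circle_arc c cp" "ap \<notin> circle_arc c cp" "b \<notin> circle_arc c cp" "bp \<notin> circle_arc c cp"
    using dis ends by (meson disjoint_iff)+
  have "?V \<union> {b, bp, c, cp} \<subseteq> S1 - circle_arc a ap" using VS S VI(1) out(1-4) by blast
  then have A: "adjacent (?V \<union> {b, bp, c, cp}) a ap (1/2)" by (rule adjacent_arc[OF S(1,2) ne(1)])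
  have "?V \<union> {a, ap, c, cp} \<subseteq> S1 - circle_arc b bp" using VS S VI(2) out(5-8) by blast
  then have B: "adjacent (?V \<union> {a, ap, c, cp}) b bp (1/2)" by (rule adjacent_arc[OF S(3,4) ne(2)])
  have "?V \<union> {a, ap, b, bp} \<subseteq> S1 - circle_arc c cp" using VS S VI(3) out(9-12) by blast
  then have C: "adjacent (?V \<union> {a, ap, b, bp}) c cp (1/2)" by (rule adjacent_arc[OF S(5,6) ne(3)])
  have perm: "{a, ap, c, cp} = {c, cp, a, ap}" "{b, bp, c, cp} = {c, cp, b, bp}" "{a, ap, b, bp} = {b, bp, a, ap}"
    by auto
  define \<gamma> where "\<gamma> = weight a b c"
  have \<gamma>: "\<gamma> = 0 \<or> \<gamma> = 1" unfolding \<gamma>_def using dist by (intro weight_01) auto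
  have rot: "weight b c a = \<gamma>" "weight c a b = \<gamma>"
    using weight_rotate[of a b c] weight_rotate[of b c a] S dist by (auto simp: \<gamma>_def)
  have rot': "weight a c b = 1 - \<gamma>"
    using weight_swap[of c a b] S dist rot(2) by auto
  note ab = corner_weights[OF A B C \<gamma>_def[symmetric]]
  note bc = corner_weights[OF B[unfolded perm(1)] C[unfolded perm(3)] A rot(1)]
  note ca = corner_weights[OF C A[unfolded perm(2)] B[unfolded perm(1)] rot(2)]
  note ac = corner_weights[OF A[unfolded perm(2)] C B rot']
  let ?P = "[a, ap, b, bp, c, cp]"
  have same: "\<exists>x y z. map (arrow_weight w) ?P = [x, x, y, y, z, z]"
    if w: "w \<in> with_base (\<alpha> - Domain R)" for w
  proof -
    have "arrow_weight w ap = arrow_weight w a \<and> arrow_weight w bp = arrow_weight w b \<and>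
        arrow_weight w cp = arrow_weight w c"
    proof (cases w)
      case (Some e)
      moreover obtain p q where "e = (p, q)" by (cases e)
      ultimately have pq: "w = Some (p, q)" "p \<in> ?V" "q \<in> ?V"
        using w endpointsI[of p q "\<alpha> - Domain R"] by auto
      then show ?thesis
        using adjacent_weight[OF A, of p q] adjacent_weight[OF B, of p q] adjacent_weight[OF C, of p q]
        by simp
    qed simp
    then show ?thesis by simp
  qed
  have table: "T (map (arrow_weight w) ?P) (map (arrow_weight (map_option r w)) ?P)"
    if same_T: "\<And>x y z. T [x, x, y, y, z, z] [x, x, y, y, z, z]"
      and moved: "\<forall>(e, f)\<in>R. r e = f \<and> T (map (arrow_weight (Some e)) ?P) (map (arrow_weight (Some f)) ?P)"
      and fixed: "\<And>e. e \<notin> Domain R \<Longrightarrow> r e = e" and w: "w \<in> with_base \<alpha>" for T r w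
  proof (cases "w \<in> with_base (\<alpha> - Domain R)")
    case True
    then have "map_option r w = w" using fixed by auto
    then show ?thesis using same[OF True] same_T by metis
  next
    case False
    then obtain e where "w = Some e" "e \<in> Domain R" using w by blast
    moreover from this obtain f where "(e, f) \<in> R" by blast
    ultimately show ?thesis using bspec[OF moved, of "(e, f)"] by simp
  qed
  from R show ?thesis
  proof
    assume R: "R = {((ap, b), (a, bp)), ((bp, c), (b, cp)), ((cp, a), (c, ap))}"
    define r :: "arrow \<Rightarrow> arrow" where "r = id((ap, b) := (a, bp), (bp, c) := (b, cp), (cp, a) := (c, ap))"
    have D: "Domain R = {(ap, b), (bp, c), (cp, a)}" by (auto simp: R)
    have mem: "(ap, b) \<in> \<alpha>" "(bp, c) \<in> \<alpha>" "(cp, a) \<in> \<alpha>" using dom D by auto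
    have new: "(a, bp) \<notin> \<alpha>" "(b, cp) \<notin> \<alpha>" "(c, ap) \<notin> \<alpha>"
      using vD(3)[OF _ mem(3), of a bp] vD(3)[OF _ mem(1), of b cp] vD(3)[OF _ mem(2), of c ap] dist by auto
    have tab: "corner_table_3a \<gamma> (map (arrow_weight w) ?P) (map (arrow_weight (map_option r w)) ?P)"
      if "w \<in> with_base \<alpha>" for w
    proof (rule table[OF _ _ _ that])
      show "\<forall>(e, f)\<in>R. r e = f \<and>
          corner_table_3a \<gamma> (map (arrow_weight (Some e)) ?P) (map (arrow_weight (Some f)) ?P)"
        unfolding R corner_table_3a_def using ab(2,3) bc(2,3) ca(2,3) dist by (simp add: r_def arrow_weight_fun)
    qed (auto simp: corner_table_3a_def r_def D)
    have three: "wedge {(a, bp), (b, cp), (c, ap)} (arrow_weight (map_option r x)) (arrow_weight (map_option r y)) =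
      wedge {(ap, b), (bp, c), (cp, a)} (arrow_weight x) (arrow_weight y)"
      if "x \<in> with_base \<alpha>" "y \<in> with_base \<alpha>" for x y
      using triangle_3a[OF tab[OF that(1), unfolded list.map] tab[OF that(2), unfolded list.map] \<gamma>] dist
      by (simp add: wedge_def)
    have rest: "arrow_weight (Some f) z = arrow_weight (Some e) z" if "(e, f) \<in> R" "z \<in> ?V" for e f z
      using that(1) ab(5,6)[OF that(2)] bc(5,6)[OF that(2)] ca(5,6)[OF that(2)] by (auto simp: R)
    show ?thesis
      by (rule that[of r]; unfold r_def;
          rule replace_three[OF vD(1) R dom _ _ new \<beta> rest three[unfolded r_def]];
          use dist in \<open>simp; fail\<close>)
  next
    assume R: "R = {((a, b), (ap, bp)), ((ap, c), (a, cp)), ((bp, cp), (b, c))}"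
    define r :: "arrow \<Rightarrow> arrow" where "r = id((a, b) := (ap, bp), (ap, c) := (a, cp), (bp, cp) := (b, c))"
    have D: "Domain R = {(a, b), (ap, c), (bp, cp)}" by (auto simp: R)
    have mem: "(a, b) \<in> \<alpha>" "(ap, c) \<in> \<alpha>" "(bp, cp) \<in> \<alpha>" using dom D by auto
    have new: "(ap, bp) \<notin> \<alpha>" "(a, cp) \<notin> \<alpha>" "(b, c) \<notin> \<alpha>"
      using vD(3)[OF _ mem(2), of ap bp] vD(3)[OF _ mem(1), of a cp] vD(3)[OF _ mem(1), of b c] dist by auto
    have tab: "corner_table_3b \<gamma> (map (arrow_weight w) ?P) (map (arrow_weight (map_option r w)) ?P)"
      if "w \<in> with_base \<alpha>" for w
    proof (rule table[OF _ _ _ that])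
      show "\<forall>(e, f)\<in>R. r e = f \<and>
          corner_table_3b \<gamma> (map (arrow_weight (Some e)) ?P) (map (arrow_weight (Some f)) ?P)"
        unfolding R corner_table_3b_def using ab(1,4) ac(2,3) bc(1,4) dist by (simp add: r_def arrow_weight_fun)
    qed (auto simp: corner_table_3b_def r_def D)
    have three: "wedge {(ap, bp), (a, cp), (b, c)} (arrow_weight (map_option r x)) (arrow_weight (map_option r y)) =
      wedge {(a, b), (ap, c), (bp, cp)} (arrow_weight x) (arrow_weight y)"
      if "x \<in> with_base \<alpha>" "y \<in> with_base \<alpha>" for x y
      using triangle_3b[OF tab[OF that(1), unfolded list.map] tab[OF that(2), unfolded list.map] \<gamma>] dist
      by (simp add: wedge_def)
    have rest: "arrow_weight (Some f) z = arrow_weight (Some e) z" if "(e, f) \<in> R" "z \<in> ?V" for e f z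
      using that(1) ab(7)[OF that(2)] ac(5,6)[OF that(2)] bc(7)[OF that(2)] by (auto simp: R)
    show ?thesis
      by (rule that[of r]; unfold r_def;
          rule replace_three[OF vD(1) R dom _ _ new \<beta> rest three[unfolded r_def]];
          use dist in \<open>simp; fail\<close>)
  qed
qed

section \<open>Homotopic singular strings have homologous matrices\<close>

lemma type_extension_homologous:
  assumes "virtual_string \<alpha>" "virtual_string \<beta>" "d \<in> \<alpha>"
    and ext: "extension (string_matrix \<alpha>) (string_matrix \<beta>)"
  shows "singular_homologous (singular_string_matrix (\<alpha>, d, \<epsilon>)) (singular_string_matrix (\<beta>, d, \<epsilon>))"
proof (rule singular_homologous_extension)
  have "d \<in> \<beta>" using ext assms(3) by (auto simp: extension_iff extends_def)
  then show "singular_extension (singular_string_matrix (\<alpha>, d, \<epsilon>)) (singular_string_matrix (\<beta>, d, \<epsilon>))"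
    using assms singular_matrix_string by (auto simp: singular_extension_def)
qed

lemma singular_move_homologous:
  "singular_move x y \<Longrightarrow> singular_homologous (singular_string_matrix x) (singular_string_matrix y)"
proof (induction rule: singular_move.induct)
  case (homeo \<alpha> d h \<epsilon>)
  note h = homeo_string[OF homeo(1) homeo(3)]
  show ?case
    by (rule iso_string_homologous[OF homeo(1) h(1,2) homeo(2)])
next
  case (type1 \<alpha> \<beta> d \<epsilon>)
  then show ?case by (intro type_extension_homologous type1_extension)
next
  case (type2 \<alpha> \<beta> d \<epsilon>)
  then show ?case by (intro type_extension_homologous type2_extension)
next
  case (type3 \<alpha> \<beta> d R \<epsilon>)
  obtain r where r: "wedge_iso r \<alpha> \<beta>" "\<forall>(e, f)\<in>R. r e = f" "\<forall>e\<in>\<alpha> - Domain R. r e = e"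
    using type3(1,4) by (rule type3_replacement)
  have "singular_homologous (singular_string_matrix (\<alpha>, d, \<epsilon>)) (singular_string_matrix (\<beta>, r d, \<epsilon>))"
    by (rule iso_string_homologous[OF type3(1,2) r(1) type3(3)])
  then show ?case using r(3) type3(3,5) by simp
next
  case (singular_type2 \<alpha> a b b' a' x x' y y' d d' \<epsilon>)
  have c: "complementary (string_matrix \<alpha>) (Some (a, b)) (Some (b', a'))"
    using singular_type2 by (intro bigon_complementary)
  have "complementary (string_matrix \<alpha>) (Some d') (Some d)"
    using singular_type2(6) c complementary_sym[OF c] by auto
  moreover have "d \<in> \<alpha>" using singular_type2 by auto
  ultimately show ?case
    using singular_matrix_string[OF singular_type2(1)]
    by (intro singular_homologous_N) (auto simp: N_move_def)
next
  case (singular_type3 \<alpha> \<beta> R d d' \<epsilon>)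
  obtain r where r: "wedge_iso r \<alpha> \<beta>" "\<forall>(e, f)\<in>R. r e = f" "\<forall>e\<in>\<alpha> - Domain R. r e = e"
    using singular_type3(1,3) by (rule type3_replacement)
  have d: "d \<in> \<alpha>" using singular_type3(3,4) unfolding type3_via_def by blast
  have "singular_homologous (singular_string_matrix (\<alpha>, d, \<epsilon>)) (singular_string_matrix (\<beta>, r d, \<epsilon>))"
    by (rule iso_string_homologous[OF singular_type3(1,2) r(1) d])
  then show ?case using r(2) singular_type3(4) by auto
qed

text \<open>
  The matrix of a signed singular string is a homotopy invariant. The move that makes the other
  arrow of a Type 2 pair distinguished corresponds to an \<open>N\<close>-move, moves of Types 1 and 2 to
  extensions, and the others to isomorphisms.
\<close>

lemma homotopic_homologous:
  assumes "equivclp singular_move x y"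
  shows "singular_homologous (singular_string_matrix x) (singular_string_matrix y)"
  using assms
proof (induction rule: equivclp_induct)
  case base
  show ?case by (rule singular_homologous_refl)
next
  case (step y z)
  then show ?case
    using singular_move_homologous singular_homologous_sym singular_homologous_trans by blast
qed

section \<open>Functionals on the free module\<close>

definition evaluate :: "('a \<Rightarrow> int) \<Rightarrow> ('a \<Rightarrow>\<^sub>0 int) \<Rightarrow> int" where
  "evaluate F L = (\<Sum>c\<in>Poly_Mapping.keys L. Poly_Mapping.lookup L c * F c)"

lemma evaluate_superset:
  assumes "finite S" "Poly_Mapping.keys L \<subseteq> S"
  shows "evaluate F L = (\<Sum>c\<in>S. Poly_Mapping.lookup L c * F c)"
  unfolding evaluate_def using assms
  by (intro sum.mono_neutral_left) (auto simp: in_keys_iff)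

lemma evaluate_add: "evaluate F (K + L) = evaluate F K + evaluate F L"
  and evaluate_diff: "evaluate F (K - L) = evaluate F K - evaluate F L"
proof -
  let ?S = "Poly_Mapping.keys K \<union> Poly_Mapping.keys L"
  have S: "finite ?S" by simp
  have eq: "evaluate F M = (\<Sum>c\<in>?S. Poly_Mapping.lookup M c * F c)"
    if "\<And>c. Poly_Mapping.lookup K c = 0 \<Longrightarrow> Poly_Mapping.lookup L c = 0 \<Longrightarrow> Poly_Mapping.lookup M c = 0" for M
    by (rule evaluate_superset[OF S]) (use that in \<open>auto simp: in_keys_iff\<close>)
  show "evaluate F (K + L) = evaluate F K + evaluate F L"
    by (subst (1 2 3) eq) (auto simp: lookup_add distrib_right sum.distrib)
  show "evaluate F (K - L) = evaluate F K - evaluate F L"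
    by (subst (1 2 3) eq) (auto simp: lookup_minus left_diff_distrib sum_subtractf)
qed

lemma evaluate_sum: "evaluate F (\<Sum>x\<in>A. f x) = (\<Sum>x\<in>A. evaluate F (f x))"
  by (induction A rule: infinite_finite_induct) (simp_all add: evaluate_add, simp_all add: evaluate_def)

text \<open>
  The tool for bounding \<open>t\<close> from below: the functional with suitable values in \<open>[-1, 1]\<close> detects
  the coefficients that survive.
\<close>

lemma evaluate_le_coeff_sum:
  assumes "\<And>c. \<bar>F c\<bar> \<le> 1" shows "evaluate F L \<le> coeff_sum L"
  unfolding evaluate_def coeff_sum_def
proof (rule sum_mono)
  fix c
  have "Poly_Mapping.lookup L c * F c \<le> \<bar>Poly_Mapping.lookup L c\<bar> * \<bar>F c\<bar>"
    by (metis abs_ge_self abs_mult)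
  also have "\<dots> \<le> \<bar>Poly_Mapping.lookup L c\<bar>" using assms[of c] by (simp add: mult_left_le)
  finally show "Poly_Mapping.lookup L c * F c \<le> \<bar>Poly_Mapping.lookup L c\<bar>" .
qed

lemma evaluate_generator:
  "evaluate F (class_generator x) =
     (if semi_trivial_class (singular_class x) then 0 else F (singular_class x))"
  by (simp add: class_generator_def evaluate_def)

text \<open>
  The sum of absolute values is itself the value of a functional, namely of the one given by the
  signs of the coefficients; so linearity bounds it by two for each arrow.
\<close>

lemma coeff_sum_mu_le: "coeff_sum (mu \<alpha>) \<le> 2 * int (card \<alpha>)"
proof -
  define F where "F c = sgn (Poly_Mapping.lookup (mu \<alpha>) c)" for c
  have gen: "\<bar>evaluate F (class_generator x)\<bar> \<le> 1" for x
    by (simp add: evaluate_generator F_def sgn_if)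
  have "coeff_sum (mu \<alpha>) = evaluate F (mu \<alpha>)"
    by (simp add: coeff_sum_def evaluate_def F_def abs_sgn)
  also have "\<dots> = (\<Sum>e\<in>\<alpha>. evaluate F (class_generator (\<alpha>, e, Plus) - class_generator (\<alpha>, e, Minus)))"
    by (simp add: mu_def evaluate_sum)
  also have "\<dots> \<le> (\<Sum>e\<in>\<alpha>. 2)"
  proof (rule sum_mono)
    fix e
    show "evaluate F (class_generator (\<alpha>, e, Plus) - class_generator (\<alpha>, e, Minus)) \<le> 2"
      using gen[of "(\<alpha>, e, Plus)"] gen[of "(\<alpha>, e, Minus)"] by (simp add: evaluate_diff)
  qed
  finally show ?thesis by simp
qed

section \<open>Homotopy invariance of \<open>\<mu>\<close>\<close>

lemma singular_class_eq:
  assumes "equivclp singular_move x y" shows "singular_class x = singular_class y"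
proof -
  have "equivclp singular_move x z \<longleftrightarrow> equivclp singular_move y z" for z
    using assms by (meson equivclp_sym equivclp_trans)
  then show ?thesis by (simp add: singular_class_def)
qed

lemma generator_move:
  "singular_move x y \<Longrightarrow> class_generator x = class_generator y"
  unfolding class_generator_def using singular_class_eq[OF r_into_equivclp] by metis

lemma generator_semi_trivial:
  assumes "virtual_string \<alpha>" "d \<in> \<alpha>" "semi_trivial (\<alpha>, d, \<epsilon>)"
  shows "class_generator (\<alpha>, d, \<epsilon>) = 0"
proof -
  have "(\<alpha>, d, \<epsilon>) \<in> singular_class (\<alpha>, d, \<epsilon>)" using assms by (simp add: singular_class_def)
  then show ?thesis using assms(3) unfolding class_generator_def semi_trivial_class_def by metis
qed

lemma mu_bij:
  assumes "bij_betw r \<alpha> \<beta>" "\<And>e \<epsilon>. e \<in> \<alpha> \<Longrightarrow> class_generator (\<alpha>, e, \<epsilon>) = class_generator (\<beta>, r e, \<epsilon>)"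
  shows "mu \<alpha> = mu \<beta>"
proof -
  have "mu \<beta> = (\<Sum>e\<in>\<alpha>. class_generator (\<beta>, r e, Plus) - class_generator (\<beta>, r e, Minus))"
    unfolding mu_def by (rule sum.reindex_bij_betw[OF assms(1), symmetric])
  then show ?thesis by (simp add: mu_def assms(2))
qed

text \<open>
  An arrow added by a Type 1 move is semi-trivial. The two arrows added by a Type 2 move are
  exchanged by a singular move that flips the sign, so their contributions cancel. All other
  arrows keep their classes.
\<close>

lemma mu_string_move: "string_move \<alpha> \<beta> \<Longrightarrow> mu \<alpha> = mu \<beta>"
proof (induction rule: string_move.induct)
  case (homeo \<alpha> h)
  show ?case
  proof (rule mu_bij)
    show "bij_betw (map_prod h h) \<alpha> (map_prod h h ` \<alpha>)"
      using homeo_string(2)[OF homeo] by (simp add: wedge_iso_def)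
  qed (use homeo in \<open>auto intro: generator_move singular_move.homeo\<close>)
next
  case (type1 \<alpha> \<beta>)
  obtain a b e where ab: "a \<in> S1" "b \<in> S1" "a \<noteq> b" "circle_arc a b \<inter> endpoints \<alpha> = {}"
    and \<beta>: "\<beta> = insert e \<alpha>" and e: "e = (a, b) \<or> e = (b, a)" and eA: "e \<notin> \<alpha>"
    and empty: "arc_interior a b \<inter> endpoints \<beta> = {}"
    using type1(3) by (rule type1E)
  have fin: "finite \<alpha>" using type1(1) by (rule virtual_stringD(1))
  have "class_generator (\<beta>, e, \<epsilon>) = 0" for \<epsilon>
    using e empty by (intro generator_semi_trivial[OF type1(2)]) (auto simp: \<beta>)
  moreover have "class_generator (\<alpha>, f, \<epsilon>) = class_generator (\<beta>, f, \<epsilon>)" if "f \<in> \<alpha>" for f \<epsilon>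
    using type1 that by (intro generator_move singular_move.type1)
  ultimately show ?case unfolding mu_def using eA fin by (simp add: \<beta>)
next
  case (type2 \<alpha> \<beta>)
  obtain a a' b b' x x' y y' where arcs: "disjoint_arcs2 a a' b b' x x' y y'"
    and \<beta>: "\<beta> = insert (a, b) (insert (b', a') \<alpha>)"
    and new: "(a, b) \<notin> \<alpha>" "(b', a') \<notin> \<alpha>" "(a, b) \<noteq> (b', a')"
    and "(circle_arc x x' \<union> circle_arc y y') \<inter> endpoints \<alpha> = {}"
    and emp: "(arc_interior x x' \<union> arc_interior y y') \<inter> endpoints \<beta> = {}"
    using type2 by (rule type2E)
  have fin: "finite \<alpha>" using type2(1) by (rule virtual_stringD(1))
  have "class_generator (\<beta>, (a, b), \<epsilon>) = class_generator (\<beta>, (b', a'), flip \<epsilon>)" for \<epsilon>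
    by (rule generator_move, rule singular_move.singular_type2[OF type2(2) _ _ arcs emp]) (auto simp: \<beta>)
  from this[of Plus] this[of Minus]
  have "class_generator (\<beta>, (a, b), Plus) - class_generator (\<beta>, (a, b), Minus) +
    (class_generator (\<beta>, (b', a'), Plus) - class_generator (\<beta>, (b', a'), Minus)) = 0" by simp
  moreover have "class_generator (\<alpha>, f, \<epsilon>) = class_generator (\<beta>, f, \<epsilon>)" if "f \<in> \<alpha>" for f \<epsilon>
    using type2 that by (intro generator_move singular_move.type2)
  then have "mu \<alpha> = (\<Sum>e\<in>\<alpha>. class_generator (\<beta>, e, Plus) - class_generator (\<beta>, e, Minus))"
    by (simp add: mu_def)
  moreover have "mu \<beta> = class_generator (\<beta>, (a, b), Plus) - class_generator (\<beta>, (a, b), Minus) +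
    (class_generator (\<beta>, (b', a'), Plus) - class_generator (\<beta>, (b', a'), Minus)) +
    (\<Sum>e\<in>\<alpha>. class_generator (\<beta>, e, Plus) - class_generator (\<beta>, e, Minus))"
    unfolding mu_def using new fin
    by (subst \<beta>, subst sum.insert, simp, simp, subst sum.insert) (simp_all add: add.assoc)
  ultimately show ?case by simp
next
  case (type3 \<alpha> \<beta> R)
  obtain r where r: "wedge_iso r \<alpha> \<beta>" "\<forall>(e, f)\<in>R. r e = f" "\<forall>e\<in>\<alpha> - Domain R. r e = e"
    using type3(1,3) by (rule type3_replacement)
  show ?case
  proof (rule mu_bij)
    show "bij_betw r \<alpha> \<beta>" using r(1) by (simp add: wedge_iso_def)
    fix e \<epsilon> assume e: "e \<in> \<alpha>"
    show "class_generator (\<alpha>, e, \<epsilon>) = class_generator (\<beta>, r e, \<epsilon>)"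
    proof (cases "e \<in> Domain R")
      case True
      then obtain f where f: "(e, f) \<in> R" by blast
      then have "singular_move (\<alpha>, e, \<epsilon>) (\<beta>, f, \<epsilon>)" using type3 by (intro singular_move.singular_type3)
      then show ?thesis using generator_move r(2) f by auto
    next
      case False
      then have "singular_move (\<alpha>, e, \<epsilon>) (\<beta>, e, \<epsilon>)" using type3 e by (intro singular_move.type3)
      then show ?thesis using generator_move r(3) e False by auto
    qed
  qed
qed

lemma mu_homotopic: "equivclp string_move \<alpha> \<beta> \<Longrightarrow> mu \<alpha> = mu \<beta>"
  by (induction rule: equivclp_induct) (auto dest: mu_string_move)

lemma min_arrows_bound:
  assumes "virtual_string \<alpha>"
  shows "coeff_sum (mu \<alpha>) \<le> 2 * int (min_arrows (homotopy_class \<alpha>))"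
proof -
  have "\<alpha> \<in> homotopy_class \<alpha>" using assms by (simp add: homotopy_class_def)
  then have "\<exists>n. \<exists>\<beta>\<in>homotopy_class \<alpha>. card \<beta> = n" by blast
  then have "\<exists>\<beta>\<in>homotopy_class \<alpha>. card \<beta> = min_arrows (homotopy_class \<alpha>)"
    unfolding min_arrows_def by (rule LeastI_ex)
  then obtain \<beta> where \<beta>: "equivclp string_move \<alpha> \<beta>" "card \<beta> = min_arrows (homotopy_class \<alpha>)"
    by (auto simp: homotopy_class_def)
  then show ?thesis using coeff_sum_mu_le[of \<beta>] mu_homotopic by metis
qed

lemma singular_move_flip:
  "singular_move x y \<Longrightarrow> singular_move (apsnd (apsnd flip) x) (apsnd (apsnd flip) y)"
proof (induction rule: singular_move.induct)
  case (singular_type2 \<alpha> a b b' a' x x' y y' d d' \<epsilon>)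
  then show ?case using singular_move.singular_type2[of \<alpha> a b b' a' x x' y y' d d' "flip \<epsilon>"] by simp
qed (auto intro: singular_move.intros)

lemma homotopic_flip:
  "equivclp singular_move x y \<Longrightarrow> equivclp singular_move (apsnd (apsnd flip) x) (apsnd (apsnd flip) y)"
proof (induction rule: equivclp_induct)
  case (step y z)
  let ?f = "apsnd (apsnd flip) :: singular_string \<Rightarrow> singular_string"
  have "singular_move (?f y) (?f z) \<or> singular_move (?f z) (?f y)"
    using step(2) singular_move_flip by blast
  with step(3) show ?case by (rule equivclp_into_equivclp)
qed simp

text \<open>
  All moves and the notion of being semi-trivial are insensitive to flipping all signs.
\<close>

lemma semi_trivial_class_flip:
  assumes "semi_trivial_class (singular_class (\<alpha>, e, \<epsilon>))"
  shows "semi_trivial_class (singular_class (\<alpha>, e, flip \<epsilon>))"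
proof -
  obtain y where y: "y \<in> singular_class (\<alpha>, e, \<epsilon>)" "semi_trivial y"
    using assms unfolding semi_trivial_class_def by blast
  obtain \<beta> a b \<delta> where y_eq: "y = (\<beta>, (a, b), \<delta>)" by (cases y) auto
  have "(\<beta>, (a, b), flip \<delta>) \<in> singular_class (\<alpha>, e, flip \<epsilon>)"
    using y(1) homotopic_flip[of "(\<alpha>, e, \<epsilon>)" y] by (auto simp: singular_class_def y_eq)
  moreover have "semi_trivial (\<beta>, (a, b), flip \<delta>)" using y(2) by (simp add: y_eq)
  ultimately show ?thesis unfolding semi_trivial_class_def by blast
qed

section \<open>Classes with an ordinary core or annihilating element\<close>

definition has_primitive ::
  "(('a, 'h::ab_group_add) sbmat \<Rightarrow> bool) \<Rightarrow> sign \<Rightarrow> ('a, 'h) sbmat \<Rightarrow> bool" where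
  "has_primitive K \<epsilon> T \<longleftrightarrow>
     (\<exists>P. singular_homologous T P \<and> singular_primitive P \<and> sgn_of P = \<epsilon> \<and> K P)"

abbreviation "has_core \<equiv> has_primitive ordinary_core"
abbreviation "has_annihilating \<equiv> has_primitive ordinary_annihilating"

lemma has_swap:
  fixes T :: "('a, 'h::ab_group_add) sbmat"
  assumes inf: "infinite (UNIV :: 'a set)"
  shows "has_core \<epsilon> T \<longleftrightarrow> has_annihilating (flip \<epsilon>) T"
proof
  assume "has_core \<epsilon> T"
  then obtain P where P: "singular_homologous T P" "singular_primitive P" "sgn_of P = \<epsilon>" "ordinary_core P"
    by (auto simp: has_primitive_def)
  then have "\<not> annihilating_like (underlying P)" "trivial_dist P" "core (underlying P) (dist_elem P)"
    by (auto simp: ordinary_core_def trivial_dist_def)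
  then obtain Q where "singular_homologous P Q" "singular_primitive Q" "sgn_of Q = flip (sgn_of P)"
    "ordinary_annihilating Q"
    using ordinary_swap[OF inf P(2)] by metis
  then show "has_annihilating (flip \<epsilon>) T"
    using P singular_homologous_trans unfolding has_primitive_def by blast
next
  assume "has_annihilating (flip \<epsilon>) T"
  then obtain P where P: "singular_homologous T P" "singular_primitive P" "sgn_of P = flip \<epsilon>" "ordinary_annihilating P"
    by (auto simp: has_primitive_def)
  then have "\<not> annihilating_like (underlying P)" "trivial_dist P" "annihilating (underlying P) (dist_elem P)"
    by (auto simp: ordinary_annihilating_def trivial_dist_def)
  then obtain Q where "singular_homologous P Q" "singular_primitive Q" "sgn_of Q = flip (sgn_of P)"
    "ordinary_core Q"
    using ordinary_swap[OF inf P(2)] by metis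
  then show "has_core \<epsilon> T"
    using P singular_homologous_trans unfolding has_primitive_def by (metis flip_flip)
qed

lemma singular_primitive_flip:
  assumes "singular_primitive P" "trivial_dist P" shows "singular_primitive (flip_sign P)"
proof -
  have "singular_matrix P" using assms(1) by (simp add: singular_primitive_def)
  moreover from this have "singular_matrix (flip_sign P)" by (simp add: singular_matrix_def)
  moreover have "trivial_dist (flip_sign P)" using assms(2) by (simp add: trivial_dist_def)
  moreover have "sremovable (flip_sign P) D = sremovable P D" for D by (simp add: sremovable_def)
  ultimately show ?thesis using assms singular_primitive_iff_trivial by metis
qed

lemma has_core_flip: "has_core \<epsilon> T \<Longrightarrow> has_core (flip \<epsilon>) (flip_sign T)"
  unfolding has_primitive_def
proof (elim exE conjE)
  fix P assume "singular_homologous T P" "singular_primitive P" "sgn_of P = \<epsilon>" "ordinary_core P"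
  then show "\<exists>P. singular_homologous (flip_sign T) P \<and> singular_primitive P \<and> sgn_of P = flip \<epsilon> \<and> ordinary_core P"
    using singular_homologous_flip[of T P] singular_primitive_flip[of P]
    by (intro exI[of _ "flip_sign P"]) (auto simp: ordinary_core_def trivial_dist_def)
qed

text \<open>
  Flipping all signs turns a core element with sign \<open>\<epsilon>\<close> into one with the opposite sign; by the
  swap this amounts to an annihilating element with sign \<open>\<epsilon>\<close>.
\<close>

lemma has_flip:
  fixes T :: "('a, 'h::ab_group_add) sbmat"
  assumes inf: "infinite (UNIV :: 'a set)"
  shows "has_core \<epsilon> (flip_sign T) \<longleftrightarrow> has_annihilating \<epsilon> T"
    "has_annihilating \<epsilon> (flip_sign T) \<longleftrightarrow> has_core \<epsilon> T"
proof -
  have core: "has_core \<epsilon> (flip_sign T) \<longleftrightarrow> has_core (flip \<epsilon>) T" for \<epsilon>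
    using has_core_flip[of \<epsilon> "flip_sign T"] has_core_flip[of "flip \<epsilon>" T] by auto
  show "has_core \<epsilon> (flip_sign T) \<longleftrightarrow> has_annihilating \<epsilon> T"
    using core has_swap[OF inf, of "flip \<epsilon>" T] by simp
  show "has_annihilating \<epsilon> (flip_sign T) \<longleftrightarrow> has_core \<epsilon> T"
    using core[of "flip \<epsilon>"] has_swap[OF inf, of "flip \<epsilon>" "flip_sign T"] by simp
qed

lemma has_cong:
  assumes "singular_homologous S T" shows "has_primitive K \<epsilon> S \<longleftrightarrow> has_primitive K \<epsilon> T"
  unfolding has_primitive_def
  using assms singular_homologous_sym singular_homologous_trans by blast

lemma mark_index_has:
  assumes H: "primitive H" and "has_core \<epsilon> T \<or> has_annihilating \<epsilon> T" shows "mark_index H T = 0"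
proof -
  obtain P where P: "singular_homologous T P" "singular_primitive P" "trivial_dist P"
    using assms(2) unfolding has_primitive_def trivial_dist_def
      ordinary_core_def ordinary_annihilating_def by blast
  then show ?thesis
    using mark_index_cong[OF P(1)] mark_index_trivial[OF H _ P(3)] by (simp add: singular_primitive_def)
qed

lemma standard_primitive_has:
  fixes T :: "('a, 'h::ab_group_add) sbmat"
  shows "(\<exists>P. standard_primitive T P \<and> ordinary_core P) \<longleftrightarrow> has_core (sgn_of T) T"
    "(\<exists>P. standard_primitive T P \<and> ordinary_annihilating P) \<longleftrightarrow> has_annihilating (sgn_of T) T"
  unfolding standard_primitive_def has_primitive_def by blast+

section \<open>The lower bound for \<open>t(\<mu>)\<close>\<close>

text \<open>
  The function on classes that is used as a functional. The two summands have disjoint supports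
  by \<open>mark_index_has\<close>, so the values stay between \<open>-1\<close> and \<open>1\<close>; the sign \<open>\<sigma>\<close> makes the second
  summand contribute the absolute value of \<open>C - A\<close>.
\<close>

definition class_index :: "(arrow option, int) bmat \<Rightarrow> int \<Rightarrow> (arrow option, int) sbmat \<Rightarrow> int" where
  "class_index H \<sigma> T = mark_index H T + \<sigma> * (of_bool (has_core Plus T) - of_bool (has_annihilating Plus T))"

lemma class_index_cong:
  "singular_homologous S T \<Longrightarrow> class_index H \<sigma> S = class_index H \<sigma> T"
  by (simp add: class_index_def mark_index_cong has_cong)

lemma abs_class_index_le:
  assumes "primitive H" "\<bar>\<sigma>\<bar> \<le> 1" shows "\<bar>class_index H \<sigma> T\<bar> \<le> 1"
  using assms mark_index_has[OF assms(1), of Plus T] abs_mark_index_le[of H T]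
  by (auto simp: class_index_def)

text \<open>
  The functional is evaluated at \<open>\<mu>\<close>. The first summand of \<open>class_index\<close> adds up to the total
  index of the matrix of \<open>\<alpha>\<close>; setting semi-trivial classes to zero does not disturb this, as their
  index is zero. In the second summand an arrow counted in \<open>C\<close> contributes \<open>\<sigma>\<close> with sign plus and
  \<open>- (- \<sigma>)\<close> with sign minus, one counted in \<open>A\<close> the opposite of this.
\<close>

lemma coeff_sum_mu_ge:
  assumes v: "virtual_string \<alpha>" and H: "primitive H" "homologous (string_matrix \<alpha>) H"
  shows "coeff_sum (mu \<alpha>) \<ge> 2 * (int (card (regular_elements H)) + O_number \<alpha>)"
proof -
  define \<sigma> where "\<sigma> = sgn (int (num_core \<alpha>) - int (num_annihilating \<alpha>))"
  let ?T = "\<lambda>e \<epsilon>. singular_string_matrix (\<alpha>, e, \<epsilon>)"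
  \<comment> \<open>By homotopy invariance the value does not depend on the chosen representative.\<close>
  define F where "F X = class_index H \<sigma> (singular_string_matrix (SOME x. x \<in> X))" for X
  have \<sigma>: "\<bar>\<sigma>\<bar> \<le> 1" by (simp add: \<sigma>_def sgn_if)
  have "\<bar>F X\<bar> \<le> 1" for X unfolding F_def by (rule abs_class_index_le[OF H(1) \<sigma>])
  then have le: "evaluate F (mu \<alpha>) \<le> coeff_sum (mu \<alpha>)" by (rule evaluate_le_coeff_sum)
  have F: "F (singular_class (\<alpha>, e, \<epsilon>)) = class_index H \<sigma> (?T e \<epsilon>)" if e: "e \<in> \<alpha>" for e \<epsilon>
  proof -
    have "(\<alpha>, e, \<epsilon>) \<in> singular_class (\<alpha>, e, \<epsilon>)" using v e by (simp add: singular_class_def)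
    then have "(SOME x. x \<in> singular_class (\<alpha>, e, \<epsilon>)) \<in> singular_class (\<alpha>, e, \<epsilon>)" by (rule someI)
    then have "equivclp singular_move (\<alpha>, e, \<epsilon>) (SOME x. x \<in> singular_class (\<alpha>, e, \<epsilon>))"
      by (auto simp: singular_class_def)
    from homotopic_homologous[OF this] show ?thesis
      unfolding F_def by (rule class_index_cong[symmetric])
  qed
  let ?st = "\<lambda>e \<epsilon>. semi_trivial_class (singular_class (\<alpha>, e, \<epsilon>))"
  have st_index: "mark_index H (?T e \<epsilon>) = 0" if st: "?st e \<epsilon>" for e \<epsilon>
  proof -
    obtain y where "y \<in> singular_class (\<alpha>, e, \<epsilon>)" "semi_trivial y"
      using st unfolding semi_trivial_class_def by blast
    moreover obtain \<beta> d \<delta> where "y = (\<beta>, d, \<delta>)" by (rule prod_cases3)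
    ultimately have y: "(\<beta>, d, \<delta>) \<in> singular_class (\<alpha>, e, \<epsilon>)" "semi_trivial (\<beta>, d, \<delta>)"
      by simp_all
    then have \<beta>: "virtual_string \<beta>" "d \<in> \<beta>" "equivclp singular_move (\<alpha>, e, \<epsilon>) (\<beta>, d, \<delta>)"
      by (auto simp: singular_class_def)
    have "mark_index H (singular_string_matrix (\<beta>, d, \<delta>)) = 0"
      using H(1) singular_matrix_string[OF \<beta>(1,2)] semi_trivial_dist[OF \<beta>(1,2) y(2)] by (rule mark_index_trivial)
    then show ?thesis using mark_index_cong[OF homotopic_homologous[OF \<beta>(3)]] by simp
  qed
  have st_flip: "?st e Plus \<longleftrightarrow> ?st e Minus" for e
    using semi_trivial_class_flip[of \<alpha> e Plus] semi_trivial_class_flip[of \<alpha> e Minus] by auto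
  have ev: "evaluate F (class_generator (\<alpha>, e, \<epsilon>)) = (if ?st e \<epsilon> then 0 else class_index H \<sigma> (?T e \<epsilon>))"
    if "e \<in> \<alpha>" for e \<epsilon>
    using F[OF that] by (simp add: evaluate_generator)
  let ?C = "\<lambda>e. of_bool (\<not> ?st e Plus \<and> has_core Plus (?T e Plus)) :: int"
  let ?A = "\<lambda>e. of_bool (\<not> ?st e Plus \<and> has_annihilating Plus (?T e Plus)) :: int"
  have contribution: "evaluate F (class_generator (\<alpha>, e, Plus) - class_generator (\<alpha>, e, Minus)) =
      index_difference H (string_matrix \<alpha>) (Some e) + 2 * \<sigma> * (?C e - ?A e)" if e: "e \<in> \<alpha>" for e
  proof -
    have flip: "?T e Minus = flip_sign (?T e Plus)" by (simp add: flip_sign_def)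
    have m: "index_difference H (string_matrix \<alpha>) (Some e) = mark_index H (?T e Plus) - mark_index H (?T e Minus)"
      by (simp add: index_difference_def)
    show ?thesis
    proof (cases "?st e Plus")
      case True
      then show ?thesis
        using st_flip st_index[of e Plus] st_index[of e Minus] by (simp add: m evaluate_diff ev[OF e])
    next
      case False
      then have "evaluate F (class_generator (\<alpha>, e, Plus) - class_generator (\<alpha>, e, Minus)) =
          class_index H \<sigma> (?T e Plus) - class_index H \<sigma> (?T e Minus)"
        using st_flip by (simp add: evaluate_diff ev[OF e])
      moreover have "class_index H \<sigma> (?T e Minus) = mark_index H (?T e Minus) +
          \<sigma> * (of_bool (has_annihilating Plus (?T e Plus)) - of_bool (has_core Plus (?T e Plus)))"
        unfolding class_index_def unfolding flip has_flip[OF infinite_arrow_option] ..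
      ultimately show ?thesis using False
        by (simp add: class_index_def m algebra_simps)
    qed
  qed
  have fin: "finite \<alpha>" using v by (rule virtual_stringD(1))
  have "evaluate F (mu \<alpha>) = (\<Sum>e\<in>\<alpha>. index_difference H (string_matrix \<alpha>) (Some e)) +
      2 * \<sigma> * ((\<Sum>e\<in>\<alpha>. ?C e) - (\<Sum>e\<in>\<alpha>. ?A e))"
    unfolding mu_def evaluate_sum
    by (simp add: contribution sum.distrib sum_distrib_left sum_subtractf right_diff_distrib)
  also have "(\<Sum>e\<in>\<alpha>. index_difference H (string_matrix \<alpha>) (Some e)) = total_index H (string_matrix \<alpha>)"
    by (simp add: total_index_def sum.reindex)
  also have "\<dots> = 2 * int (card (regular_elements H))"
    using total_index_homologous[OF H] total_index_primitive[OF H(1)] by simp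
  also have "(\<Sum>e\<in>\<alpha>. ?C e) = int (num_core \<alpha>)"
    using fin by (simp add: num_core_def standard_primitive_has sum.If_cases of_bool_def Int_def)
  also have "(\<Sum>e\<in>\<alpha>. ?A e) = int (num_annihilating \<alpha>)"
    using fin by (simp add: num_annihilating_def standard_primitive_has sum.If_cases of_bool_def Int_def)
  also have "2 * \<sigma> * (int (num_core \<alpha>) - int (num_annihilating \<alpha>)) = 2 * O_number \<alpha>"
    by (simp add: O_number_def \<sigma>_def sgn_if)
  finally show ?thesis using le by simp
qed

theorem theorem1p3:
  fixes \<alpha> :: "arrow set"
  assumes "virtual_string \<alpha>"
  shows "(real (min_arrows (homotopy_class \<alpha>)) \<ge> real_of_int (coeff_sum (mu \<alpha>)) / 2 \<and>
          real_of_int (coeff_sum (mu \<alpha>)) / 2 \<ge>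
            real (rho \<alpha>) - 1 + real_of_int (O_number \<alpha>) / 2) \<and>
         (\<not> (\<exists>g\<in>elems (primitive_matrix \<alpha>). self_complementary (primitive_matrix \<alpha>) g) \<longrightarrow>
          real (min_arrows (homotopy_class \<alpha>)) \<ge> real_of_int (coeff_sum (mu \<alpha>)) / 2 \<and>
          real_of_int (coeff_sum (mu \<alpha>)) / 2 \<ge>
            real (rho \<alpha>) + real_of_int (O_number \<alpha>) / 2)"
proof -
  let ?H = "primitive_matrix \<alpha>"
  have H: "primitive ?H" "homologous (string_matrix \<alpha>) ?H"
    using someI_ex[OF primitive_exists[OF based_string_matrix[OF assms]]]
    unfolding primitive_matrix_def by blast+
  have upper: "real_of_int (coeff_sum (mu \<alpha>)) / 2 \<le> real (min_arrows (homotopy_class \<alpha>))"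
    using min_arrows_bound[OF assms] by linarith
  have "real_of_int (coeff_sum (mu \<alpha>)) \<ge> real_of_int (2 * (int (card (regular_elements ?H)) + O_number \<alpha>))"
    using coeff_sum_mu_ge[OF assms H] by (rule of_int_le_iff[THEN iffD2])
  then have "real_of_int (coeff_sum (mu \<alpha>)) / 2 \<ge> real (card (regular_elements ?H)) + real_of_int (O_number \<alpha>)"
    by simp
  moreover have "real_of_int (O_number \<alpha>) \<ge> 0" by (simp add: O_number_def)
  ultimately have lower: "real_of_int (coeff_sum (mu \<alpha>)) / 2 \<ge>
      real (card (regular_elements ?H)) + real_of_int (O_number \<alpha>) / 2"
    by linarith
  have "real (rho \<alpha>) \<le> real (card (regular_elements ?H)) + 1"
    using card_regular_elements(1)[OF H(1)] unfolding rho_def by linarith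
  moreover have "real (rho \<alpha>) = real (card (regular_elements ?H))"
    if "\<not> (\<exists>g\<in>elems ?H. self_complementary ?H g)"
    using card_regular_elements(2)[OF H(1) that] unfolding rho_def by simp
  ultimately show ?thesis using upper lower by auto
qed

end
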